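(* Let $(V,\rho)\simeq(V_5,\rho_5)\oplus(V_3,\rho_3)\oplus(V_1,\rho_1)$, and let $\mathcal{T}=(T_1,T_2,T_3)$ be a spherically symmetric solution to Nahm's equations on a connected open interval whose generators induce the representation $(V,\rho)$. Then, in some gauge, there are real-valued real analytic functions $f_1,f_2,g_0,g_1$ on the domain of $\mathcal{T}$ such that for all $i\in\{1,2,3\}$ $$T_i=\begin{pmatrix} f_2Y_i^5 & g_1B_i^3 & 0\\ -g_1(B_i^3)^* & f_1Y_i^3 & g_0B_i^1\\ 0 & -g_0(B_i^1)^* & 0\end{pmatrix},$$ and $f_1,f_2,g_0,g_1$ satisfy $$\dot f_1=f_1^2+g_0^2-\tfrac56g_1^2,\quad \dot f_2=f_2^2+\tfrac12g_1^2,\quad \dot g_0=2f_1g_0,\quad \dot g_1=(3f_2-f_1)g_1.$$ These equations have the following maximally extended, irreducible solution on $(-1,1)$: $$f_1(t)=f_2(t)=-\frac{t}{t^2-1},\quad g_0(t)=\frac{\sqrt8}{\sqrt3\,(t^2-1)},\quad g_1(t)=\frac{\sqrt2}{t^2-1},$$ with residues $$\mathrm{Res}(f_1,\pm1)=\mathrm{Res}(f_2,\pm1)=-\tfrac12,\quad \mathrm{Res}(g_0,\pm1)=\pm\sqrt{\tfrac23},\quad \mathrm{Res}(g_1,\pm1)=\pm\tfrac1{\sqrt2}.$$ The corresponding Nahm datum (given by the displayed form of $T_i$ with these functions) induces representations of $\mathfrak{so}(3)$ isomorphic to $(V_3,\rho_3)^{\oplus3}$ at both poles $t=1$ and $t=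-1$.
   Context: Nahm's equations for a triple $\mathcal{T}=(T_1,T_2,T_3)$ of functions from an open interval to $\mathfrak{su}(N)$ (here $N=9$) are $\dot T_1=[T_2,T_3]$, $\dot T_2=[T_3,T_1]$, $\dot T_3=[T_1,T_2]$. For $A\in\mathrm{SO}(3)$ and $U\in\mathrm{SU}(N)$ set ${}^AT_i:=\sum_jA_{ij}T_j$ and ${}_UT_i:=UT_iU^{-1}$. A solution is spherically symmetric if for every $A\in\mathrm{SO}(3)$ there is $U_A\in\mathrm{SU}(N)$ with ${}^A\mathcal{T}={}_{U_A^{-1}}\mathcal{T}$. A triple $(Y_1,Y_2,Y_3)\in\mathfrak{su}(N)^{\oplus3}$ is a triple of generators of the spherical symmetry for $\mathcal{T}$ if $[Y_i,T_j]=\sum_{k}\epsilon_{ijk}T_k$ for all $i,j$ at every point of the domain ($\epsilon_{ijk}$ the Levi-Civita symbol). $(X_1,X_2,X_3)$ is the standard basis of $\mathfrak{so}(3)$, $(X_i)_{jk}=-\epsilon_{ijk}$. The generators induce the representation $\rho$ of $\mathfrak{so}(3)$ if $[Y_i,Y_j]=\sum_k\epsilon_{ijk}Y_k$ for all $i,j$ and $\rho(X_i)=Y_i$. "In some gauge" means after replacing all $T_i$ by $UT_iU^{-1}$ for some constant $U\in\mathrm{SU}(N)$. $(V_m,\rho_m)$ is the $m$-dimensional irreducible complex representation of the Lie algebra $\mathfrak{so}(3)$, with an invariant Hermitian inner product; $V\cong\mathbb{C}^N$ is the orthogonal direct sum, and block matrices are with respect to it. Put $Y_i^m:=\rho_m(X_i)$.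 $(B_1^m,B_2^m,B_3^m)$ is the triple of linear maps $B_i^m:V_m\to V_{m+2}$ (unique up to a $\mathrm{U}(1)$ factor) with $Y_j^{m+2}B_k^m-B_k^mY_j^m=\sum_{i=1}^3\epsilon_{ijk}B_i^m$ for all $j,k$, normalized by $\sum_{i=1}^3B_i^m(B_i^m)^*=\mathrm{Id}_{V_{m+2}}$. A Nahm datum is irreducible if there is no proper nonzero subspace of $\mathbb{C}^N$ invariant under $T_1(t),T_2(t),T_3(t)$ for all $t$ in the domain; a solution of the differential equations for $f_1,f_2,g_0,g_1$ is called irreducible if the corresponding Nahm datum is. Maximally extended means that the solution does not extend to a solution on a larger open interval. If $\mathcal{T}$ has a simple pole at $t_*$, the representation of $\mathfrak{so}(3)$ on $\mathbb{C}^N$ induced at $t_*$ is the linear map determined by $X_i\mapsto-\mathrm{Res}(T_i,t_* )$. *)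

theory Defs
  imports "HOL-Complex_Analysis.Complex_Analysis"
begin

(* Leaves $ as notation for vector components only. *)
no_notation fps_nth (infixl \<open>$\<close> 75)

section \<open>Matrices\<close>

definition cadj :: "complex^'n^'m \<Rightarrow> complex^'m^'n" where
  "cadj A = (\<chi> i j. cnj (A $ j $ i))"

definition mcomm :: "'a::ring_1^'n^'n \<Rightarrow> 'a^'n^'n \<Rightarrow> 'a^'n^'n" where
  "mcomm A B = A ** B - B ** A"

definition SU :: "(complex^'n^'n) set" where
  "SU = {U. U ** cadj U = mat 1 \<and> det U = 1}"

definition su :: "(complex^'n^'n) set" where
  "su = {A. cadj A = - A \<and> trace A = 0}"

definition gauge_act :: "complex^'n^'n \<Rightarrow> complex^'n^'n \<Rightarrow> complex^'n^'n" where
  "gauge_act U M = U ** M ** matrix_inv U"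

(* The sum type 'p + 'q + 'r indexes an orthonormal basis of the orthogonal direct sum of three
   spaces with orthonormal bases indexed by 'p, 'q and 'r. The arguments are the rows of blocks. *)
definition block3 ::
  "'a^'p1^'q1 \<Rightarrow> 'a^'p2^'q1 \<Rightarrow> 'a^'p3^'q1 \<Rightarrow>
   'a^'p1^'q2 \<Rightarrow> 'a^'p2^'q2 \<Rightarrow> 'a^'p3^'q2 \<Rightarrow>
   'a^'p1^'q3 \<Rightarrow> 'a^'p2^'q3 \<Rightarrow> 'a^'p3^'q3 \<Rightarrow> 'a^('p1 + 'p2 + 'p3)^('q1 + 'q2 + 'q3)" where
  "block3 A11 A12 A13 A21 A22 A23 A31 A32 A33 = (\<chi> r c.
     case r of
       Inl i \<Rightarrow>
         (case c of Inl j \<Rightarrow> A11 $ i $ j | Inr (Inl j) \<Rightarrow> A12 $ i $ j | Inr (Inr j) \<Rightarrow> A13 $ i $ j)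
     | Inr (Inl i) \<Rightarrow>
         (case c of Inl j \<Rightarrow> A21 $ i $ j | Inr (Inl j) \<Rightarrow> A22 $ i $ j | Inr (Inr j) \<Rightarrow> A23 $ i $ j)
     | Inr (Inr i) \<Rightarrow>
         (case c of Inl j \<Rightarrow> A31 $ i $ j | Inr (Inl j) \<Rightarrow> A32 $ i $ j | Inr (Inr j) \<Rightarrow> A33 $ i $ j))"

(* vec.subspace is the notion of a complex linear subspace; plain subspace would mean a real one. *)
definition irreducible_family :: "(complex^'n^'n) set \<Rightarrow> bool" where
  "irreducible_family S \<longleftrightarrow>
     (\<forall>W. vec.subspace W \<and> (\<forall>M\<in>S. \<forall>w\<in>W. M *v w \<in> W) \<longrightarrow> W = {0} \<or> W = UNIV)"


section \<open>Representations of so(3)\<close>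

(* The indices 1, 2, 3 are the elements of the three-element type 3 (where 3 = 0). *)
definition levi_civita :: "3 \<Rightarrow> 3 \<Rightarrow> 3 \<Rightarrow> real" where
  "levi_civita i j k =
     (if (i, j, k) \<in> {(1, 2, 3), (2, 3, 1), (3, 1, 2)} then 1
      else if (i, j, k) \<in> {(1, 3, 2), (2, 1, 3), (3, 2, 1)} then - 1
      else 0)"

definition so3 :: "(real^3^3) set" where
  "so3 = {A. transpose A = - A}"

definition so3_basis :: "3 \<Rightarrow> real^3^3" where
  "so3_basis i = (\<chi> j k. - levi_civita i j k)"

(* Only the values of \<rho> on so3 matter. *)
definition so3_rep :: "(real^3^3 \<Rightarrow> complex^'n^'n) \<Rightarrow> bool" where
  "so3_rep \<rho> \<longleftrightarrow>
     (\<forall>A\<in>so3. \<forall>B\<in>so3. \<rho> (A + B) = \<rho> A + \<rho> B) \<and>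
     (\<forall>c. \<forall>A\<in>so3. \<rho> (c *\<^sub>R A) = c *\<^sub>R \<rho> A) \<and>
     (\<forall>A\<in>so3. \<forall>B\<in>so3. \<rho> (mcomm A B) = mcomm (\<rho> A) (\<rho> B))"

(* Irreducible representation written in an orthonormal basis for an invariant Hermitian inner
   product; invariance says that so(3) acts by skew-Hermitian matrices. *)
definition irreducible_unitary_so3_rep :: "(real^3^3 \<Rightarrow> complex^'n^'n) \<Rightarrow> bool" where
  "irreducible_unitary_so3_rep \<rho> \<longleftrightarrow>
     so3_rep \<rho> \<and> (\<forall>A\<in>so3. cadj (\<rho> A) = - \<rho> A) \<and> irreducible_family (\<rho> ` so3)"

definition rep_sum3 ::
  "(real^3^3 \<Rightarrow> complex^'p^'p) \<Rightarrow> (real^3^3 \<Rightarrow> complex^'q^'q) \<Rightarrow> (real^3^3 \<Rightarrow> complex^'r^'r) \<Rightarrow>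
   real^3^3 \<Rightarrow> complex^('p + 'q + 'r)^('p + 'q + 'r)" where
  "rep_sum3 \<rho> \<sigma> \<tau> A = block3 (\<rho> A) 0 0  0 (\<sigma> A) 0  0 0 (\<tau> A)"

definition rep_isomorphic ::
  "(real^3^3 \<Rightarrow> complex^'n^'n) \<Rightarrow> (real^3^3 \<Rightarrow> complex^'m^'m) \<Rightarrow> bool" where
  "rep_isomorphic \<rho> \<sigma> \<longleftrightarrow>
     (\<exists>P :: complex^'m^'n. invertible P \<and> (\<forall>A\<in>so3. \<rho> A ** P = P ** \<sigma> A))"

(* The maps B_i from the space of \<rho> (dimension m) to the space of \<sigma> (dimension m + 2). *)
definition B_triple ::
  "(real^3^3 \<Rightarrow> complex^'m^'m) \<Rightarrow> (real^3^3 \<Rightarrow> complex^'n^'n) \<Rightarrow> (3 \<Rightarrow> complex^'m^'n) \<Rightarrow> bool" where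
  "B_triple \<rho> \<sigma> B \<longleftrightarrow>
     (\<forall>j k. \<sigma> (so3_basis j) ** B k - B k ** \<rho> (so3_basis j)
            = (\<Sum>i\<in>UNIV. levi_civita i j k *\<^sub>R B i)) \<and>
     (\<Sum>i\<in>UNIV. B i ** cadj (B i)) = mat 1"


section \<open>Nahm's equations\<close>

definition nahm_solution :: "(3 \<Rightarrow> real \<Rightarrow> complex^'n^'n) \<Rightarrow> real set \<Rightarrow> bool" where
  "nahm_solution T I \<longleftrightarrow>
     (\<forall>i. \<forall>t\<in>I. T i t \<in> su) \<and>
     (\<forall>t\<in>I. (T 1 has_vector_derivative mcomm (T 2 t) (T 3 t)) (at t)
          \<and> (T 2 has_vector_derivative mcomm (T 3 t) (T 1 t)) (at t)
          \<and> (T 3 has_vector_derivative mcomm (T 1 t) (T 2 t)) (at t))"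

definition spherically_symmetric :: "(3 \<Rightarrow> real \<Rightarrow> complex^'n^'n) \<Rightarrow> real set \<Rightarrow> bool" where
  "spherically_symmetric T I \<longleftrightarrow>
     (\<forall>A :: real^3^3. rotation_matrix A \<longrightarrow>
        (\<exists>U\<in>SU. \<forall>i. \<forall>t\<in>I. (\<Sum>j\<in>UNIV. (A $ i $ j) *\<^sub>R T j t) = gauge_act (matrix_inv U) (T i t)))"

definition symmetry_generators ::
  "(3 \<Rightarrow> complex^'n^'n) \<Rightarrow> (3 \<Rightarrow> real \<Rightarrow> complex^'n^'n) \<Rightarrow> real set \<Rightarrow> bool" where
  "symmetry_generators Y T I \<longleftrightarrow>
     (\<forall>i. Y i \<in> su) \<and>
     (\<forall>i j. \<forall>t\<in>I. mcomm (Y i) (T j t) = (\<Sum>k\<in>UNIV. levi_civita i j k *\<^sub>R T k t))"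

definition generators_induce ::
  "(3 \<Rightarrow> complex^'n^'n) \<Rightarrow> (real^3^3 \<Rightarrow> complex^'n^'n) \<Rightarrow> bool" where
  "generators_induce Y \<rho> \<longleftrightarrow>
     (\<forall>i j. mcomm (Y i) (Y j) = (\<Sum>k\<in>UNIV. levi_civita i j k *\<^sub>R Y k)) \<and>
     so3_rep \<rho> \<and> (\<forall>i. \<rho> (so3_basis i) = Y i)"

definition irreducible_datum :: "(3 \<Rightarrow> real \<Rightarrow> complex^'n^'n) \<Rightarrow> real set \<Rightarrow> bool" where
  "irreducible_datum T I \<longleftrightarrow> irreducible_family {T i t | i t. t \<in> I}"


section \<open>Real analyticity and residues\<close>

definition real_analytic_on :: "(real \<Rightarrow> real) \<Rightarrow> real set \<Rightarrow> bool" where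
  "real_analytic_on f I \<longleftrightarrow> (\<forall>x\<in>I. \<exists>F. (\<lambda>h. f (x + h)) has_fps_expansion F)"

(* F extends f, restricted to the points of I near t0, holomorphically to a punctured disc around
   t0. As t0 is a limit point of I, any two extensions agree near t0 as soon as they have at most
   poles there; t0 itself need not lie in I. *)
definition punctured_disc_extension ::
  "(real \<Rightarrow> complex) \<Rightarrow> real set \<Rightarrow> real \<Rightarrow> (complex \<Rightarrow> complex) \<Rightarrow> bool" where
  "punctured_disc_extension f I t0 F \<longleftrightarrow>
     t0 islimpt I \<and>
     (\<exists>r>0. F holomorphic_on ball (of_real t0) r - {of_real t0} \<and>
            (\<forall>t\<in>I. t \<noteq> t0 \<and> \<bar>t - t0\<bar> < r \<longrightarrow> F (of_real t) = f t))"

(* R is the residue at t0 of f, which has at most a simple pole there. *)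
definition simple_residue :: "(real \<Rightarrow> complex) \<Rightarrow> real set \<Rightarrow> real \<Rightarrow> complex \<Rightarrow> bool" where
  "simple_residue f I t0 R \<longleftrightarrow>
     (\<exists>F. punctured_disc_extension f I t0 F \<and>
          (\<exists>l. ((\<lambda>z. (z - of_real t0) * F z) \<longlongrightarrow> l) (at (of_real t0))) \<and>
          residue F (of_real t0) = R)"

(* A triple has a simple pole if its entries have at most simple poles and some residue is not 0. *)
definition simple_pole_residues ::
  "(3 \<Rightarrow> real \<Rightarrow> complex^'n^'n) \<Rightarrow> real set \<Rightarrow> real \<Rightarrow> (3 \<Rightarrow> complex^'n^'n) \<Rightarrow> bool" where
  "simple_pole_residues T I t0 R \<longleftrightarrow>
     (\<forall>i a b. simple_residue (\<lambda>t. T i t $ a $ b) I t0 (R i $ a $ b)) \<and> (\<exists>i. R i \<noteq> 0)"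

definition induced_rep_at_pole ::
  "(3 \<Rightarrow> real \<Rightarrow> complex^'n^'n) \<Rightarrow> real set \<Rightarrow> real \<Rightarrow> (real^3^3 \<Rightarrow> complex^'n^'n) \<Rightarrow> bool" where
  "induced_rep_at_pole T I t0 \<sigma> \<longleftrightarrow>
     so3_rep \<sigma> \<and> (\<exists>R. simple_pole_residues T I t0 R \<and> (\<forall>i. \<sigma> (so3_basis i) = - R i))"


section \<open>The reduced system\<close>

definition ansatz ::
  "(real^3^3 \<Rightarrow> complex^5^5) \<Rightarrow> (real^3^3 \<Rightarrow> complex^3^3) \<Rightarrow> (3 \<Rightarrow> complex^3^5) \<Rightarrow> (3 \<Rightarrow> complex^1^3) \<Rightarrow>
   (real \<Rightarrow> real) \<Rightarrow> (real \<Rightarrow> real) \<Rightarrow> (real \<Rightarrow> real) \<Rightarrow> (real \<Rightarrow> real) \<Rightarrow>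
   3 \<Rightarrow> real \<Rightarrow> complex^(5 + 3 + 1)^(5 + 3 + 1)" where
  "ansatz \<rho>5 \<rho>3 B3 B1 f1 f2 g0 g1 i t = block3
     (f2 t *\<^sub>R \<rho>5 (so3_basis i))   (g1 t *\<^sub>R B3 i)                 0
     (- (g1 t *\<^sub>R cadj (B3 i)))   (f1 t *\<^sub>R \<rho>3 (so3_basis i))   (g0 t *\<^sub>R B1 i)
     0                            (- (g0 t *\<^sub>R cadj (B1 i)))     0"

definition reduced_solution ::
  "(real \<Rightarrow> real) \<Rightarrow> (real \<Rightarrow> real) \<Rightarrow> (real \<Rightarrow> real) \<Rightarrow> (real \<Rightarrow> real) \<Rightarrow> real set \<Rightarrow> bool" where
  "reduced_solution f1 f2 g0 g1 I \<longleftrightarrow> (\<forall>t\<in>I.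
     (f1 has_real_derivative (f1 t)\<^sup>2 + (g0 t)\<^sup>2 - 5/6 * (g1 t)\<^sup>2) (at t) \<and>
     (f2 has_real_derivative (f2 t)\<^sup>2 + 1/2 * (g1 t)\<^sup>2) (at t) \<and>
     (g0 has_real_derivative 2 * f1 t * g0 t) (at t) \<and>
     (g1 has_real_derivative (3 * f2 t - f1 t) * g1 t) (at t))"

definition maximally_extended_reduced_solution ::
  "(real \<Rightarrow> real) \<Rightarrow> (real \<Rightarrow> real) \<Rightarrow> (real \<Rightarrow> real) \<Rightarrow> (real \<Rightarrow> real) \<Rightarrow> real set \<Rightarrow> bool" where
  "maximally_extended_reduced_solution f1 f2 g0 g1 I \<longleftrightarrow>
     reduced_solution f1 f2 g0 g1 I \<and>
     \<not> (\<exists>J F1 F2 G0 G1. open J \<and> is_interval J \<and> I \<subset> J \<and> reduced_solution F1 F2 G0 G1 J \<and>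
          (\<forall>t\<in>I. F1 t = f1 t \<and> F2 t = f2 t \<and> G0 t = g0 t \<and> G1 t = g1 t))"

end

theory Submission
  imports Defs "HOL-Computational_Algebra.Fundamental_Theorem_Algebra"
begin

text \<open>
  Write \<open>B\<^sub>i\<close> for the maps from \<open>V\<^sub>3\<close> to \<open>V\<^sub>5\<close> and \<open>b\<^sub>i\<close> for those from \<open>V\<^sub>1\<close> to \<open>V\<^sub>3\<close>.
  The \<open>b\<^sub>i\<close> are an orthonormal basis of \<open>V\<^sub>3\<close>. The sums of \<open>B\<^sub>i Y\<^sub>i\<close> and of \<open>B\<^sub>i b\<^sub>i\<close> are
  intertwiners into \<open>V\<^sub>5\<close> from smaller spaces, hence vanish: the vectors \<open>B\<^sub>i b\<^sub>j\<close> of \<open>V\<^sub>5\<close> are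
  symmetric and traceless in \<open>i, j\<close>. Comparing traces of projections identifies \<open>V\<^sub>5\<close> with the
  traceless symmetric tensors, i.e. gives \<open>B\<^sub>i\<^sup>* B\<^sub>k\<close> explicitly, and all products needed for
  Nahm's equations follow without choosing a basis of \<open>V\<^sub>5\<close>.

  A generator triple is unitarily equivalent to the given one because the positive intertwiner
  \<open>P\<^sup>* P\<close> is block scalar by Schur's lemma. Schur's lemma and the projection theorem then force
  every equivariant triple into block form, with complex off-diagonal coefficients. These satisfy
  linear differential equations with real coefficients, so they have constant phase and a diagonal
  gauge transformation makes them real. Solutions of the quadratic system are analytic since their
  \<open>n\<close>-th derivatives are bounded by \<open>n! M (K M)\<^sup>n\<close>.

  At \<open>t = \<plusminus>1\<close> the space becomes \<open>V\<^sub>3 \<otimes> \<complex>\<^sup>3\<close>; the intertwiner consists of multiples of \<open>B\<^sub>k\<close>,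
  \<open>Y\<^sub>k\<close> and \<open>b\<^sub>k\<^sup>*\<close> for \<open>k = 1, 2, 3\<close>.
\<close>

section \<open>Matrix algebra\<close>

lemma matrix_mult_entry: "(A ** B) $ i $ j = (\<Sum>k\<in>UNIV. A $ i $ k * B $ k $ j)"
  by (simp add: matrix_matrix_mult_def)

lemma matrix_mult_minus_right: "(A :: 'a::ring_1^'n^'m) ** (- B) = - (A ** B)"
  by (simp add: vec_eq_iff matrix_mult_entry sum_negf)

lemma matrix_mult_minus_left: "(- A :: 'a::ring_1^'n^'m) ** B = - (A ** B)"
  by (simp add: vec_eq_iff matrix_mult_entry sum_negf)

lemma matrix_add_rdistrib: "(A + B :: 'a::ring_1^'n^'m) ** C = A ** C + B ** C"
  by (simp add: vec_eq_iff matrix_mult_entry sum.distrib algebra_simps)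

lemma matrix_diff_ldistrib: "(A :: 'a::ring_1^'n^'m) ** (B - C) = A ** B - A ** C"
  by (simp add: vec_eq_iff matrix_mult_entry sum_subtractf algebra_simps)

lemma matrix_diff_rdistrib: "(A - B :: 'a::ring_1^'n^'m) ** C = A ** C - B ** C"
  by (simp add: vec_eq_iff matrix_mult_entry sum_subtractf algebra_simps)

lemma matrix_scaleR_right: "(A :: 'a::real_algebra_1^'n^'m) ** (r *\<^sub>R B) = r *\<^sub>R (A ** B)"
  by (simp add: vec_eq_iff matrix_mult_entry scaleR_sum_right)

lemma matrix_scaleR_left: "(r *\<^sub>R A :: 'a::real_algebra_1^'n^'m) ** B = r *\<^sub>R (A ** B)"
  by (simp add: vec_eq_iff matrix_mult_entry scaleR_sum_right)

lemma matrix_sum_right: "(A :: 'a::ring_1^'n^'m) ** sum f S = (\<Sum>x\<in>S. A ** f x)"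
  by (induction S rule: infinite_finite_induct) (simp_all add: matrix_add_ldistrib)

lemma matrix_sum_left: "sum f S ** (A :: 'a::ring_1^'n^'m) = (\<Sum>x\<in>S. f x ** A)"
  by (induction S rule: infinite_finite_induct) (simp_all add: matrix_add_rdistrib)

lemma matrix_assoc_right: "(A ** B) ** (C :: 'a::semiring_1^'n^'m) = A ** (B ** C)"
  by (simp add: matrix_mul_assoc)

lemmas matrix_ring_simps = matrix_assoc_right matrix_add_ldistrib matrix_add_rdistrib
  matrix_diff_ldistrib matrix_diff_rdistrib matrix_mult_minus_left matrix_mult_minus_right
  matrix_scaleR_left matrix_scaleR_right

section \<open>Conjugate transposes\<close>

lemma cadj_cadj [simp]: "cadj (cadj A) = A"
  by (simp add: cadj_def vec_eq_iff)

lemma cadj_mult: "cadj (A ** B) = cadj B ** cadj A"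
  by (simp add: cadj_def vec_eq_iff matrix_mult_entry mult.commute)

lemma cadj_0 [simp]: "cadj 0 = 0"
  by (simp add: cadj_def vec_eq_iff)

lemma cadj_mat: "cadj (mat c) = mat (cnj c)"
  by (simp add: cadj_def vec_eq_iff mat_def)

lemma cadj_one [simp]: "cadj (mat 1) = mat 1"
  by (simp add: cadj_mat)

lemma cadj_add: "cadj (A + B) = cadj A + cadj B"
  by (simp add: cadj_def vec_eq_iff)

lemma cadj_diff: "cadj (A - B) = cadj A - cadj B"
  by (simp add: cadj_def vec_eq_iff)

lemma cadj_minus: "cadj (- A) = - cadj A"
  by (simp add: cadj_def vec_eq_iff)

lemma cadj_scaleR: "cadj (r *\<^sub>R A) = r *\<^sub>R cadj A"
  by (simp add: cadj_def vec_eq_iff)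

lemma cadj_sum: "cadj (sum f S) = (\<Sum>x\<in>S. cadj (f x))"
  by (induction S rule: infinite_finite_induct) (simp_all add: cadj_add)

lemmas cadj_simps = cadj_mult cadj_add cadj_diff cadj_minus cadj_scaleR cadj_sum

section \<open>Traces and the Hilbert-Schmidt norm\<close>

lemma trace_mult_commute: "trace ((A :: complex^'n^'m) ** B) = trace (B ** A)"
  unfolding trace_def matrix_mult_entry by (subst sum.swap) (simp add: mult.commute)

lemma trace_scaleR: "trace (r *\<^sub>R A :: complex^'n^'n) = r *\<^sub>R trace A"
  by (simp add: trace_def scaleR_sum_right)

lemma trace_sum: "trace (sum f S :: complex^'n^'n) = (\<Sum>x\<in>S. trace (f x))"
  unfolding trace_def sum_component by (rule sum.swap)

lemma trace_mult_cadj: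
  "trace (A ** cadj A) = of_real (\<Sum>i\<in>UNIV. \<Sum>j\<in>UNIV. (cmod (A $ i $ j))\<^sup>2)"
  by (simp add: trace_def matrix_mult_entry cadj_def complex_norm_square [symmetric])

text \<open>The trace of \<open>Z ** cadj Z\<close> is the sum of the squared moduli of the entries.
  This positivity later turns equal traces of two nested projections into equality.\<close>

lemma sum_mult_cadj_eq_0:
  fixes Z :: "'a \<Rightarrow> complex^'n^'m"
  assumes "finite S" "(\<Sum>x\<in>S. trace (Z x ** cadj (Z x))) = 0" "x \<in> S"
  shows "Z x = 0"
proof -
  have "(\<Sum>x\<in>S. \<Sum>i\<in>UNIV. \<Sum>j\<in>UNIV. (cmod (Z x $ i $ j))\<^sup>2) = 0"
    using assms(2) unfolding trace_mult_cadj of_real_sum [symmetric]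
    by (simp only: of_real_eq_0_iff)
  then have "(\<Sum>i\<in>UNIV. \<Sum>j\<in>UNIV. (cmod (Z x $ i $ j))\<^sup>2) = 0"
    using assms(1,3) by (subst (asm) sum_nonneg_eq_0_iff) (auto intro!: sum_nonneg)
  then show ?thesis
    by (simp add: sum_nonneg_eq_0_iff sum_nonneg vec_eq_iff)
qed

section \<open>Scalar matrices in the role of complex scalars\<close>

lemma mat_mult_entry: "(mat c ** A) $ i $ j = c * A $ i $ j"
  by (simp add: matrix_mult_entry mat_def if_distrib [of "\<lambda>x. x * _"] cong: if_cong)

lemma mult_mat_entry: "(A ** mat c) $ i $ j = A $ i $ j * c"
  by (simp add: matrix_mult_entry mat_def if_distrib [of "\<lambda>x. _ * x"] cong: if_cong)

lemma mat_commute: "mat c ** (A :: complex^'n^'m) = A ** mat c"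
  by (simp add: vec_eq_iff mat_mult_entry mult_mat_entry mult.commute)

lemma mat_of_real_mult: "mat (complex_of_real r) ** (A :: complex^'n^'m) = r *\<^sub>R A"
  unfolding vec_eq_iff mat_mult_entry vector_scaleR_component
  by (simp add: scaleR_conv_of_real)

lemma mat_mult_mat_mult: "mat c ** (mat d ** (A :: complex^'n^'m)) = mat (c * d) ** A"
  by (simp add: vec_eq_iff mat_mult_entry)

lemma mult_mat_mult: "(A :: complex^'n^'m) ** (mat c ** B) = mat c ** (A ** B)"
  by (simp add: vec_eq_iff mat_mult_entry)
    (simp add: matrix_mult_entry [of A] mat_mult_entry sum_distrib_left mult_ac)

lemma cadj_mat_mult: "cadj (mat c ** A) = mat (cnj c) ** cadj A"
  by (simp add: vec_eq_iff cadj_def mat_mult_entry)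

lemma unitary_matrix_inv:
  fixes U :: "complex^'n^'n"
  assumes "U ** cadj U = mat 1"
  shows "matrix_inv U = cadj U"
proof -
  \<comment> \<open>\<open>matrix_inv\<close> is a choice among two-sided inverses, so one has to be
    exhibited first.\<close>
  have "\<exists>V. U ** V = mat 1 \<and> V ** U = mat 1"
    using assms matrix_left_right_inverse by blast
  then have *: "U ** matrix_inv U = mat 1"
    unfolding matrix_inv_def by (rule someI2_ex) simp
  have "cadj U ** U = mat 1"
    using assms matrix_left_right_inverse by blast
  then have "matrix_inv U = (cadj U ** U) ** matrix_inv U"
    by simp
  then show ?thesis
    by (simp only: matrix_assoc_right * matrix_mul_rid)
qed

lemma sum_UNIV_Plus:
  "(\<Sum>x\<in>(UNIV :: ('a::finite + 'b::finite) set). f x) = (\<Sum>x\<in>UNIV. f (Inl x)) + (\<Sum>x\<in>UNIV. f (Inr x))"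
  using sum.Plus [of "UNIV :: 'a set" "UNIV :: 'b set" f] by simp

subsection \<open>Block matrices\<close>

lemma block3_entry [simp]:
  "block3 A11 A12 A13 A21 A22 A23 A31 A32 A33 $ Inl i $ Inl j = A11 $ i $ j"
  "block3 A11 A12 A13 A21 A22 A23 A31 A32 A33 $ Inl i $ Inr (Inl k) = A12 $ i $ k"
  "block3 A11 A12 A13 A21 A22 A23 A31 A32 A33 $ Inl i $ Inr (Inr l) = A13 $ i $ l"
  "block3 A11 A12 A13 A21 A22 A23 A31 A32 A33 $ Inr (Inl m) $ Inl j = A21 $ m $ j"
  "block3 A11 A12 A13 A21 A22 A23 A31 A32 A33 $ Inr (Inl m) $ Inr (Inl k) = A22 $ m $ k"
  "block3 A11 A12 A13 A21 A22 A23 A31 A32 A33 $ Inr (Inl m) $ Inr (Inr l) = A23 $ m $ l"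
  "block3 A11 A12 A13 A21 A22 A23 A31 A32 A33 $ Inr (Inr n) $ Inl j = A31 $ n $ j"
  "block3 A11 A12 A13 A21 A22 A23 A31 A32 A33 $ Inr (Inr n) $ Inr (Inl k) = A32 $ n $ k"
  "block3 A11 A12 A13 A21 A22 A23 A31 A32 A33 $ Inr (Inr n) $ Inr (Inr l) = A33 $ n $ l"
  by (simp_all add: block3_def)

lemma matrix_eq_sum_type_iff:
  "(M :: 'a^('p1::finite + 'p2::finite + 'p3::finite)^('q1::finite + 'q2::finite + 'q3::finite)) = N \<longleftrightarrow>
   (\<forall>i j. M $ Inl i $ Inl j = N $ Inl i $ Inl j) \<and>
   (\<forall>i j. M $ Inl i $ Inr (Inl j) = N $ Inl i $ Inr (Inl j)) \<and>
   (\<forall>i j. M $ Inl i $ Inr (Inr j) = N $ Inl i $ Inr (Inr j)) \<and>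
   (\<forall>i j. M $ Inr (Inl i) $ Inl j = N $ Inr (Inl i) $ Inl j) \<and>
   (\<forall>i j. M $ Inr (Inl i) $ Inr (Inl j) = N $ Inr (Inl i) $ Inr (Inl j)) \<and>
   (\<forall>i j. M $ Inr (Inl i) $ Inr (Inr j) = N $ Inr (Inl i) $ Inr (Inr j)) \<and>
   (\<forall>i j. M $ Inr (Inr i) $ Inl j = N $ Inr (Inr i) $ Inl j) \<and>
   (\<forall>i j. M $ Inr (Inr i) $ Inr (Inl j) = N $ Inr (Inr i) $ Inr (Inl j)) \<and>
   (\<forall>i j. M $ Inr (Inr i) $ Inr (Inr j) = N $ Inr (Inr i) $ Inr (Inr j))"
  by (auto simp: vec_eq_iff split_sum_all)

lemma block3_eq_iff:
  "block3 A11 A12 A13 A21 A22 A23 A31 A32 A33 = block3 B11 B12 B13 B21 B22 B23 B31 B32 B33 \<longleftrightarrow>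
   A11 = B11 \<and> A12 = B12 \<and> A13 = B13 \<and> A21 = B21 \<and> A22 = B22 \<and> A23 = B23 \<and>
   A31 = B31 \<and> A32 = B32 \<and> A33 = B33"
  by (simp add: matrix_eq_sum_type_iff) (simp add: vec_eq_iff)

lemma block3_exhaust:
  fixes M :: "'a^('p1::finite + 'p2::finite + 'p3::finite)^('q1::finite + 'q2::finite + 'q3::finite)"
  obtains A11 A12 A13 A21 A22 A23 A31 A32 A33
  where "M = block3 A11 A12 A13 A21 A22 A23 A31 A32 A33"
proof
  show "M = block3
     (\<chi> i j. M $ Inl i $ Inl j) (\<chi> i j. M $ Inl i $ Inr (Inl j)) (\<chi> i j. M $ Inl i $ Inr (Inr j))
     (\<chi> i j. M $ Inr (Inl i) $ Inl j) (\<chi> i j. M $ Inr (Inl i) $ Inr (Inl j)) (\<chi> i j. M $ Inr (Inl i) $ Inr (Inr j))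
     (\<chi> i j. M $ Inr (Inr i) $ Inl j) (\<chi> i j. M $ Inr (Inr i) $ Inr (Inl j)) (\<chi> i j. M $ Inr (Inr i) $ Inr (Inr j))"
    by (simp add: matrix_eq_sum_type_iff)
qed

lemma block3_mult:
  "block3 A11 A12 A13 A21 A22 A23 A31 A32 A33 ** block3 B11 B12 B13 B21 B22 B23 B31 B32 B33 =
   block3
     (A11 ** B11 + A12 ** B21 + A13 ** B31) (A11 ** B12 + A12 ** B22 + A13 ** B32) (A11 ** B13 + A12 ** B23 + A13 ** B33)
     (A21 ** B11 + A22 ** B21 + A23 ** B31) (A21 ** B12 + A22 ** B22 + A23 ** B32) (A21 ** B13 + A22 ** B23 + A23 ** B33)
     (A31 ** B11 + A32 ** B21 + A33 ** B31) (A31 ** B12 + A32 ** B22 + A33 ** B32) (A31 ** B13 + A32 ** B23 + A33 ** B33)"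
  by (simp add: matrix_eq_sum_type_iff matrix_mult_entry sum_UNIV_Plus add.assoc)

lemma block3_add:
  "block3 A11 A12 A13 A21 A22 A23 A31 A32 A33 + block3 B11 B12 B13 B21 B22 B23 B31 B32 B33 =
   block3 (A11 + B11) (A12 + B12) (A13 + B13) (A21 + B21) (A22 + B22) (A23 + B23) (A31 + B31) (A32 + B32) (A33 + B33)"
  by (simp add: matrix_eq_sum_type_iff)

lemma block3_diff:
  "block3 A11 A12 A13 A21 A22 A23 A31 A32 A33 - block3 B11 B12 B13 B21 B22 B23 B31 B32 B33 =
   block3 (A11 - B11) (A12 - B12) (A13 - B13) (A21 - B21) (A22 - B22) (A23 - B23) (A31 - B31) (A32 - B32) (A33 - B33)"
  by (simp add: matrix_eq_sum_type_iff)

lemma block3_minus: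
  "- block3 A11 A12 A13 A21 A22 A23 A31 A32 A33 =
   block3 (- A11) (- A12) (- A13) (- A21) (- A22) (- A23) (- A31) (- A32) (- A33)"
  by (simp add: matrix_eq_sum_type_iff)

lemma block3_scaleR:
  "r *\<^sub>R block3 A11 A12 A13 A21 A22 A23 A31 A32 A33 =
   block3 (r *\<^sub>R A11) (r *\<^sub>R A12) (r *\<^sub>R A13) (r *\<^sub>R A21) (r *\<^sub>R A22) (r *\<^sub>R A23) (r *\<^sub>R A31) (r *\<^sub>R A32) (r *\<^sub>R A33)"
  by (simp add: matrix_eq_sum_type_iff)

lemma block3_0: "block3 0 0 0 0 0 0 0 0 0 = 0"
  by (simp add: matrix_eq_sum_type_iff)

lemma block3_sum:
  "(\<Sum>x\<in>S. block3 (A11 x) (A12 x) (A13 x) (A21 x) (A22 x) (A23 x) (A31 x) (A32 x) (A33 x)) =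
   block3 (sum A11 S) (sum A12 S) (sum A13 S) (sum A21 S) (sum A22 S) (sum A23 S)
     (sum A31 S) (sum A32 S) (sum A33 S)"
  by (induction S rule: infinite_finite_induct) (simp_all add: block3_0 block3_add)

lemma cadj_block3:
  "cadj (block3 A11 A12 A13 A21 A22 A23 A31 A32 A33) =
   block3 (cadj A11) (cadj A21) (cadj A31) (cadj A12) (cadj A22) (cadj A32) (cadj A13) (cadj A23) (cadj A33)"
  by (simp add: matrix_eq_sum_type_iff cadj_def)

lemma block3_mat: "block3 (mat c) 0 0 0 (mat c) 0 0 0 (mat c) = mat c"
  by (simp add: matrix_eq_sum_type_iff mat_def)

lemma trace_block3:
  "trace (block3 A11 A12 A13 A21 A22 A23 A31 A32 A33 :: complex^('p::finite + 'q::finite + 'r::finite)^('p + 'q + 'r)) =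
   trace A11 + trace A22 + trace A33"
  by (simp add: trace_def sum_UNIV_Plus add.assoc)

lemmas block3_simps = block3_mult block3_add block3_diff block3_minus block3_scaleR block3_sum cadj_block3

section \<open>Schur's lemma\<close>

text \<open>In the Leibniz expansion each permutation contributes a product of linear polynomials.
  Nothing is recorded about the degree.\<close>

lemma det_pencil_poly:
  fixes A B :: "complex^'n^'n"
  shows "\<exists>p. \<forall>x. poly p x = det (A + mat x ** B)"
proof -
  let ?p = "\<Sum>p\<in>{p. p permutes (UNIV :: 'n set)}.
      [: of_int (sign p) :] * (\<Prod>i\<in>UNIV. [: A $ i $ p i, B $ i $ p i :])"
  have "poly ?p x = det (A + mat x ** B)" for x
    by (simp add: det_def poly_sum poly_prod mat_mult_entry)
  then show ?thesis by blast
qed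

lemma det_mat_mult: "det (mat c ** (A :: complex^'n^'n)) = c ^ CARD('n) * det A"
proof -
  have "mat c ** A = (\<chi> i. c *s row i A)"
    by (simp add: vec_eq_iff mat_mult_entry row_def)
  then show ?thesis
    using det_rows_mul [of "\<lambda>_. c" "\<lambda>i. row i A"] by (simp add: row_def)
qed

text \<open>For p(x) = det (x - A) and q(y) = det (1 - y A) one has q(y) = y^n p(1/y) when y is
  nonzero. A rootless p would be a constant c, so q(y) = c y^n at infinitely many y and q(0) = 0;
  but q(0) = det 1 = 1. This takes the place of computing the degree of p.\<close>

lemma complex_eigenvector:
  fixes A :: "complex^'n^'n"
  obtains x v where "v \<noteq> 0" "A *v v = x *s v"
proof -
  obtain p where p: "\<And>x. poly p x = det (- A + mat x ** mat 1)"
    using det_pencil_poly [of "- A" "mat 1"] by auto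
  obtain q where q: "\<And>x. poly q x = det (mat 1 + mat x ** (- A))"
    using det_pencil_poly [of "mat 1" "- A"] by auto
  have pq: "poly q y = y ^ CARD('n) * poly p (1 / y)" if "y \<noteq> 0" for y
  proof -
    have "mat y ** (- A + mat (1 / y)) = mat 1 + mat y ** (- A)"
      using that by (simp add: vec_eq_iff mat_mult_entry) (simp add: mat_def field_simps)
    then show ?thesis
      unfolding p q matrix_mul_rid by (metis det_mat_mult)
  qed
  have "\<exists>x. poly p x = 0"
  proof (rule ccontr)
    assume no: "\<not> ?thesis"
    then obtain c where "p = [: c :]"
      using fundamental_theorem_of_algebra_alt [of p] by metis
    then have c: "poly p x = c" for x
      by simp
    have "poly (q - monom c CARD('n)) y = 0" if "y \<noteq> 0" for y
      using pq [OF that] by (simp add: c poly_monom)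
    then have "UNIV - {0} \<subseteq> {y. poly (q - monom c CARD('n)) y = 0}"
      by auto
    moreover have "infinite (UNIV - {0 :: complex})"
      using infinite_UNIV_char_0 by simp
    ultimately have "q - monom c CARD('n) = 0"
      using poly_roots_finite infinite_super by blast
    then have "poly q 0 = 0"
      by (simp add: poly_monom)
    then show False
      by (simp add: q)
  qed
  then obtain x where "det (- A + mat x) = 0"
    using p by (auto simp: matrix_mul_rid)
  then obtain v where v: "v \<noteq> 0" "(- A + mat x) *v v = 0"
    by (meson invertible_det_nz invertible_left_inverse matrix_left_invertible_ker)
  have "mat x *v v = x *s v"
    by (simp add: vec_eq_iff matrix_vector_mult_def mat_def if_distrib [of "\<lambda>x. x * _"] cong: if_cong)
  then have "A *v v = x *s v"
    using v(2) by (simp add: matrix_vector_mult_diff_rdistrib)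
  with v(1) show ?thesis by (rule that)
qed

text \<open>An eigenspace of \<open>Z\<close> is nonzero and invariant under the family, hence is
  the whole space.\<close>

lemma irreducible_commuting_scalar:
  assumes irr: "irreducible_family S" and comm: "\<And>M. M \<in> S \<Longrightarrow> Z ** M = M ** Z"
  shows "\<exists>c. Z = mat c"
proof -
  obtain c v where v: "v \<noteq> 0" "Z *v v = c *s v"
    by (rule complex_eigenvector)
  let ?W = "{w. Z *v w = c *s w}"
  have "vec.subspace ?W"
    by (auto simp: vec.subspace_def matrix_vector_right_distrib vec.scale
        vector_add_ldistrib mult.commute)
  moreover have "M *v w \<in> ?W" if "M \<in> S" "w \<in> ?W" for M w
  proof -
    have "Z *v (M *v w) = M *v (Z *v w)"
      by (simp add: matrix_vector_mul_assoc comm that)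
    then show ?thesis using that by (simp add: vec.scale)
  qed
  ultimately have "?W = {0} \<or> ?W = UNIV"
    using irr unfolding irreducible_family_def by blast
  with v have "?W = UNIV" by blast
  then have "Z *v w = mat c *v w" for w
    by (auto simp: vec_eq_iff matrix_vector_mult_def mat_def if_distrib [of "\<lambda>x. x * _"] cong: if_cong)
  then show ?thesis
    by (metis matrix_eq)
qed

text \<open>The range of \<open>X\<close> is invariant and too small to be everything. Since M' is
  arbitrary, M' = 0 covers maps out of a trivial representation.\<close>

lemma irreducible_intertwiner_zero:
  fixes X :: "complex^'m^'n"
  assumes irr: "irreducible_family S" and card: "CARD('m) < CARD('n)"
    and inter: "\<And>M. M \<in> S \<Longrightarrow> \<exists>M'. M ** X = X ** M'"
  shows "X = 0"
proof -
  let ?W = "range ((*v) X)"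
  have lin: "Vector_Spaces.linear (*s) (*s) ((*v) X)"
    by (rule matrix_vector_mul_linear_gen)
  have "vec.subspace ?W"
    using vec.subspace_UNIV vec.linear_subspace_image [OF lin] by blast
  moreover have "M *v w \<in> ?W" if M: "M \<in> S" and "w \<in> ?W" for M w
  proof -
    obtain u where u: "w = X *v u" using \<open>w \<in> ?W\<close> by auto
    obtain M' where "M ** X = X ** M'" using inter [OF M] by blast
    then have "M *v w = X *v (M' *v u)"
      by (simp add: u matrix_vector_mul_assoc)
    then show ?thesis by blast
  qed
  ultimately have "?W = {0} \<or> ?W = UNIV"
    using irr unfolding irreducible_family_def by blast
  moreover have "?W \<noteq> UNIV"
  proof
    assume "?W = UNIV"
    then have "vec.dim (UNIV :: (complex^'n) set) \<le> vec.dim (UNIV :: (complex^'m) set)"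
      using vec.dim_image_le [OF lin, of UNIV] by simp
    then show False
      using card by (simp add: vec.dim_UNIV card_cart_basis)
  qed
  ultimately have "X *v v = 0 *v v" for v
    by (auto simp: set_eq_iff)
  then show ?thesis
    by (metis matrix_eq)
qed

section \<open>Tensor operators\<close>

lemma levi_civita_values [simp]:
  "levi_civita 1 2 3 = 1" "levi_civita 2 3 1 = 1" "levi_civita 3 1 2 = 1"
  "levi_civita 1 3 2 = -1" "levi_civita 2 1 3 = -1" "levi_civita 3 2 1 = -1"
  "levi_civita i i j = 0" "levi_civita i j i = 0" "levi_civita j i i = 0"
  by (auto simp: levi_civita_def)

lemma levi_civita_swap:
  "levi_civita j i k = - levi_civita i j k" "levi_civita i k j = - levi_civita i j k"
  "levi_civita k j i = - levi_civita i j k"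
  using exhaust_3 [of i] exhaust_3 [of j] exhaust_3 [of k] by auto

text \<open>Three maps from the space of \<open>Y\<close> to the space of \<open>Y'\<close> that
  rotate like the components of a vector. The order of the indices is that of
  \<open>B_triple\<close>.\<close>

definition tensor_operator ::
  "(3 \<Rightarrow> complex^'m^'m) \<Rightarrow> (3 \<Rightarrow> complex^'n^'n) \<Rightarrow> (3 \<Rightarrow> complex^'n^'m) \<Rightarrow> bool" where
  "tensor_operator Y' Y M \<longleftrightarrow>
     (\<forall>j k. Y' j ** M k - M k ** Y j = (\<Sum>i\<in>UNIV. levi_civita i j k *\<^sub>R M i))"

lemma tensor_operatorD:
  "tensor_operator Y' Y M \<Longrightarrow> Y' j ** M k = M k ** Y j + (\<Sum>i\<in>UNIV. levi_civita i j k *\<^sub>R M i)"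
  by (simp add: tensor_operator_def algebra_simps)

text \<open>The adjoint exchanges source and target; skewness of both actions supplies the sign that
  restores the relation.\<close>

lemma tensor_operator_cadj:
  assumes "tensor_operator Y' Y M" "\<And>i. cadj (Y' i) = - Y' i" "\<And>i. cadj (Y i) = - Y i"
  shows "tensor_operator Y Y' (\<lambda>i. cadj (M i))"
proof -
  have "Y j ** cadj (M k) - cadj (M k) ** Y' j = cadj (Y' j ** M k - M k ** Y j)" for j k
    by (simp add: cadj_simps assms matrix_ring_simps)
  then show ?thesis
    using assms(1) unfolding tensor_operator_def by (simp add: cadj_sum cadj_scaleR)
qed

text \<open>Contracting two vector indices leaves an intertwiner, because the two rotation terms
  cancel by antisymmetry of \<open>levi_civita\<close>. Schur's lemma then applies to the
  sum.\<close>

lemma tensor_operator_contract: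
  assumes "tensor_operator Y' Y M" "tensor_operator Y Y'' N"
  shows "Y' j ** (\<Sum>i\<in>UNIV. M i ** N i) = (\<Sum>i\<in>UNIV. M i ** N i) ** Y'' j"
proof -
  have "Y' j ** (M k ** N k) = (M k ** N k) ** Y'' j
      + M k ** (\<Sum>i\<in>UNIV. levi_civita i j k *\<^sub>R N i) + (\<Sum>i\<in>UNIV. levi_civita i j k *\<^sub>R M i) ** N k" for k
  proof -
    have "Y' j ** (M k ** N k) = (Y' j ** M k) ** N k"
      by (simp add: matrix_ring_simps)
    also have "\<dots> = M k ** (Y j ** N k) + (\<Sum>i\<in>UNIV. levi_civita i j k *\<^sub>R M i) ** N k"
      by (simp add: tensor_operatorD [OF assms(1)] matrix_ring_simps)
    finally show ?thesis
      by (simp add: tensor_operatorD [OF assms(2)] matrix_ring_simps)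
  qed
  then show ?thesis
    using exhaust_3 [of j] by (auto simp: sum_3 matrix_ring_simps)
qed

lemma tensor_operator_self:
  assumes "\<And>i j. mcomm (Y i) (Y j) = (\<Sum>k\<in>UNIV. levi_civita i j k *\<^sub>R Y k)"
  shows "tensor_operator Y Y Y"
proof -
  have "levi_civita j k i = levi_civita i j k" for i j k
    by (metis levi_civita_swap(1,2) minus_minus)
  then show ?thesis
    using assms unfolding tensor_operator_def mcomm_def by simp
qed

(* Since the Casimir operator is scalar, M commutes with it, which means that M_k is the k-th
   component of the cross product of M and Y. This is the rule for moving indices in M_k Y_i Y_i. *)
lemma tensor_operator_projection:
  assumes tens: "tensor_operator Y Y M" and self: "tensor_operator Y Y Y"
    and cas: "(\<Sum>i\<in>UNIV. Y i ** Y i) = mat c"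
  shows "mat c ** M k = (\<Sum>i\<in>UNIV. M i ** Y i) ** Y k"
proof -
  note M = tensor_operatorD [OF tens] and Y = tensor_operatorD [OF self]
  have M': "Y j ** (M i ** Z) = M i ** (Y j ** Z) + (\<Sum>l\<in>UNIV. levi_civita l j i *\<^sub>R M l) ** Z"
    for i j and Z :: "complex^'a^'a"
    using arg_cong [OF M, of "\<lambda>A. A ** Z" j i] by (simp add: matrix_ring_simps)
  have K: "(\<Sum>i\<in>UNIV. Y i ** Y i) ** M k = M k ** (\<Sum>i\<in>UNIV. Y i ** Y i)" for k
    by (simp add: cas mat_commute)
  \<comment> \<open>Moving both factors of the Casimir operator past M_k leaves twice the cross
    product of M and Y against twice M_k; the latter comes from contracting two Levi-Civita
    symbols.\<close>
  have D: "2 *\<^sub>R M 1 = 2 *\<^sub>R (M 2 ** Y 3 - M 3 ** Y 2)" "2 *\<^sub>R M 2 = 2 *\<^sub>R (M 3 ** Y 1 - M 1 ** Y 3)"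
    "2 *\<^sub>R M 3 = 2 *\<^sub>R (M 1 ** Y 2 - M 2 ** Y 1)"
    using K [of 1] K [of 2] K [of 3]
    by (simp_all add: sum_3 matrix_ring_simps M M' scaleR_2 algebra_simps)
  have A: "M 1 = M 2 ** Y 3 - M 3 ** Y 2" "M 2 = M 3 ** Y 1 - M 1 ** Y 3"
    "M 3 = M 1 ** Y 2 - M 2 ** Y 1"
    by (rule scaleR_left_imp_eq [OF _ D(1)] scaleR_left_imp_eq [OF _ D(2)]
        scaleR_left_imp_eq [OF _ D(3)], simp)+
  \<comment> \<open>Normal ordering: the smaller index moves to the left in each product, so that
    both sides of the final identity become sums of the same words.\<close>
  have MY: "M 2 ** Y 1 = M 1 ** Y 2 - M 3" "M 3 ** Y 2 = M 2 ** Y 3 - M 1"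
    "M 3 ** Y 1 = M 1 ** Y 3 + M 2"
    by (subst A(3), simp) (subst A(1), simp, subst A(2), simp)
  have MY': "M 2 ** (Y 1 ** Z) = M 1 ** (Y 2 ** Z) - M 3 ** Z"
    "M 3 ** (Y 2 ** Z) = M 2 ** (Y 3 ** Z) - M 1 ** Z"
    "M 3 ** (Y 1 ** Z) = M 1 ** (Y 3 ** Z) + M 2 ** Z" for Z :: "complex^'a^'a"
    using MY [THEN arg_cong, of "\<lambda>A. A ** Z"] by (simp_all add: matrix_ring_simps)
  have YY: "Y 2 ** Y 1 = Y 1 ** Y 2 - Y 3" "Y 3 ** Y 2 = Y 2 ** Y 3 - Y 1"
    "Y 3 ** Y 1 = Y 1 ** Y 3 + Y 2"
    using Y [of 2 1] Y [of 3 2] Y [of 3 1] by (simp_all add: sum_3)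
  have "M k ** (\<Sum>i\<in>UNIV. Y i ** Y i) = (\<Sum>i\<in>UNIV. M i ** Y i) ** Y k"
    using exhaust_3 [of k]
    by (auto simp: sum_3 matrix_ring_simps MY MY' YY)
  then show ?thesis
    by (simp add: cas mat_commute)
qed

section \<open>The blocks of spin two, one and zero\<close>

text \<open>Representations enter only through their values on the basis. The one-dimensional
  summand carries the zero action, hence the zero source generators of \<open>b\<close>.\<close>

locale so3_blocks =
  fixes Y5 :: "3 \<Rightarrow> complex^5^5" and Y3 :: "3 \<Rightarrow> complex^3^3"
    and B :: "3 \<Rightarrow> complex^3^5" and b :: "3 \<Rightarrow> complex^1^3"
  assumes irr5: "irreducible_family (range Y5)" and irr3: "irreducible_family (range Y3)"
    and skew5: "cadj (Y5 i) = - Y5 i" and skew3: "cadj (Y3 i) = - Y3 i"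
    and comm5: "mcomm (Y5 i) (Y5 j) = (\<Sum>k\<in>UNIV. levi_civita i j k *\<^sub>R Y5 k)"
    and comm3: "mcomm (Y3 i) (Y3 j) = (\<Sum>k\<in>UNIV. levi_civita i j k *\<^sub>R Y3 k)"
    and tensor_B: "tensor_operator Y5 Y3 B" and tensor_b: "tensor_operator Y3 (\<lambda>_. 0) b"
    and B_norm: "(\<Sum>i\<in>UNIV. B i ** cadj (B i)) = mat 1"
    and b_norm: "(\<Sum>i\<in>UNIV. b i ** cadj (b i)) = mat 1"
begin

lemmas tensor5 = tensor_operator_self [OF comm5]
lemmas tensor3 = tensor_operator_self [OF comm3]
lemmas tensor_B_cadj = tensor_operator_cadj [OF tensor_B skew5 skew3]
lemmas tensor_b_cadj = tensor_operator_cadj [OF tensor_b skew3, simplified]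

section \<open>Schur's lemma for the individual blocks\<close>

lemma schur5: "(\<And>j. Y5 j ** Z = Z ** Y5 j) \<Longrightarrow> \<exists>c. Z = mat c"
  by (rule irreducible_commuting_scalar [OF irr5]) auto

lemma schur3: "(\<And>j. Y3 j ** Z = Z ** Y3 j) \<Longrightarrow> \<exists>c. Z = mat c"
  by (rule irreducible_commuting_scalar [OF irr3]) auto

lemma intertwiner_35_zero: "(\<And>j. Y5 j ** X = X ** Y3 j) \<Longrightarrow> X = 0"
  by (rule irreducible_intertwiner_zero [OF irr5]) auto

lemma intertwiner_15_zero: "(\<And>j. Y5 j ** X = 0) \<Longrightarrow> X = 0" for X :: "complex^1^5"
  by (rule irreducible_intertwiner_zero [OF irr5]) (auto intro: exI [of _ 0])

lemma intertwiner_13_zero: "(\<And>j. Y3 j ** X = 0) \<Longrightarrow> X = 0" for X :: "complex^1^3"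
  by (rule irreducible_intertwiner_zero [OF irr3]) (auto intro: exI [of _ 0])

lemma Y3_b: "Y3 j ** b k = (\<Sum>i\<in>UNIV. levi_civita i j k *\<^sub>R b i)"
  using tensor_operatorD [OF tensor_b] by simp

text \<open>What follows holds for every vector operator from V_3 to V_5. This generality is used to
  show that each of them is a multiple of \<open>B\<close>.\<close>

context
  fixes M :: "3 \<Rightarrow> complex^3^5"
  assumes tensor_M: "tensor_operator Y5 Y3 M"
begin

lemma sum_tensor_Y3: "(\<Sum>i\<in>UNIV. M i ** Y3 i) = 0"
  using tensor_operator_contract [OF tensor_M tensor3] by (rule intertwiner_35_zero)

lemma sum_tensor_b: "(\<Sum>i\<in>UNIV. M i ** b i) = 0"
  by (rule intertwiner_15_zero) (simp add: tensor_operator_contract [OF tensor_M tensor_b])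

text \<open>Apply \<open>sum_tensor_Y3\<close> to \<open>b k\<close>: each
  \<open>Y3 i ** b k\<close> is a Levi-Civita combination of the \<open>b\<close>, and what remains
  is the antisymmetric part of M_i b_j.\<close>

lemma tensor_b_sym: "M i ** b j = M j ** b i"
proof -
  have *: "(\<Sum>i\<in>UNIV. M i ** (Y3 i ** b k)) = 0" for k
    using arg_cong [OF sum_tensor_Y3, of "\<lambda>A. A ** b k"]
    by (simp add: matrix_sum_left matrix_assoc_right)
  have 1: "M 2 ** b 1 = M 1 ** b 2"
    using * [of 3] by (simp add: sum_3 Y3_b matrix_ring_simps)
  have 2: "M 3 ** b 1 = M 1 ** b 3"
    using * [of 2] by (simp add: sum_3 Y3_b matrix_ring_simps)
  have 3: "M 3 ** b 2 = M 2 ** b 3"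
    using * [of 1] by (simp add: sum_3 Y3_b matrix_ring_simps)
  show ?thesis
    using exhaust_3 [of i] exhaust_3 [of j] by (auto simp: 1 2 3)
qed

text \<open>Rewrite rules that leave the five products M_1 b_1, M_1 b_2, M_1 b_3, M_2 b_2 and M_2
  b_3, in which later identities are compared.\<close>

lemma tensor_b_normal:
  "M 2 ** b 1 = M 1 ** b 2" "M 3 ** b 1 = M 1 ** b 3" "M 3 ** b 2 = M 2 ** b 3"
  "M 3 ** b 3 = - (M 1 ** b 1) - M 2 ** b 2"
  using sum_tensor_b by (simp_all add: tensor_b_sym [of 2 1] tensor_b_sym [of 3 1]
      tensor_b_sym [of 3 2] sum_3 add_eq_0_iff algebra_simps)

end

lemmas sum_B_Y3 = sum_tensor_Y3 [OF tensor_B]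
lemmas sum_B_b = sum_tensor_b [OF tensor_B]
lemmas B_b_sym = tensor_b_sym [OF tensor_B]
lemmas B_b_normal = tensor_b_normal [OF tensor_B]

text \<open>The columns \<open>b i\<close> form a square matrix. By \<open>b_norm\<close> its
  adjoint is a right inverse, hence also a left inverse.\<close>

lemma b_orth: "cadj (b i) ** b j = (if i = j then mat 1 else 0)"
proof -
  define \<beta> :: "complex^3^3" where "\<beta> = (\<chi> r c. b c $ r $ 1)"
  have "\<beta> ** cadj \<beta> = (\<Sum>i\<in>UNIV. b i ** cadj (b i))"
    by (simp add: \<beta>_def vec_eq_iff matrix_mult_entry cadj_def)
  then have "cadj \<beta> ** \<beta> = mat 1"
    using b_norm matrix_left_right_inverse by metis
  then have "(cadj \<beta> ** \<beta>) $ i $ j = mat 1 $ i $ j"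
    by simp
  then show ?thesis
    by (simp add: \<beta>_def vec_eq_iff matrix_mult_entry cadj_def mat_def)
qed

text \<open>Completeness \<open>b_norm\<close> recovers an operator from its values on the
  \<open>b l\<close>.\<close>

lemma eq_on_b:
  fixes A A' :: "complex^3^'n"
  assumes "\<And>l. A ** b l = A' ** b l"
  shows "A = A'"
proof -
  have *: "(\<Sum>i\<in>UNIV. (A ** b i) ** cadj (b i)) = A" for A :: "complex^3^'n"
    by (simp add: matrix_assoc_right matrix_sum_right [symmetric] b_norm)
  have "A = (\<Sum>i\<in>UNIV. (A ** b i) ** cadj (b i))"
    by (rule * [symmetric])
  also have "\<dots> = A'"
    unfolding assms by (rule * )
  finally show ?thesis .
qed

text \<open>The \<open>B l\<close> are maps rather than vectors, but \<open>B_norm\<close> is a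
  completeness relation all the same. Together with \<open>eq_on_b\<close> it allows testing on the
  vectors B_l b_m in place of a basis of V_5.\<close>

lemma eq_on_B:
  fixes A A' :: "complex^5^'n"
  assumes "\<And>l. A ** B l = A' ** B l"
  shows "A = A'"
proof -
  have *: "(\<Sum>i\<in>UNIV. (A ** B i) ** cadj (B i)) = A" for A :: "complex^5^'n"
    by (simp add: matrix_assoc_right matrix_sum_right [symmetric] B_norm)
  have "A = (\<Sum>i\<in>UNIV. (A ** B i) ** cadj (B i))"
    by (rule * [symmetric])
  also have "\<dots> = A'"
    unfolding assms by (rule * )
  finally show ?thesis .
qed

text \<open>Both sides are the infinitesimal rotation in the plane of b_i and b_j, as evaluation on
  the orthonormal basis shows.\<close>

lemma b_cadj_b_antisym: "b i ** cadj (b j) - b j ** cadj (b i) = - (\<Sum>k\<in>UNIV. levi_civita i j k *\<^sub>R Y3 k)"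
proof (rule eq_on_b)
  fix l
  show "(b i ** cadj (b j) - b j ** cadj (b i)) ** b l
      = - (\<Sum>k\<in>UNIV. levi_civita i j k *\<^sub>R Y3 k) ** b l"
    using exhaust_3 [of i] exhaust_3 [of j] exhaust_3 [of l]
    by (auto simp: matrix_ring_simps b_orth sum_3 Y3_b)
qed

lemma Y3_b_antisym: "Y3 i ** b j - Y3 j ** b i = 2 *\<^sub>R (\<Sum>k\<in>UNIV. levi_civita i j k *\<^sub>R b k)"
  using exhaust_3 [of i] exhaust_3 [of j] by (auto simp: sum_3 Y3_b scaleR_2)

end

lemma scaleR_complex: "r *\<^sub>R (x :: complex) = of_real r * x"
  by (rule scaleR_conv_of_real)

context so3_blocks begin

lemma B_Y3_antisym: "B i ** Y3 j - B j ** Y3 i = - (\<Sum>k\<in>UNIV. levi_civita i j k *\<^sub>R B k)"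
proof (rule eq_on_b)
  fix l
  show "(B i ** Y3 j - B j ** Y3 i) ** b l = - (\<Sum>k\<in>UNIV. levi_civita i j k *\<^sub>R B k) ** b l"
    using exhaust_3 [of i] exhaust_3 [of j] exhaust_3 [of l]
    by (auto simp: matrix_ring_simps sum_3 Y3_b B_b_normal)
qed

lemma Y5_B: "Y5 j ** B k = B k ** Y3 j + (\<Sum>i\<in>UNIV. levi_civita i j k *\<^sub>R B i)"
  using tensor_operatorD [OF tensor_B] .

lemma Y5_B': "Y5 j ** (B k ** Z) = B k ** (Y3 j ** Z) + (\<Sum>i\<in>UNIV. levi_civita i j k *\<^sub>R (B i ** Z))"
  using arg_cong [OF Y5_B, of "\<lambda>A. A ** Z" j k]
  by (simp add: matrix_ring_simps matrix_sum_left)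

text \<open>The commutator terms contribute 2 and the cross product of \<open>B\<close> with
  \<open>Y3\<close> contributes 1.\<close>

lemma Y5_B_antisym: "Y5 i ** B j - Y5 j ** B i = 3 *\<^sub>R (\<Sum>k\<in>UNIV. levi_civita i j k *\<^sub>R B k)"
proof -
  have "Y5 i ** B j - Y5 j ** B i = - (B i ** Y3 j - B j ** Y3 i)
      + 2 *\<^sub>R (\<Sum>k\<in>UNIV. levi_civita i j k *\<^sub>R B k)"
    using exhaust_3 [of i] exhaust_3 [of j] by (auto simp: sum_3 Y5_B scaleR_2)
  also have "\<dots> = 1 *\<^sub>R (\<Sum>k\<in>UNIV. levi_civita i j k *\<^sub>R B k)
      + 2 *\<^sub>R (\<Sum>k\<in>UNIV. levi_civita i j k *\<^sub>R B k)"
    unfolding B_Y3_antisym by simp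
  finally show ?thesis
    unfolding scaleR_left_distrib [symmetric] by simp
qed

section \<open>Casimir operators\<close>

lemma casimir3: "(\<Sum>i\<in>UNIV. Y3 i ** Y3 i) = mat (- 2)"
proof (rule eq_on_b)
  fix l
  have "mat (- 2) ** b l = - 2 *\<^sub>R b l"
    using mat_of_real_mult [of "- 2" "b l"] by simp
  then show "(\<Sum>i\<in>UNIV. Y3 i ** Y3 i) ** b l = mat (- 2) ** b l"
    using exhaust_3 [of l]
    by (auto simp: matrix_ring_simps sum_3 Y3_b scaleR_2 mat_of_real_mult)
qed

text \<open>As for spin one, the constant is - s (s + 1), here with s = 2.\<close>

lemma casimir5: "(\<Sum>i\<in>UNIV. Y5 i ** Y5 i) = mat (- 6)"
proof (intro eq_on_B eq_on_b)
  fix l m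
  have "mat (- 6) ** B l ** b m = - 6 *\<^sub>R (B l ** b m)"
    using mat_of_real_mult [of "- 6" "B l ** b m"] by (simp add: matrix_assoc_right)
  then show "(\<Sum>i\<in>UNIV. Y5 i ** Y5 i) ** B l ** b m = mat (- 6) ** B l ** b m"
    using exhaust_3 [of l] exhaust_3 [of m]
    by (auto simp: matrix_ring_simps sum_3 Y3_b Y5_B Y5_B' B_b_normal vec_eq_iff scaleR_complex)
qed


text \<open>The block matrix with entries \<open>gram i k\<close> is the orthogonal projection of \<open>\<complex>\<^sup>3 \<otimes> \<complex>\<^sup>3\<close> onto the
  traceless symmetric tensors.\<close>

definition gram :: "3 \<Rightarrow> 3 \<Rightarrow> complex^3^3" where
  "gram i k = (1/2) *\<^sub>R ((if i = k then mat 1 else 0) + b k ** cadj (b i)) - (1/3) *\<^sub>R (b i ** cadj (b k))"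

lemma gram_b: "gram i k ** b l =
  (1/2) *\<^sub>R ((if i = k then b l else 0) + (if i = l then b k else 0)) - (1/3) *\<^sub>R (if k = l then b i else 0)"
  by (simp add: gram_def matrix_ring_simps b_orth)

lemma cadj_gram: "cadj (gram i k) = gram k i"
  by (simp add: gram_def cadj_simps)

text \<open>The row (M_1, M_2, M_3) annihilates antisymmetric tensors and the trace tensor, so
  composing it with the projection changes nothing.\<close>

lemma sum_tensor_gram:
  assumes "tensor_operator Y5 Y3 M"
  shows "(\<Sum>j\<in>UNIV. M j ** gram j k) = M k"
proof (rule eq_on_b)
  fix l
  show "(\<Sum>j\<in>UNIV. M j ** gram j k) ** b l = M k ** b l"
    using exhaust_3 [of k] exhaust_3 [of l]
    by (auto simp: matrix_ring_simps sum_3 gram_b tensor_b_normal [OF assms] vec_eq_iff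
        scaleR_complex field_simps)
qed

lemmas sum_B_gram = sum_tensor_gram [OF tensor_B]

lemma sum_gram_gram: "(\<Sum>j\<in>UNIV. gram i j ** gram j k) = gram i k"
proof (rule eq_on_b)
  fix l
  show "(\<Sum>j\<in>UNIV. gram i j ** gram j k) ** b l = gram i k ** b l"
    using exhaust_3 [of i] exhaust_3 [of k] exhaust_3 [of l]
    by (auto simp: matrix_ring_simps sum_3 gram_b vec_eq_iff scaleR_complex field_simps)
qed

text \<open>The trace is the rank of the projection, and it agrees with the dimension of
  V_5.\<close>

lemma trace_gram: "(\<Sum>i\<in>UNIV. trace (gram i i)) = 5"
proof -
  have "(\<Sum>i\<in>UNIV. gram i i) = (5/3) *\<^sub>R mat 1"
  proof (rule eq_on_b)
    fix l
    show "(\<Sum>i\<in>UNIV. gram i i) ** b l = (5/3) *\<^sub>R mat 1 ** b l"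
      using exhaust_3 [of l]
      by (auto simp: matrix_ring_simps sum_3 gram_b vec_eq_iff scaleR_complex field_simps)
  qed
  then show ?thesis
    by (simp add: trace_sum [symmetric] trace_scaleR trace_I scaleR_complex)
qed

lemma trace_B: "(\<Sum>i\<in>UNIV. trace (cadj (B i) ** B i)) = 5"
proof -
  have "(\<Sum>i\<in>UNIV. trace (cadj (B i) ** B i)) = trace (\<Sum>i\<in>UNIV. B i ** cadj (B i))"
    unfolding trace_sum by (intro sum.cong refl trace_mult_commute)
  then show ?thesis
    by (simp add: B_norm trace_I)
qed

text \<open>Let P have the blocks \<open>gram i k\<close> and Q the blocks
  \<open>cadj (B i) ** B k\<close>. Both are orthogonal projections and P Q = Q P = Q, so P - Q is
  one as well. Its trace is 5 - 5 = 0, hence it vanishes.\<close>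

lemma B_cadj_B: "cadj (B i) ** B k = gram i k"
proof -
  \<comment> \<open>The blocks of P - Q, indexed by pairs so that they form one finite
    family.\<close>
  define Z where "Z x = gram (fst x) (snd x) - cadj (B (fst x)) ** B (snd x)" for x
  have QQ: "(\<Sum>k\<in>UNIV. (cadj (B i) ** B k) ** (cadj (B k) ** B j)) = cadj (B i) ** B j" for i j
  proof -
    have "(\<Sum>k\<in>UNIV. (cadj (B i) ** B k) ** (cadj (B k) ** B j))
        = cadj (B i) ** ((\<Sum>k\<in>UNIV. B k ** cadj (B k)) ** B j)"
      by (simp add: matrix_sum_right matrix_sum_left matrix_assoc_right)
    then show ?thesis by (simp add: B_norm)
  qed
  have QP: "(\<Sum>k\<in>UNIV. (cadj (B i) ** B k) ** gram k j) = cadj (B i) ** B j" for i j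
    by (simp add: matrix_assoc_right matrix_sum_right [symmetric] sum_B_gram)
  have PQ: "(\<Sum>k\<in>UNIV. gram i k ** (cadj (B k) ** B j)) = cadj (B i) ** B j" for i j
    using arg_cong [OF QP [of j i], of cadj] by (simp add: cadj_simps cadj_gram)
  have "(\<Sum>k\<in>UNIV. Z (i, k) ** cadj (Z (i, k))) = gram i i - cadj (B i) ** B i" for i
  proof -
    have "(\<Sum>k\<in>UNIV. Z (i, k) ** cadj (Z (i, k))) =
        (\<Sum>k\<in>UNIV. gram i k ** gram k i) - (\<Sum>k\<in>UNIV. gram i k ** (cadj (B k) ** B i))
        - (\<Sum>k\<in>UNIV. (cadj (B i) ** B k) ** gram k i)
        + (\<Sum>k\<in>UNIV. (cadj (B i) ** B k) ** (cadj (B k) ** B i))"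
      by (simp add: Z_def cadj_simps cadj_gram matrix_diff_ldistrib matrix_diff_rdistrib
          sum_subtractf sum.distrib algebra_simps)
    then show ?thesis
      by (simp add: QQ QP PQ sum_gram_gram)
  qed
  then have "(\<Sum>i\<in>UNIV. \<Sum>k\<in>UNIV. trace (Z (i, k) ** cadj (Z (i, k)))) = 0"
    by (simp add: trace_sum [symmetric] trace_sub)
      (simp add: trace_sum trace_sub sum_subtractf trace_gram trace_B)
  then have "(\<Sum>x\<in>UNIV. trace (Z x ** cadj (Z x))) = 0"
    by (simp add: sum.cartesian_product)
  then have "Z (i, k) = 0"
    by (intro sum_mult_cadj_eq_0 [of UNIV Z]) simp_all
  then show ?thesis
    by (simp add: Z_def)
qed

text \<open>Antisymmetrising \<open>gram\<close> gives 1/2 + 1/3 = 5/6; this is the 5/6 in the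
  equation for the derivative of f_1.\<close>

lemma B_cadj_B_antisym:
  "cadj (B i) ** B j - cadj (B j) ** B i = (5/6) *\<^sub>R (\<Sum>k\<in>UNIV. levi_civita i j k *\<^sub>R Y3 k)"
proof -
  have "cadj (B i) ** B j - cadj (B j) ** B i = - (5/6) *\<^sub>R (b i ** cadj (b j) - b j ** cadj (b i))"
    by (simp add: B_cadj_B gram_def vec_eq_iff scaleR_complex field_simps)
  then show ?thesis
    by (simp add: b_cadj_b_antisym)
qed

text \<open>Testing on \<open>B l\<close> turns \<open>cadj (B j) ** B l\<close> into
  \<open>gram\<close>. The terms with 1/3 cancel because B_i b_j is symmetric, and the others
  assemble to the action of \<open>Y5\<close>.\<close>

lemma B_B_cadj_antisym:
  "B i ** cadj (B j) - B j ** cadj (B i) = - (1/2) *\<^sub>R (\<Sum>k\<in>UNIV. levi_civita i j k *\<^sub>R Y5 k)"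
proof (rule eq_on_B)
  fix l
  define R where "R = (if j = l then B i else 0) - (if i = l then B j else 0)"
  \<comment> \<open>Contraction of two Levi-Civita symbols: up to sign, \<open>R\<close> is the
    rotation in the (i, j) plane applied to the index l.\<close>
  have R: "(\<Sum>k\<in>UNIV. levi_civita i j k *\<^sub>R (\<Sum>m\<in>UNIV. levi_civita m k l *\<^sub>R B m)) = - R"
    using exhaust_3 [of i] exhaust_3 [of j] exhaust_3 [of l] by (auto simp: sum_3 R_def)
  have gram: "B i ** gram j l = (1/2) *\<^sub>R ((if j = l then B i else 0) + B l ** (b i ** cadj (b j)))
      - (1/3) *\<^sub>R (B i ** (b j ** cadj (b l)))" for i j
  proof -
    have "B i ** (b l ** cadj (b j)) = B l ** (b i ** cadj (b j))"
      by (simp add: matrix_mul_assoc B_b_sym [of i l])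
    then show ?thesis
      by (simp add: gram_def matrix_ring_simps)
  qed
  have "B i ** (b j ** cadj (b l)) = B j ** (b i ** cadj (b l))"
    by (simp add: matrix_mul_assoc B_b_sym [of i j])
  then have "(B i ** cadj (B j) - B j ** cadj (B i)) ** B l
      = (1/2) *\<^sub>R (R + B l ** (b i ** cadj (b j) - b j ** cadj (b i)))"
    unfolding matrix_diff_rdistrib matrix_assoc_right B_cadj_B gram
    by (simp add: R_def matrix_diff_ldistrib algebra_simps)
  also have "\<dots> = (1/2) *\<^sub>R (R - (\<Sum>k\<in>UNIV. levi_civita i j k *\<^sub>R (B l ** Y3 k)))"
    unfolding b_cadj_b_antisym by (simp add: matrix_ring_simps matrix_sum_right)
  also have "\<dots> = - (1/2) *\<^sub>R (\<Sum>k\<in>UNIV. levi_civita i j k *\<^sub>R (Y5 k ** B l))"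
    unfolding Y5_B scaleR_add_right sum.distrib R by (simp add: algebra_simps)
  finally show "(B i ** cadj (B j) - B j ** cadj (B i)) ** B l
      = - (1/2) *\<^sub>R (\<Sum>k\<in>UNIV. levi_civita i j k *\<^sub>R Y5 k) ** B l"
    by (simp add: matrix_ring_simps matrix_sum_left)
qed

lemma sum_Y3_b: "(\<Sum>i\<in>UNIV. Y3 i ** b i) = 0"
  by (simp add: Y3_b sum_3)

text \<open>The rule for an iterated cross product, evaluated on the basis \<open>b\<close>.\<close>

lemma Y3_Y3: "Y3 i ** Y3 k = b k ** cadj (b i) - (if i = k then mat 1 else 0)"
proof (rule eq_on_b)
  fix l
  show "Y3 i ** Y3 k ** b l = (b k ** cadj (b i) - (if i = k then mat 1 else 0)) ** b l"
    using exhaust_3 [of i] exhaust_3 [of k] exhaust_3 [of l]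
    by (auto simp: matrix_ring_simps sum_3 Y3_b b_orth)
qed

end

section \<open>Comparison of scalar coefficients\<close>

lemma mat_eq_0_iff [simp]: "mat c = (0 :: complex^'n^'n) \<longleftrightarrow> c = 0"
proof
  assume "mat c = (0 :: complex^'n^'n)"
  then have "(mat c :: complex^'n^'n) $ i $ i = 0" for i
    by simp
  then show "c = 0"
    by (simp add: mat_def)
qed (simp add: vec_eq_iff mat_def)

lemma mat_minus_mult: "mat (- c) ** (A :: complex^'n^'m) = - (mat c ** A)"
  by (simp add: vec_eq_iff mat_mult_entry)

lemma mat_mult_mat: "mat x ** mat y = (mat (x * y) :: complex^'n^'n)"
  by (simp add: vec_eq_iff mat_mult_entry) (simp add: mat_def)

lemma mat_add_mat: "mat x + mat y = (mat (x + y) :: complex^'n^'n)"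
  by (simp add: vec_eq_iff mat_def)

lemma mat_mult_cancel:
  assumes "mat x ** M = mat y ** (M :: complex^'n^'m)" "M \<noteq> 0"
  shows "x = y"
proof -
  obtain i j where "M $ i $ j \<noteq> 0"
    using assms(2) by (auto simp: vec_eq_iff)
  moreover have "x * M $ i $ j = y * M $ i $ j"
    by (metis assms(1) mat_mult_entry)
  ultimately show ?thesis by simp
qed

context so3_blocks begin

subsection \<open>The bracket of two block operators\<close>

definition gen :: "3 \<Rightarrow> complex^(5 + 3 + 1)^(5 + 3 + 1)" where
  "gen i = block3 (Y5 i) 0 0 0 (Y3 i) 0 0 0 0"

text \<open>The ansatz at one time, except that the off-diagonal coefficients are complex:
  equivariance and skewness do not make them real. Complex factors are scalar matrices because
  \<open>*\<^sub>R\<close> takes only real ones.\<close>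

definition form :: "real \<Rightarrow> real \<Rightarrow> complex \<Rightarrow> complex \<Rightarrow> 3 \<Rightarrow> complex^(5 + 3 + 1)^(5 + 3 + 1)" where
  "form f1 f2 c0 c1 i = block3
     (f2 *\<^sub>R Y5 i) (mat c1 ** B i) 0
     (- (mat (cnj c1) ** cadj (B i))) (f1 *\<^sub>R Y3 i) (mat c0 ** b i)
     0 (- (mat (cnj c0) ** cadj (b i))) 0"

lemma sum_form:
  "(\<Sum>k\<in>UNIV. levi_civita i j k *\<^sub>R form f1 f2 c0 c1 k) = block3
     (f2 *\<^sub>R (\<Sum>k\<in>UNIV. levi_civita i j k *\<^sub>R Y5 k)) (mat c1 ** (\<Sum>k\<in>UNIV. levi_civita i j k *\<^sub>R B k)) 0
     (- (mat (cnj c1) ** cadj (\<Sum>k\<in>UNIV. levi_civita i j k *\<^sub>R B k)))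
     (f1 *\<^sub>R (\<Sum>k\<in>UNIV. levi_civita i j k *\<^sub>R Y3 k)) (mat c0 ** (\<Sum>k\<in>UNIV. levi_civita i j k *\<^sub>R b k))
     0 (- (mat (cnj c0) ** cadj (\<Sum>k\<in>UNIV. levi_civita i j k *\<^sub>R b k))) 0"
  by (simp add: form_def block3_simps block3_eq_iff matrix_sum_right matrix_scaleR_right
      scaleR_sum_right sum_negf cadj_sum cadj_scaleR mult.commute)

text \<open>Each block of the commutator is an antisymmetrised product computed above, and the
  corner blocks cancel since B_i b_j is symmetric. The result has the same shape, so Nahm's
  equations close on the four coefficients.\<close>

lemma mcomm_form:
  "mcomm (form f1 f2 c0 c1 i) (form f1 f2 c0 c1 j) = (\<Sum>k\<in>UNIV. levi_civita i j k *\<^sub>R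
     form (f1\<^sup>2 + (cmod c0)\<^sup>2 - 5/6 * (cmod c1)\<^sup>2) (f2\<^sup>2 + 1/2 * (cmod c1)\<^sup>2)
       (of_real (2 * f1) * c0) (of_real (3 * f2 - f1) * c1) k)"
proof -
  define E5 where "E5 = (\<Sum>k\<in>UNIV. levi_civita i j k *\<^sub>R Y5 k)"
  define E3 where "E3 = (\<Sum>k\<in>UNIV. levi_civita i j k *\<^sub>R Y3 k)"
  define EB where "EB = (\<Sum>k\<in>UNIV. levi_civita i j k *\<^sub>R B k)"
  define Eb where "Eb = (\<Sum>k\<in>UNIV. levi_civita i j k *\<^sub>R b k)"
  \<comment> \<open>\<open>R1\<close> to \<open>R6\<close> are oriented so as to exchange i and j:
    the two halves of the commutator become the same words and cancel up to Levi-Civita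
    terms.\<close>
  have R1: "Y5 i ** B j = Y5 j ** B i + 3 *\<^sub>R EB" "B i ** Y3 j = B j ** Y3 i - EB"
    "Y3 i ** b j = Y3 j ** b i + 2 *\<^sub>R Eb"
    using Y5_B_antisym [of i j] B_Y3_antisym [of i j] Y3_b_antisym [of i j]
    by (simp_all add: EB_def Eb_def algebra_simps)
  have R2: "cadj (B j) ** Y5 i = cadj (B i) ** Y5 j - 3 *\<^sub>R cadj EB"
    "Y3 j ** cadj (B i) = Y3 i ** cadj (B j) + cadj EB"
    "cadj (b j) ** Y3 i = cadj (b i) ** Y3 j - 2 *\<^sub>R cadj Eb"
    using R1 [THEN arg_cong, of cadj]
    by (simp_all add: cadj_simps skew5 skew3 matrix_ring_simps algebra_simps)
  have R3: "Y5 i ** Y5 j = Y5 j ** Y5 i + E5" "Y3 i ** Y3 j = Y3 j ** Y3 i + E3"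
    "B i ** cadj (B j) = B j ** cadj (B i) - (1/2) *\<^sub>R E5"
    "cadj (B i) ** B j = cadj (B j) ** B i + (5/6) *\<^sub>R E3"
    "b i ** cadj (b j) = b j ** cadj (b i) - E3"
    using comm5 [of i j] comm3 [of i j] B_B_cadj_antisym [of i j] B_cadj_B_antisym [of i j]
      b_cadj_b_antisym [of i j]
    by (simp_all add: E5_def E3_def mcomm_def algebra_simps)
  have R4: "B i ** b j = B j ** b i"
    by (rule B_b_sym)
  have R5: "cadj (b j) ** cadj (B i) = cadj (b i) ** cadj (B j)"
    using arg_cong [OF R4, of cadj] by (simp only: cadj_mult)
  have R6: "cadj (b i) ** b j = cadj (b j) ** b i"
    by (simp add: b_orth)
  have c: "c * cnj c = of_real ((cmod c)\<^sup>2)" "cnj c * c = of_real ((cmod c)\<^sup>2)" for c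
    by (simp_all add: complex_norm_square [symmetric] mult.commute [of "cnj c"])
  show ?thesis
    unfolding sum_form E5_def [symmetric] E3_def [symmetric] EB_def [symmetric] Eb_def [symmetric]
    unfolding form_def mcomm_def block3_mult block3_diff block3_eq_iff
    unfolding matrix_ring_simps mult_mat_mult [of "Y5 k" for k] mult_mat_mult [of "Y3 k" for k]
      mult_mat_mult [of "B k" for k] mult_mat_mult [of "b k" for k]
      mult_mat_mult [of "cadj (B k)" for k] mult_mat_mult [of "cadj (b k)" for k]
      mat_mult_mat_mult c mat_of_real_mult R1 R2 R3 R4 R5 R6
    by (simp add: vec_eq_iff mat_mult_entry scaleR_complex power2_eq_square algebra_simps)
qed

subsection \<open>Intertwiners and tensor operators on the sum\<close>

lemma Y5_nonzero: "\<exists>k. Y5 k \<noteq> 0"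
proof (rule ccontr)
  assume "\<not> ?thesis"
  then have "mat (- 6) = (0 :: complex^5^5)"
    unfolding casimir5 [symmetric] by simp
  then show False
    by simp
qed

lemma Y3_nonzero: "\<exists>k. Y3 k \<noteq> 0"
proof (rule ccontr)
  assume "\<not> ?thesis"
  then have "mat (- 2) = (0 :: complex^3^3)"
    unfolding casimir3 [symmetric] by simp
  then show False
    by simp
qed

lemma B_nonzero: "\<exists>k. B k \<noteq> 0"
proof (rule ccontr)
  assume "\<not> ?thesis"
  then have "mat 1 = (0 :: complex^5^5)"
    unfolding B_norm [symmetric] by simp
  then show False
    by simp
qed

lemma b_nonzero: "\<exists>k. b k \<noteq> 0"
proof (rule ccontr)
  assume "\<not> ?thesis"
  then have "mat 1 = (0 :: complex^3^3)"
    unfolding b_norm [symmetric] by simp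
  then show False
    by simp
qed

text \<open>The projection rule makes M_k a multiple of \<open>Y5 k\<close>: the scalar contraction
  of M with \<open>Y5\<close>, divided by the Casimir value -6. As both triples are skew, the factor
  is real.\<close>

lemma tensor_55:
  assumes "tensor_operator Y5 Y5 M" and skew: "\<And>k. cadj (M k) = - M k"
  shows "\<exists>r. \<forall>k. M k = r *\<^sub>R Y5 k"
proof -
  obtain s where s: "(\<Sum>i\<in>UNIV. M i ** Y5 i) = mat s"
    using schur5 [OF tensor_operator_contract [OF assms(1) tensor5]] by auto
  have "mat (- 6) ** M k = mat s ** Y5 k" for k
    using tensor_operator_projection [OF assms(1) tensor5 casimir5] by (simp add: s)
  from arg_cong [OF this, of "\<lambda>A. mat (- (1/6)) ** A"]
  have M: "M k = mat (- s / 6) ** Y5 k" for k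
    by (simp add: mat_mult_mat_mult)
  have "mat (- s / 6) ** Y5 k = mat (cnj (- s / 6)) ** Y5 k" for k
    using skew [of k] unfolding M by (simp add: cadj_mat_mult skew5 matrix_ring_simps)
  then have "- s / 6 = cnj (- s / 6)"
    using mat_mult_cancel Y5_nonzero by blast
  then have "- s / 6 = of_real (Re (- s / 6))"
    by (metis Reals_cnj_iff of_real_Re)
  then have "M k = Re (- s / 6) *\<^sub>R Y5 k" for k
    unfolding M using mat_of_real_mult by metis
  then show ?thesis by blast
qed

lemma tensor_33:
  assumes "tensor_operator Y3 Y3 M" and skew: "\<And>k. cadj (M k) = - M k"
  shows "\<exists>r. \<forall>k. M k = r *\<^sub>R Y3 k"
proof -
  obtain s where s: "(\<Sum>i\<in>UNIV. M i ** Y3 i) = mat s"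
    using schur3 [OF tensor_operator_contract [OF assms(1) tensor3]] by auto
  have "mat (- 2) ** M k = mat s ** Y3 k" for k
    using tensor_operator_projection [OF assms(1) tensor3 casimir3] by (simp add: s)
  from arg_cong [OF this, of "\<lambda>A. mat (- (1/2)) ** A"]
  have M: "M k = mat (- s / 2) ** Y3 k" for k
    by (simp add: mat_mult_mat_mult)
  have "mat (- s / 2) ** Y3 k = mat (cnj (- s / 2)) ** Y3 k" for k
    using skew [of k] unfolding M by (simp add: cadj_mat_mult skew3 matrix_ring_simps)
  then have "- s / 2 = cnj (- s / 2)"
    using mat_mult_cancel Y3_nonzero by blast
  then have "- s / 2 = of_real (Re (- s / 2))"
    by (metis Reals_cnj_iff of_real_Re)
  then have "M k = Re (- s / 2) *\<^sub>R Y3 k" for k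
    unfolding M using mat_of_real_mult by metis
  then show ?thesis by blast
qed

text \<open>Subtracting s B, where s is the contraction of M with the adjoints of \<open>B\<close>,
  leaves a vector operator D whose contraction is zero. Since D_k is the sum over j of D_j
  \<open>cadj (B j) ** B k\<close>, it vanishes.\<close>

lemma tensor_53:
  assumes M: "tensor_operator Y5 Y3 M"
  shows "\<exists>c. \<forall>k. M k = mat c ** B k"
proof -
  obtain s where s: "(\<Sum>i\<in>UNIV. M i ** cadj (B i)) = mat s"
    using schur5 [OF tensor_operator_contract [OF M tensor_B_cadj]] by auto
  define D where "D k = M k - mat s ** B k" for k
  have "tensor_operator Y5 Y3 D"
    unfolding tensor_operator_def
  proof (intro allI)
    fix j k
    have "Y5 j ** D k - D k ** Y3 j = (Y5 j ** M k - M k ** Y3 j) - mat s ** (Y5 j ** B k - B k ** Y3 j)"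
      by (simp add: D_def matrix_ring_simps mult_mat_mult)
    also have "\<dots> = (\<Sum>i\<in>UNIV. levi_civita i j k *\<^sub>R D i)"
      using M tensor_B unfolding tensor_operator_def
      by (simp add: D_def matrix_sum_right matrix_scaleR_right sum_subtractf scaleR_diff_right)
    finally show "Y5 j ** D k - D k ** Y3 j = (\<Sum>i\<in>UNIV. levi_civita i j k *\<^sub>R D i)" .
  qed
  moreover have "(\<Sum>i\<in>UNIV. D i ** cadj (B i)) = 0"
    by (simp add: D_def matrix_diff_rdistrib sum_subtractf s matrix_assoc_right
        matrix_sum_right [symmetric] B_norm)
  ultimately have "D k = 0" for k
    using sum_tensor_gram [of D k]
    by (simp add: B_cadj_B [symmetric] matrix_mul_assoc matrix_sum_left [symmetric])
  then show ?thesis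
    by (auto simp: D_def)
qed

lemma tensor_31:
  assumes M: "tensor_operator Y3 (\<lambda>_. 0) M"
  shows "\<exists>c. \<forall>k. M k = mat c ** b k"
proof -
  obtain s where s: "(\<Sum>i\<in>UNIV. M i ** cadj (b i)) = mat s"
    using schur3 [OF tensor_operator_contract [OF M tensor_b_cadj]] by auto
  have "M k = mat s ** b k" for k
    by (simp add: s [symmetric] matrix_sum_left matrix_assoc_right b_orth if_distrib cong: if_cong)
  then show ?thesis by blast
qed

text \<open>Contraction with the adjoints of the \<open>b\<close> loses nothing by orthonormality,
  and it yields an intertwiner from V_3 to V_5, which is zero.\<close>

lemma tensor_51:
  fixes M :: "3 \<Rightarrow> complex^1^5"
  assumes M: "tensor_operator Y5 (\<lambda>_. 0) M"
  shows "M k = 0"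
proof -
  have "(\<Sum>i\<in>UNIV. M i ** cadj (b i)) = 0"
    using tensor_operator_contract [OF M tensor_b_cadj] by (rule intertwiner_35_zero)
  then have "0 = (\<Sum>i\<in>UNIV. M i ** cadj (b i)) ** b k"
    by simp
  also have "\<dots> = M k"
    by (simp add: matrix_sum_left matrix_assoc_right b_orth if_distrib cong: if_cong)
  finally show ?thesis ..
qed

lemma tensor_11:
  assumes M: "tensor_operator (\<lambda>_. 0) (\<lambda>_. 0) M"
  shows "M k = 0"
proof -
  have "(\<Sum>i\<in>UNIV. levi_civita i j k *\<^sub>R M i) = 0" for j k
    using M by (simp add: tensor_operator_def)
  from this [of 2 3] this [of 3 1] this [of 1 2] show ?thesis
    using exhaust_3 [of k] by (auto simp: sum_3)
qed

text \<open>Equivariance under block-diagonal generators is one condition per block. Skewness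
  determines the lower triangle from the upper one.\<close>

lemma tensor_operator_gen_form:
  assumes tens: "tensor_operator gen gen T" and skew: "\<And>i. cadj (T i) = - T i"
  shows "\<exists>f1 f2 c0 c1. \<forall>i. T i = form f1 f2 c0 c1 i"
proof -
  have "\<exists>A11 A12 A13 A21 A22 A23 A31 A32 A33. T i = block3 A11 A12 A13 A21 A22 A23 A31 A32 A33" for i
    by (metis block3_exhaust)
  then obtain A11 A12 A13 A21 A22 A23 A31 A32 A33
    where T: "\<And>i. T i = block3 (A11 i) (A12 i) (A13 i) (A21 i) (A22 i) (A23 i) (A31 i) (A32 i) (A33 i)"
    by metis
  have sk: "cadj (A11 i) = - A11 i" "cadj (A22 i) = - A22 i" "A21 i = - cadj (A12 i)"
    "A31 i = - cadj (A13 i)" "A32 i = - cadj (A23 i)" for i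
    using skew [of i] unfolding T cadj_block3 block3_minus block3_eq_iff
    by (simp_all add: minus_equation_iff)
  have "tensor_operator Y5 Y5 A11" "tensor_operator Y5 Y3 A12" "tensor_operator Y5 (\<lambda>_. 0) A13"
    "tensor_operator Y3 Y3 A22" "tensor_operator Y3 (\<lambda>_. 0) A23" "tensor_operator (\<lambda>_. 0) (\<lambda>_. 0) A33"
    using tens unfolding tensor_operator_def gen_def T block3_simps block3_eq_iff by simp_all
  with sk show ?thesis
    using tensor_55 [of A11] tensor_53 [of A12] tensor_51 [of A13] tensor_33 [of A22]
      tensor_31 [of A23] tensor_11 [of A33]
    by (simp add: T form_def block3_eq_iff) (metis cadj_mat_mult)
qed

text \<open>Upper off-diagonal blocks are intertwiners into a larger irreducible space and vanish by
  dimension; hermiticity disposes of the lower ones.\<close>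

lemma commutes_gen_hermitian:
  assumes comm: "\<And>j. gen j ** H = H ** gen j" and herm: "cadj H = H"
  shows "\<exists>a b c. H = block3 (mat a) 0 0 0 (mat b) 0 0 0 (mat c)"
proof -
  obtain H11 H12 H13 H21 H22 H23 H31 H32 H33
    where H: "H = block3 H11 H12 H13 H21 H22 H23 H31 H32 H33"
    by (rule block3_exhaust)
  have he: "H21 = cadj H12" "H31 = cadj H13" "H32 = cadj H23"
    using herm unfolding H cadj_block3 block3_eq_iff by simp_all
  have c: "Y5 j ** H11 = H11 ** Y5 j" "Y5 j ** H12 = H12 ** Y3 j" "Y5 j ** H13 = 0"
    "Y3 j ** H22 = H22 ** Y3 j" "Y3 j ** H23 = 0" for j
    using comm [of j] unfolding H gen_def block3_mult block3_eq_iff by simp_all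
  have z: "H12 = 0" "H13 = 0" "H23 = 0"
    using intertwiner_35_zero [OF c(2)] intertwiner_15_zero [OF c(3)] intertwiner_13_zero [OF c(5)]
    by blast+
  obtain x where x: "H11 = mat x" using schur5 [OF c(1)] by blast
  obtain y where y: "H22 = mat y" using schur3 [OF c(4)] by blast
  have "H33 = mat (H33 $ 1 $ 1)"
    by (simp add: vec_eq_iff mat_def)
  with x y z he show ?thesis
    unfolding H by (auto simp: block3_eq_iff)
qed

subsection \<open>The representation at the poles\<close>

lemma Y5_B_Y3: "Y5 i ** B k = 2 *\<^sub>R (B k ** Y3 i) - B i ** Y3 k"
proof -
  have "levi_civita m i k = levi_civita i k m" for m
    by (metis levi_civita_swap(1,2) minus_minus)
  then show ?thesis
    using B_Y3_antisym [of i k] by (simp add: Y5_B scaleR_2 algebra_simps)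
qed

text \<open>For x^2 = 2 and z^2 = 2/3 this is sqrt 2 times a unitary Clebsch-Gordan map from the
  tensor product of V_3 and C^3, with column k belonging to the k-th basis vector of C^3. The signs
  of \<open>x\<close> and \<open>z\<close> stay free to serve both poles.\<close>

definition pole_map :: "real \<Rightarrow> real \<Rightarrow> complex^(3 + 3 + 3)^(5 + 3 + 1)" where
  "pole_map x z = block3
     (x *\<^sub>R B 1) (x *\<^sub>R B 2) (x *\<^sub>R B 3)
     (Y3 1) (Y3 2) (Y3 3)
     (z *\<^sub>R cadj (b 1)) (z *\<^sub>R cadj (b 2)) (z *\<^sub>R cadj (b 3))"

lemma pole_map_intertwines:
  assumes "x\<^sup>2 = 2" "z\<^sup>2 = 2/3"
  shows "form (1/2) (1/2) (of_real z) (of_real (x/2)) i ** pole_map x z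
     = pole_map x z ** block3 (Y3 i) 0 0 0 (Y3 i) 0 0 0 (Y3 i)"
proof -
  \<comment> \<open>First row: \<open>Y5_B_Y3\<close> produces an extra multiple of B_i Y_k, which
    the coefficient x/2 cancels.\<close>
  have 1: "(1/2) *\<^sub>R (Y5 i ** x *\<^sub>R B k) + (x/2) *\<^sub>R (B i ** Y3 k) = x *\<^sub>R (B k ** Y3 i)" for k
    by (simp add: Y5_B_Y3 vec_eq_iff scaleR_complex matrix_scaleR_right field_simps)
  \<comment> \<open>Second row, where the values of x^2 and z^2 enter: the terms in
    \<open>b k ** cadj (b i)\<close> cancel, and 1/3 + 2/3 = 1 leaves
    \<open>Y3 k ** Y3 i\<close>.\<close>
  have 2: "- ((x/2) *\<^sub>R (cadj (B i) ** x *\<^sub>R B k)) + (1/2) *\<^sub>R (Y3 i ** Y3 k) + z *\<^sub>R (b i ** z *\<^sub>R cadj (b k))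
      = Y3 k ** Y3 i" for k
  proof -
    have "x * x = 2" "z * z = 2/3"
      using assms by (simp_all add: power2_eq_square)
    moreover have "complex_of_real z * (complex_of_real z * 3) = 2"
    proof -
      have "complex_of_real z * (complex_of_real z * 3) = 3 * of_real (z * z)"
        by simp
      then show ?thesis
        unfolding \<open>z * z = 2/3\<close> by simp
    qed
    ultimately show ?thesis
      by (simp add: matrix_scaleR_right B_cadj_B gram_def Y3_Y3)
        (simp add: vec_eq_iff scaleR_complex field_simps)
  qed
  have 3: "cadj (b i) ** Y3 k = - (cadj (b k) ** Y3 i)" for k
  proof -
    have "Y3 k ** b i = - (Y3 i ** b k)"
      using exhaust_3 [of i] exhaust_3 [of k] by (auto simp: Y3_b sum_3)
    from arg_cong [OF this, of cadj] have "- (cadj (b i) ** Y3 k) = cadj (b k) ** Y3 i"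
      by (simp add: cadj_simps skew3 matrix_ring_simps)
    then show ?thesis
      by (metis minus_minus)
  qed
  show ?thesis
    unfolding form_def pole_map_def block3_mult block3_eq_iff complex_cnj_complex_of_real
      mat_of_real_mult matrix_scaleR_left matrix_mult_minus_left
    using 1 2 3 by (simp add: matrix_scaleR_left)
qed

text \<open>The diagonal blocks of the first product are x^2, minus the Casimir value of V_3, and 3
  z^2, all equal to 2. In the other order the terms of \<open>gram\<close> and \<open>Y3_Y3\<close>
  combine to twice the identity.\<close>

lemma pole_map_unitary:
  assumes "x\<^sup>2 = 2" "z\<^sup>2 = 2/3"
  shows "pole_map x z ** cadj (pole_map x z) = mat 2" "cadj (pole_map x z) ** pole_map x z = mat 2"
proof -
  have xz: "x * x = 2" "z * z = 2/3"
    using assms by (simp_all add: power2_eq_square)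
  \<comment> \<open>Every contraction identity is solved for its term with index 3, so that
    rewriting eliminates these terms.\<close>
  have E: "B 3 ** cadj (B 3) = mat 1 - B 1 ** cadj (B 1) - B 2 ** cadj (B 2)"
    "Y3 3 ** Y3 3 = mat (- 2) - Y3 1 ** Y3 1 - Y3 2 ** Y3 2"
    "B 3 ** Y3 3 = - (B 1 ** Y3 1) - B 2 ** Y3 2"
    "B 3 ** b 3 = - (B 1 ** b 1) - B 2 ** b 2"
    "Y3 3 ** b 3 = - (Y3 1 ** b 1) - Y3 2 ** b 2"
    using B_norm casimir3 sum_B_Y3 sum_B_b sum_Y3_b
    by (simp_all add: sum_3 algebra_simps eq_neg_iff_add_eq_0)
  have F: "- (Y3 3 ** cadj (B 3)) = Y3 1 ** cadj (B 1) + Y3 2 ** cadj (B 2)"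
    "- (cadj (b 3) ** Y3 3) = cadj (b 1) ** Y3 1 + cadj (b 2) ** Y3 2"
    using arg_cong [OF E(3), of cadj] arg_cong [OF E(5), of cadj]
    by (simp_all add: cadj_simps skew3 matrix_ring_simps)
  have E': "Y3 3 ** cadj (B 3) = - (Y3 1 ** cadj (B 1)) - Y3 2 ** cadj (B 2)"
    "cadj (b 3) ** Y3 3 = - (cadj (b 1) ** Y3 1) - cadj (b 2) ** Y3 2"
    using arg_cong [OF F(1), of uminus] arg_cong [OF F(2), of uminus] by simp_all
  have E'': "cadj (b 3) ** cadj (B 3) = - (cadj (b 1) ** cadj (B 1)) - cadj (b 2) ** cadj (B 2)"
    using arg_cong [OF E(4), of cadj] by (simp add: cadj_simps)
  show "pole_map x z ** cadj (pole_map x z) = mat 2"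
    unfolding pole_map_def block3_mat [symmetric] cadj_block3 block3_mult block3_eq_iff
    by (simp add: cadj_simps skew3 matrix_ring_simps xz b_orth E E' E'')
      (simp add: vec_eq_iff mat_def scaleR_complex algebra_simps)
  show "cadj (pole_map x z) ** pole_map x z = mat 2"
    unfolding pole_map_def block3_mat [symmetric] cadj_block3 block3_mult block3_eq_iff
    by (simp add: cadj_simps skew3 matrix_ring_simps xz B_cadj_B gram_def Y3_Y3)
      (simp add: vec_eq_iff mat_def scaleR_complex field_simps)
qed

subsection \<open>Irreducibility\<close>

text \<open>The operators preserving W include the projections to the summands and each off-diagonal
  block. A vector of W with nonzero V_1 component thus yields V_1, then V_3 through the
  \<open>b\<close> and V_5 through the \<open>B\<close>. If there is none, the adjoint maps carry
  the other components down towards V_1, and they vanish too.\<close>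

lemma irreducible_gen_form:
  assumes W: "vec.subspace W" and gen: "\<And>i w. w \<in> W \<Longrightarrow> gen i *v w \<in> W"
    and form: "\<And>i w. w \<in> W \<Longrightarrow> form 0 0 c0 c1 i *v w \<in> W" and c: "c0 \<noteq> 0" "c1 \<noteq> 0"
  shows "W = {0} \<or> W = UNIV"
proof -
  define A where "A = {M. \<forall>w\<in>W. M *v w \<in> W}"
  have A_add: "M + N \<in> A" if "M \<in> A" "N \<in> A" for M N
    using that W by (auto simp: A_def matrix_vector_mult_add_rdistrib vec.subspace_add)
  have A_mult: "M ** N \<in> A" if "M \<in> A" "N \<in> A" for M N
    using that by (auto simp: A_def matrix_vector_mul_assoc [symmetric])
  have A_mat: "mat x \<in> A" for x
  proof -
    have "mat x *v w = x *s w" for w :: "complex^(5 + 3 + 1)"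
      by (simp add: vec_eq_iff matrix_vector_mult_def mat_def if_distrib [of "\<lambda>x. x * _"] cong: if_cong)
    then show ?thesis
      using W by (auto simp: A_def vec.subspace_scale)
  qed
  have A_sum: "sum M (UNIV :: 3 set) \<in> A" if "\<And>i. M i \<in> A" for M
    using that by (auto simp: sum_3 intro!: A_add)
  define K :: "complex^(5 + 3 + 1)^(5 + 3 + 1)"
    where "K = block3 (mat (- 6)) 0 0 0 (mat (- 2)) 0 0 0 (0 :: complex^1^1)"
  have "K = (\<Sum>i\<in>UNIV. gen i ** gen i)"
    by (simp add: gen_def block3_simps casimir5 casimir3 K_def)
  moreover have "gen i \<in> A" for i
    using gen by (simp add: A_def)
  ultimately have K: "K \<in> A"
    by (simp add: A_sum A_mult)
  define P5 P3 P1 where "P5 = block3 (mat 1 :: complex^5^5) 0 0 0 (0 :: complex^3^3) 0 0 0 (0 :: complex^1^1)"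
    and "P3 = block3 (0 :: complex^5^5) 0 0 0 (mat 1 :: complex^3^3) 0 0 0 (0 :: complex^1^1)"
    and "P1 = block3 (0 :: complex^5^5) 0 0 0 (0 :: complex^3^3) 0 0 0 (mat 1 :: complex^1^1)"
  note P = P5_def P3_def P1_def
  have mat_block: "(mat x :: complex^(5 + 3 + 1)^(5 + 3 + 1)) = block3 (mat x) 0 0 0 (mat x) 0 0 0 (mat x :: complex^1^1)"
    for x by (rule block3_mat [symmetric])
  note mm = mat_mult_mat mat_add_mat
  \<comment> \<open>Lagrange interpolation at the Casimir values -6, -2 and 0: the normalising
    products are (-6)(-4) = 24, (-2)(4) = -8 and (6)(2) = 12.\<close>
  have "P5 = mat (1/24) ** (K ** (K + mat 2))"
    unfolding mat_block K_def P block3_simps block3_eq_iff by (simp add: mm)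
  then have P5: "P5 \<in> A"
    using K by (auto intro!: A_add A_mult A_mat)
  have "P3 = mat (- (1/8)) ** (K ** (K + mat 6))"
    unfolding mat_block K_def P block3_simps block3_eq_iff by (simp add: mm)
  then have P3: "P3 \<in> A"
    using K by (auto intro!: A_add A_mult A_mat)
  have "P1 = mat (1/12) ** ((K + mat 6) ** (K + mat 2))"
    unfolding mat_block K_def P block3_simps block3_eq_iff by (simp add: mm)
  then have P1: "P1 \<in> A"
    using K by (auto intro!: A_add A_mult A_mat)
  have F: "form 0 0 c0 c1 i \<in> A" for i
    using form by (simp add: A_def)
  define E53 where "E53 i = block3 (0 :: complex^5^5) (B i) 0 0 (0 :: complex^3^3) 0 0 0 (0 :: complex^1^1)" for i
  define E35 where "E35 i = block3 (0 :: complex^5^5) 0 0 (cadj (B i)) (0 :: complex^3^3) 0 0 0 (0 :: complex^1^1)" for i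
  define E31 where "E31 i = block3 (0 :: complex^5^5) 0 0 0 (0 :: complex^3^3) (b i) 0 0 (0 :: complex^1^1)" for i
  define E13 where "E13 i = block3 (0 :: complex^5^5) 0 0 0 (0 :: complex^3^3) 0 0 (cadj (b i)) (0 :: complex^1^1)" for i
  note E = E53_def E35_def E31_def E13_def
  \<comment> \<open>Compression by two projections isolates a single block, and its nonzero
    coefficient is divided out.\<close>
  have "E53 i = mat (1 / c1) ** (P5 ** form 0 0 c0 c1 i ** P3)"
    "E35 i = mat (- (1 / cnj c1)) ** (P3 ** form 0 0 c0 c1 i ** P5)"
    "E31 i = mat (1 / c0) ** (P3 ** form 0 0 c0 c1 i ** P1)"
    "E13 i = mat (- (1 / cnj c0)) ** (P1 ** form 0 0 c0 c1 i ** P3)" for i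
    unfolding mat_block E P form_def block3_simps block3_eq_iff using c
    by (simp_all add: mat_mult_mat_mult matrix_mult_minus_right matrix_mult_minus_left mat_minus_mult)
  then have EA: "E53 i \<in> A" "E35 i \<in> A" "E31 i \<in> A" "E13 i \<in> A" for i
    using P5 P3 P1 F by (auto intro!: A_mult A_mat)
  have EE: "P5 = (\<Sum>i\<in>UNIV. E53 i ** E35 i)" "P3 = (\<Sum>i\<in>UNIV. E31 i ** E13 i)"
    "E35 i = P3 ** E35 i" "E13 i = P1 ** E13 i" "E35 i = E35 i ** P5" "E13 i = E13 i ** P3"
    "mat 1 = P5 + P3 + P1" for i
    by (simp_all add: mat_block [of 1] E P block3_simps block3_eq_iff B_norm b_norm)
  have decomp: "w = P5 *v w + P3 *v w + P1 *v w" for w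
    using arg_cong [OF EE(7), of "\<lambda>M. M *v w"] by (simp add: matrix_vector_mult_add_rdistrib)
  have P3_v: "P3 *v w = (\<Sum>i\<in>UNIV. E31 i *v (E13 i *v w))" for w
    by (subst EE(2)) (simp add: sum_3 matrix_vector_mult_add_rdistrib matrix_vector_mul_assoc)
  have P5_v: "P5 *v w = (\<Sum>i\<in>UNIV. E53 i *v (E35 i *v w))" for w
    by (subst EE(1)) (simp add: sum_3 matrix_vector_mult_add_rdistrib matrix_vector_mul_assoc)
  have E13_v: "E13 i *v w = P1 *v (E13 i *v w)" and E35_v: "E35 i *v w = P3 *v (E35 i *v w)" for i w
    by (subst EE(3,4), simp add: matrix_vector_mul_assoc)+
  show ?thesis
  proof (cases "\<forall>w\<in>W. P1 *v w = 0")
    case True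
    have AW: "M *v w \<in> W" if "M \<in> A" "w \<in> W" for M w
      using that by (simp add: A_def)
    have P3_0: "P3 *v w = 0" if "w \<in> W" for w
    proof -
      have "E13 i *v w = 0" for i
        using True AW [OF EA(4) that] E13_v by metis
      then show ?thesis
        by (simp add: P3_v)
    qed
    have "P5 *v w = 0" if "w \<in> W" for w
    proof -
      have "E35 i *v w = 0" for i
        using P3_0 AW [OF EA(2) that] E35_v by metis
      then show ?thesis
        by (simp add: P5_v)
    qed
    with P3_0 True have "w = 0" if "w \<in> W" for w
      using decomp [of w] that by simp
    then show ?thesis
      using vec.subspace_0 [OF W] by auto
  next
    case False
    then obtain w where w: "w \<in> W" "P1 *v w \<noteq> 0" by blast
    have P1_entry: "(P1 *v v) $ x = (if x = Inr (Inr 1) then v $ Inr (Inr 1) else 0)" for v x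
      by (cases x; cases "projr x")
        (auto simp: P matrix_vector_mult_def sum_UNIV_Plus mat_def)
    then have "w $ Inr (Inr 1) \<noteq> 0"
      using w(2) unfolding vec_eq_iff P1_entry by (metis zero_index)
    \<comment> \<open>V_1 is a line, so one nonzero component already gives all of it.\<close>
    then have "P1 *v v = (v $ Inr (Inr 1) / w $ Inr (Inr 1)) *s (P1 *v w)" for v
      by (simp add: vec_eq_iff P1_entry)
    moreover have "P1 *v w \<in> W"
      using P1 w(1) by (simp add: A_def)
    ultimately have P1W: "P1 *v v \<in> W" for v
      using W by (metis vec.subspace_scale)
    have "E13 i *v v \<in> W" for i v
      using P1W E13_v by metis
    then have P3W: "P3 *v v \<in> W" for v
      unfolding P3_v using EA(3) W by (auto intro!: vec.subspace_sum simp: A_def)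
    have "E35 i *v v \<in> W" for i v
      using P3W E35_v by metis
    then have P5W: "P5 *v v \<in> W" for v
      unfolding P5_v using EA(1) W by (auto intro!: vec.subspace_sum simp: A_def)
    have "v \<in> W" for v
      using decomp [of v] P1W [of v] P3W [of v] P5W [of v] W by (metis vec.subspace_add)
    then show ?thesis by blast
  qed
qed

end

section \<open>Quadratic differential equations\<close>

text \<open>The n-th Taylor coefficient of a solution of x_i' = \<Sum> c_ijk x_j x_k as a function
  of its current value; the recursion compares coefficients of power series.\<close>

fun quadratic_coeff ::
  "('i::finite \<Rightarrow> 'i \<Rightarrow> 'i \<Rightarrow> real) \<Rightarrow> ('i \<Rightarrow> real) \<Rightarrow> nat \<Rightarrow> 'i \<Rightarrow> real" where
  "quadratic_coeff c x 0 i = x i"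
| "quadratic_coeff c x (Suc n) i = (\<Sum>j\<in>UNIV. \<Sum>k\<in>UNIV. c i j k *
     (\<Sum>m\<le>n. quadratic_coeff c x m j * quadratic_coeff c x (n - m) k)) / real (Suc n)"

text \<open>If differentiation sends a_m to (m + 1) a_(m+1), and likewise b, the Leibniz rule gives
  the same law for the Cauchy product: the weights m and p + 1 - m add up to p + 1.\<close>

lemma cauchy_product_derivative:
  fixes a b :: "nat \<Rightarrow> real"
  shows "(\<Sum>m\<le>p. real (Suc m) * a (Suc m) * b (p - m) + a m * (real (Suc (p - m)) * b (Suc (p - m))))
    = real (Suc p) * (\<Sum>m\<le>Suc p. a m * b (Suc p - m))"
proof -
  have "(\<Sum>m\<le>p. real (Suc m) * a (Suc m) * b (p - m)) = (\<Sum>m\<le>Suc p. real m * a m * b (Suc p - m))"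
    by (subst sum.atMost_Suc_shift) simp
  moreover have "(\<Sum>m\<le>p. a m * (real (Suc (p - m)) * b (Suc (p - m))))
      = (\<Sum>m\<le>Suc p. real (Suc p - m) * a m * b (Suc p - m))"
    by (simp add: Suc_diff_le mult_ac add_diff_eq)
  ultimately have "(\<Sum>m\<le>p. real (Suc m) * a (Suc m) * b (p - m) + a m * (real (Suc (p - m)) * b (Suc (p - m))))
      = (\<Sum>m\<le>Suc p. real m * a m * b (Suc p - m) + real (Suc p - m) * a m * b (Suc p - m))"
    by (simp only: sum.distrib)
  also have "\<dots> = (\<Sum>m\<le>Suc p. real (Suc p) * (a m * b (Suc p - m)))"
    by (intro sum.cong refl) (simp add: of_nat_diff algebra_simps)
  finally show ?thesis
    by (simp only: sum_distrib_left)
qed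

lemma quadratic_coeff_derivative:
  assumes "\<And>i t. t \<in> I \<Longrightarrow>
      (x i has_real_derivative (\<Sum>j\<in>UNIV. \<Sum>k\<in>UNIV. c i j k * (x j t * x k t))) (at t)"
    and "t \<in> I"
  shows "((\<lambda>t. quadratic_coeff c (\<lambda>i. x i t) n i) has_real_derivative
      real (Suc n) * quadratic_coeff c (\<lambda>i. x i t) (Suc n) i) (at t)"
proof (induction n arbitrary: i rule: less_induct)
  case (less n)
  show ?case
  proof (cases n)
    case 0
    then show ?thesis
      using assms(1) [OF assms(2), of i] by simp
  next
    case (Suc p)
    let ?d = "\<lambda>n i. quadratic_coeff c (\<lambda>i. x i t) n i"
    have IH: "((\<lambda>t. quadratic_coeff c (\<lambda>i. x i t) m j) has_real_derivative real (Suc m) * ?d (Suc m) j) (at t)"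
      if "m \<le> p" for m j
      using less [of m j] that Suc by simp
    have prod: "((\<lambda>t. quadratic_coeff c (\<lambda>i. x i t) m j * quadratic_coeff c (\<lambda>i. x i t) (p - m) k)
        has_real_derivative real (Suc m) * ?d (Suc m) j * ?d (p - m) k
          + ?d m j * (real (Suc (p - m)) * ?d (Suc (p - m)) k)) (at t)" if "m \<le> p" for m j k
      using DERIV_mult [OF IH [of m j] IH [of "p - m" k]] that by (simp only: diff_le_self add.commute mult.commute)
    have "((\<lambda>t. \<Sum>m\<le>p. quadratic_coeff c (\<lambda>i. x i t) m j * quadratic_coeff c (\<lambda>i. x i t) (p - m) k)
        has_real_derivative real (Suc p) * (\<Sum>m\<le>Suc p. ?d m j * ?d (Suc p - m) k)) (at t)" for j k
      unfolding cauchy_product_derivative [of "\<lambda>m. ?d m j" "\<lambda>m. ?d m k" p, symmetric]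
      by (intro DERIV_sum prod) simp
    then have "((\<lambda>t. (\<Sum>j\<in>UNIV. \<Sum>k\<in>UNIV. c i j k *
          (\<Sum>m\<le>p. quadratic_coeff c (\<lambda>i. x i t) m j * quadratic_coeff c (\<lambda>i. x i t) (p - m) k)) / real (Suc p))
        has_real_derivative (\<Sum>j\<in>UNIV. \<Sum>k\<in>UNIV. c i j k *
          (real (Suc p) * (\<Sum>m\<le>Suc p. ?d m j * ?d (Suc p - m) k))) / real (Suc p)) (at t)"
      by (intro DERIV_cdivide DERIV_sum DERIV_cmult)
    moreover have "(\<Sum>j\<in>UNIV. \<Sum>k\<in>UNIV. c i j k *
          (real (Suc p) * (\<Sum>m\<le>Suc p. ?d m j * ?d (Suc p - m) k))) / real (Suc p)
        = real (Suc n) * ?d (Suc n) i"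
    proof -
      have "(\<Sum>j\<in>UNIV. \<Sum>k\<in>UNIV. c i j k * (real (Suc p) * (\<Sum>m\<le>Suc p. ?d m j * ?d (Suc p - m) k)))
          = real (Suc p) * (\<Sum>j\<in>UNIV. \<Sum>k\<in>UNIV. c i j k * (\<Sum>m\<le>Suc p. ?d m j * ?d (Suc p - m) k))"
        unfolding sum_distrib_left by (intro sum.cong refl) (simp only: mult.left_commute)
      then show ?thesis
        unfolding Suc by (simp del: sum.atMost_Suc of_nat_Suc)
    qed
    ultimately show ?thesis
      unfolding Suc by (simp only: quadratic_coeff.simps(2) [of c _ p])
  qed
qed

text \<open>The Cauchy product has p + 1 terms, and this factor cancels against the division by p +
  1 in the recursion; hence the growth is only geometric.\<close>

lemma quadratic_coeff_bound:
  assumes "\<And>i. \<bar>x i\<bar> \<le> M" "0 \<le> M" "\<And>i. (\<Sum>j\<in>UNIV. \<Sum>k\<in>UNIV. \<bar>c i j k\<bar>) \<le> K"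
  shows "\<bar>quadratic_coeff c x n i\<bar> \<le> M * (K * M) ^ n"
proof (induction n arbitrary: i rule: less_induct)
  case (less n)
  have "0 \<le> (\<Sum>j\<in>UNIV. \<Sum>k\<in>UNIV. \<bar>c i j k\<bar>)"
    by (intro sum_nonneg) simp
  then have K: "0 \<le> K"
    using assms(3) [of i] by simp
  show ?case
  proof (cases n)
    case 0
    then show ?thesis using assms(1) by simp
  next
    case (Suc p)
    have prod: "\<bar>\<Sum>m\<le>p. quadratic_coeff c x m j * quadratic_coeff c x (p - m) k\<bar>
        \<le> real (Suc p) * (M * (M * (K * M) ^ p))" for j k
    proof -
      have "\<bar>quadratic_coeff c x m j * quadratic_coeff c x (p - m) k\<bar> \<le> M * (M * (K * M) ^ p)"
        if "m \<le> p" for m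
      proof -
        have "\<bar>quadratic_coeff c x m j * quadratic_coeff c x (p - m) k\<bar>
            \<le> (M * (K * M) ^ m) * (M * (K * M) ^ (p - m))"
          unfolding abs_mult using that Suc assms(2) K by (intro mult_mono less) auto
        also have "\<dots> = M * (M * ((K * M) ^ m * (K * M) ^ (p - m)))"
          by (simp only: mult_ac)
        finally show ?thesis
          using that by (simp flip: power_add)
      qed
      then have "(\<Sum>m\<le>p. \<bar>quadratic_coeff c x m j * quadratic_coeff c x (p - m) k\<bar>)
          \<le> real (card {..p}) * (M * (M * (K * M) ^ p))"
        by (intro sum_bounded_above) simp
      then show ?thesis
        by (intro order.trans [OF sum_abs]) simp
    qed
    have "\<bar>\<Sum>j\<in>UNIV. \<Sum>k\<in>UNIV. c i j k *
          (\<Sum>m\<le>p. quadratic_coeff c x m j * quadratic_coeff c x (p - m) k)\<bar>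
        \<le> (\<Sum>j\<in>UNIV. \<Sum>k\<in>UNIV. \<bar>c i j k\<bar> * (real (Suc p) * (M * (M * (K * M) ^ p))))"
      by (intro order.trans [OF sum_abs] sum_mono)
        (simp only: abs_mult, intro mult_left_mono prod abs_ge_zero)
    also have "\<dots> = (\<Sum>j\<in>UNIV. \<Sum>k\<in>UNIV. \<bar>c i j k\<bar>) * (real (Suc p) * (M * (M * (K * M) ^ p)))"
      by (simp only: sum_distrib_right)
    also have "\<dots> \<le> K * (real (Suc p) * (M * (M * (K * M) ^ p)))"
      using assms(2,3) K by (intro mult_right_mono) auto
    also have "\<dots> = real (Suc p) * (M * (K * M) ^ n)"
      unfolding Suc by (simp only: power_Suc mult_ac)
    finally have "\<bar>quadratic_coeff c x (Suc p) i\<bar> \<le> real (Suc p) * (M * (K * M) ^ n) / real (Suc p)"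
      unfolding quadratic_coeff.simps abs_divide abs_of_nat by (rule divide_right_mono) simp
    then show ?thesis
      by (simp add: Suc del: quadratic_coeff.simps of_nat_Suc power_Suc)
  qed
qed

text \<open>The bound on the Taylor coefficients is uniform near each point, so the Taylor series
  converges to the solution.\<close>

lemma quadratic_ode_real_analytic:
  fixes x :: "'i::finite \<Rightarrow> real \<Rightarrow> real"
  assumes "open I" and ode: "\<And>i t. t \<in> I \<Longrightarrow>
      (x i has_real_derivative (\<Sum>j\<in>UNIV. \<Sum>k\<in>UNIV. c i j k * (x j t * x k t))) (at t)"
  shows "real_analytic_on (x i) I"
  unfolding real_analytic_on_def
proof
  fix t0 assume "t0 \<in> I"
  then obtain r where r: "r > 0" "cball t0 r \<subseteq> I"
    using \<open>open I\<close> open_contains_cball by blast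
  have "\<exists>M. \<forall>t\<in>cball t0 r. \<bar>x i t\<bar> \<le> M" for i
  proof -
    have "continuous_on (cball t0 r) (x i)"
      using ode r(2) by (intro continuous_at_imp_continuous_on ballI DERIV_isCont) blast
    then have "bounded (x i ` cball t0 r)"
      by (intro compact_imp_bounded compact_continuous_image) auto
    then show ?thesis
      by (auto simp: bounded_iff)
  qed
  then obtain M' where M': "\<And>i t. t \<in> cball t0 r \<Longrightarrow> \<bar>x i t\<bar> \<le> M' i"
    by metis
  \<comment> \<open>The summand 1 keeps both constants positive, and with them the radius
    \<open>R\<close>.\<close>
  define M where "M = 1 + (\<Sum>i\<in>UNIV. \<bar>M' i\<bar>)"
  define K where "K = 1 + (\<Sum>i\<in>UNIV. \<Sum>j\<in>UNIV. \<Sum>k\<in>UNIV. \<bar>c i j k\<bar>)"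
  have M1: "1 \<le> M"
    by (simp add: M_def sum_nonneg)
  have K1: "1 \<le> K"
    by (simp add: K_def sum_nonneg)
  have M: "\<bar>x i t\<bar> \<le> M" if "t \<in> cball t0 r" for i t
  proof -
    have "\<bar>M' i\<bar> \<le> (\<Sum>i\<in>UNIV. \<bar>M' i\<bar>)"
      by (intro member_le_sum) auto
    then show ?thesis
      using M' [OF that, of i] by (simp add: M_def)
  qed
  have K: "(\<Sum>j\<in>UNIV. \<Sum>k\<in>UNIV. \<bar>c i j k\<bar>) \<le> K" for i
  proof -
    have "(\<Sum>j\<in>UNIV. \<Sum>k\<in>UNIV. \<bar>c i j k\<bar>) \<le> (\<Sum>i\<in>UNIV. \<Sum>j\<in>UNIV. \<Sum>k\<in>UNIV. \<bar>c i j k\<bar>)"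
      by (intro member_le_sum sum_nonneg) auto
    then show ?thesis
      by (simp add: K_def)
  qed
  let ?d = "\<lambda>n t. quadratic_coeff c (\<lambda>i. x i t) n i"
  \<comment> \<open>Within this radius the ratio K M |h| of the geometric bound stays below
    1.\<close>
  define R where "R = min r (1 / (2 * (K * M)))"
  have R: "R > 0"
    using r(1) K1 M1 by (simp add: R_def)
  have sums: "(\<lambda>n. ?d n t0 * h ^ n) sums x i (t0 + h)" if h: "\<bar>h\<bar> < R" for h
  proof (cases "h = 0")
    case True
    then show ?thesis
      using powser_sums_zero [of "\<lambda>n. ?d n t0"] by simp
  next
    case False
    have hr: "\<bar>h\<bar> < r" and hKM: "K * M * \<bar>h\<bar> < 1"
      using h K1 M1 by (auto simp: R_def field_simps)
    have sub: "t \<in> cball t0 r" if "t0 - \<bar>h\<bar> \<le> t" "t \<le> t0 + \<bar>h\<bar>" for t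
      using that hr by (auto simp: dist_real_def)
    have est: "\<bar>x i (t0 + h) - (\<Sum>m<n. ?d m t0 * h ^ m)\<bar> \<le> M * (K * M * \<bar>h\<bar>) ^ n" if n: "n > 0" for n
    proof -
      have "\<forall>m t. m < n \<and> t0 - \<bar>h\<bar> \<le> t \<and> t \<le> t0 + \<bar>h\<bar> \<longrightarrow>
          DERIV (\<lambda>t. fact m * ?d m t) t :> fact (Suc m) * ?d (Suc m) t"
      proof (intro allI impI)
        fix m t assume "m < n \<and> t0 - \<bar>h\<bar> \<le> t \<and> t \<le> t0 + \<bar>h\<bar>"
        then have "t \<in> I"
          using sub r(2) by blast
        from DERIV_cmult [OF quadratic_coeff_derivative [where x = x and c = c, OF ode this], of "fact m" m i]
        show "DERIV (\<lambda>t. fact m * ?d m t) t :> fact (Suc m) * ?d (Suc m) t"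
          by (simp only: fact_Suc mult_ac of_nat_mult)
      qed
      moreover have "- \<bar>h\<bar> \<le> h" "h \<le> \<bar>h\<bar>"
        by auto
      \<comment> \<open>Lagrange's form of the remainder: the intermediate point stays in the ball
        on which the coefficient bound is uniform.\<close>
      ultimately obtain t where t: "if t0 + h < t0 then t0 + h < t \<and> t < t0 else t0 < t \<and> t < t0 + h"
        and eq: "x i (t0 + h) = (\<Sum>m<n. ?d m t0 * h ^ m) + ?d n t * h ^ n"
        using Taylor [where diff = "\<lambda>m t. fact m * ?d m t" and f = "x i" and n = n
            and a = "t0 - \<bar>h\<bar>" and b = "t0 + \<bar>h\<bar>" and c = t0 and x = "t0 + h"] n False
        by (auto simp del: quadratic_coeff.simps(2))
      have "\<bar>?d n t\<bar> \<le> M * (K * M) ^ n"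
        using t M1 by (intro quadratic_coeff_bound M K sub) (auto split: if_splits)
      then have "\<bar>?d n t * h ^ n\<bar> \<le> M * (K * M) ^ n * \<bar>h\<bar> ^ n"
        unfolding abs_mult power_abs by (intro mult_right_mono) auto
      then show ?thesis
        by (simp add: eq power_mult_distrib mult.assoc)
    qed
    have "(\<lambda>n. M * (K * M * \<bar>h\<bar>) ^ n) \<longlonglongrightarrow> M * 0"
      using hKM K1 M1 by (intro tendsto_mult tendsto_const LIMSEQ_power_zero) (simp add: abs_mult)
    then have "(\<lambda>n. M * (K * M * \<bar>h\<bar>) ^ n) \<longlonglongrightarrow> 0"
      by simp
    moreover have "\<forall>\<^sub>F n in sequentially. norm (x i (t0 + h) - (\<Sum>m<n. ?d m t0 * h ^ m)) \<le> M * (K * M * \<bar>h\<bar>) ^ n"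
      using eventually_gt_at_top [of 0]
      by (rule eventually_mono) (simp only: real_norm_def est)
    ultimately have "(\<lambda>n. x i (t0 + h) - (\<Sum>m<n. ?d m t0 * h ^ m)) \<longlonglongrightarrow> 0"
      by (rule Lim_null_comparison [rotated])
    from tendsto_diff [OF tendsto_const [of "x i (t0 + h)"] this]
    show ?thesis
      by (simp add: sums_def)
  qed
  define F where "F = Abs_fps (\<lambda>n. ?d n t0)"
  have "summable (\<lambda>n. ?d n t0 * (R/2) ^ n)"
    using sums [of "R/2"] R by (auto simp: sums_iff)
  then have "norm (R/2) \<le> fps_conv_radius F"
    unfolding fps_conv_radius_def F_def fps_nth_Abs_fps by (rule conv_radius_geI)
  then have "fps_conv_radius F > 0"
    using R by (auto intro: less_le_trans [of 0 "ereal (norm (R/2))"])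
  moreover have "\<forall>\<^sub>F h in nhds 0. eval_fps F h = x i (t0 + h)"
  proof -
    have "\<forall>\<^sub>F h in nhds 0. \<bar>h\<bar> < R"
      using R by (auto simp: eventually_nhds_metric dist_real_def)
    then show ?thesis
    proof eventually_elim
      case (elim h)
      then show ?case
        using sums [of h] by (simp add: eval_fps_def F_def sums_iff)
    qed
  qed
  ultimately show "\<exists>F. (\<lambda>h. x i (t0 + h)) has_fps_expansion F"
    unfolding has_fps_expansion_def by blast
qed

text \<open>The integrating factor exp (- \<Phi>) is real, so every value of c is a real multiple of
  c(t0).\<close>

lemma linear_ode_constant_phase:
  fixes c :: "real \<Rightarrow> complex"
  assumes I: "is_interval I" and cont: "continuous_on I \<phi>"
    and ode: "\<And>t. t \<in> I \<Longrightarrow> (c has_vector_derivative of_real (\<phi> t) * c t) (at t)"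
  shows "\<exists>u. cmod u = 1 \<and> (\<forall>t\<in>I. \<exists>r. c t = of_real r * u)"
proof (cases "I = {}")
  case True
  then show ?thesis
    by (auto intro: exI [of _ 1])
next
  case False
  then obtain t0 where t0: "t0 \<in> I" by blast
  have proportional: "\<exists>r. c t = of_real r * c t0" if t: "t \<in> I" for t
  proof -
    define J where "J = {min t t0..max t t0}"
    have J: "J \<subseteq> I"
    proof
      fix s assume "s \<in> J"
      then show "s \<in> I"
        using mem_is_interval_1_I [OF I t t0, of s] mem_is_interval_1_I [OF I t0 t, of s]
        by (cases "t \<le> t0") (simp_all add: J_def)
    qed
    obtain \<Phi> where \<Phi>: "\<And>s. s \<in> J \<Longrightarrow> (\<Phi> has_vector_derivative \<phi> s) (at s within J)"
      using antiderivative_continuous [of "min t t0" "max t t0" \<phi>] continuous_on_subset [OF cont J]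
      unfolding J_def by metis
    have D: "((\<lambda>s. of_real (exp (- \<Phi> s)) * c s) has_vector_derivative 0) (at s within J)" if s: "s \<in> J" for s
    proof -
      have 1: "((\<lambda>s. exp (- \<Phi> s)) has_real_derivative exp (- \<Phi> s) * - \<phi> s) (at s within J)"
        using \<Phi> [OF s] unfolding has_real_derivative_iff_has_vector_derivative [symmetric]
        by (auto intro!: derivative_eq_intros)
      have "(c has_vector_derivative of_real (\<phi> s) * c s) (at s within J)"
        using ode J s by (blast intro: has_vector_derivative_at_within)
      from has_vector_derivative_mult [OF has_vector_derivative_of_real [OF 1] this]
      show ?thesis
        by (simp add: algebra_simps)
    qed
    have J': "convex J"
      by (simp add: J_def)
    obtain k where k: "\<And>s. s \<in> J \<Longrightarrow> of_real (exp (- \<Phi> s)) * c s = k"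
      by (rule has_vector_derivative_zero_constant [OF J' D]) (assumption, rule that)
    have "t \<in> J" "t0 \<in> J"
      by (auto simp: J_def)
    then have "of_real (exp (- \<Phi> t)) * c t = of_real (exp (- \<Phi> t0)) * c t0"
      by (simp add: k)
    then have "c t = of_real (exp (- \<Phi> t0) / exp (- \<Phi> t)) * c t0"
      by (simp add: field_simps)
    then show ?thesis by blast
  qed
  \<comment> \<open>If c(t0) = 0 then c vanishes on all of I and any phase will do.\<close>
  define u where "u = (if c t0 = 0 then 1 else sgn (c t0))"
  have u: "cmod u = 1" "c t0 = of_real (cmod (c t0)) * u"
    by (auto simp: u_def norm_sgn) (simp add: sgn_eq)
  have "\<exists>r. c t = of_real r * u" if t: "t \<in> I" for t
  proof -
    obtain r where "c t = of_real r * c t0"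
      using proportional [OF t] ..
    also have "\<dots> = of_real r * (of_real (cmod (c t0)) * u)"
      unfolding u(2) [symmetric] ..
    finally have "c t = of_real (r * cmod (c t0)) * u"
      by simp
    then show ?thesis by blast
  qed
  with u(1) show ?thesis by blast
qed

section \<open>Residues at the end points\<close>

text \<open>At s = 1 and s = -1 the denominator factors as (t - s)(t + s); dividing only by t + s
  leaves a function holomorphic near s, whose value at s is the residue.\<close>

lemma simple_residue_end_point:
  fixes x y :: complex
  assumes s: "s = 1 \<or> s = - 1"
    and f: "\<And>t. t \<in> {-1<..<1} \<Longrightarrow> f t = (of_real t * x + y) / (of_real t ^ 2 - 1)"
    and R: "R = (of_real s * x + y) / (2 * of_real s)"
  shows "simple_residue f {-1<..<1} s R"
proof -
  let ?s = "complex_of_real s"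
  define g where "g z = (z * x + y) / (z + ?s)" for z
  define F where "F z = g z / (z - ?s)" for z
  have ss: "?s * ?s = 1"
    using s by auto
  \<comment> \<open>The other zero -s is at distance 2, outside the unit ball.\<close>
  have nz: "z + ?s \<noteq> 0" if "z \<in> ball ?s 1" for z
  proof
    assume "z + ?s = 0"
    then have "z = - ?s"
      by (simp add: eq_neg_iff_add_eq_0)
    then show False
      using that s by (auto simp: dist_norm)
  qed
  have g: "g holomorphic_on ball ?s 1"
    unfolding g_def using nz by (intro holomorphic_intros) auto
  have F: "F holomorphic_on ball ?s 1 - {?s}"
    unfolding F_def by (intro holomorphic_intros holomorphic_on_subset [OF g]) auto
  have "F (of_real t) = f t" if "t \<in> {-1<..<1}" for t
  proof -
    have "(of_real t + ?s) * (of_real t - ?s) = of_real t ^ 2 - 1"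
      using ss by (simp add: algebra_simps power2_eq_square)
    then show ?thesis
      by (simp add: F_def g_def f [OF that])
  qed
  moreover have "s islimpt {-1<..<1}"
    using s islimpt_greaterThanLessThan1 [of "-1" "1 :: real"]
      islimpt_greaterThanLessThan2 [of "-1" "1 :: real"] by auto
  ultimately have ext: "punctured_disc_extension f {-1<..<1} s F"
    unfolding punctured_disc_extension_def using F by (auto intro!: exI [of _ "1 :: real"])
  have "isCont g ?s"
    using holomorphic_on_imp_differentiable_at [OF g]
    by (intro field_differentiable_imp_continuous_at) auto
  then have "(g \<longlongrightarrow> g ?s) (at ?s)"
    by (simp add: isCont_def)
  moreover have "\<forall>\<^sub>F z in at ?s. (z - ?s) * F z = g z"
    by (simp add: F_def eventually_at_filter)
  ultimately have lim: "((\<lambda>z. (z - ?s) * F z) \<longlongrightarrow> g ?s) (at ?s)"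
    by (simp add: tendsto_cong)
  have "residue F ?s = g ?s"
    unfolding F_def by (rule residue_simple [OF _ _ g]) auto
  also have "\<dots> = R"
    by (simp add: g_def R)
  finally show ?thesis
    unfolding simple_residue_def using ext lim by blast
qed

section \<open>Coordinates on so(3)\<close>

definition so3_coord :: "3 \<Rightarrow> real^3^3 \<Rightarrow> real" where
  "so3_coord i A = (if i = 1 then A $ 3 $ 2 else if i = 2 then A $ 1 $ 3 else A $ 2 $ 1)"

lemma so3_basis_in_so3: "so3_basis i \<in> so3"
  using exhaust_3 [of i] by (auto simp: so3_def so3_basis_def transpose_def vec_eq_iff forall_3)

lemma so3_add: "A \<in> so3 \<Longrightarrow> B \<in> so3 \<Longrightarrow> A + B \<in> so3"
proof -
  have "transpose (A + B) = transpose A + transpose B"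
    by (simp add: transpose_def vec_eq_iff)
  then show "A \<in> so3 \<Longrightarrow> B \<in> so3 \<Longrightarrow> A + B \<in> so3"
    by (simp add: so3_def)
qed

lemma so3_scaleR: "A \<in> so3 \<Longrightarrow> c *\<^sub>R A \<in> so3"
proof -
  have "transpose (c *\<^sub>R A) = c *\<^sub>R transpose A"
    by (simp add: transpose_def vec_eq_iff)
  then show "A \<in> so3 \<Longrightarrow> c *\<^sub>R A \<in> so3"
    by (simp add: so3_def)
qed

lemma so3_entry:
  assumes "A \<in> so3"
  shows "A $ i $ j = - A $ j $ i"
proof -
  have "transpose A $ j $ i = (- A) $ j $ i"
    using assms by (simp add: so3_def)
  then show ?thesis
    by (simp add: transpose_def)
qed

lemma so3_entries:
  assumes "A \<in> so3"
  shows "A $ 1 $ 1 = 0" "A $ 2 $ 2 = 0" "A $ 3 $ 3 = 0" "A $ 1 $ 2 = - A $ 2 $ 1"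
    "A $ 2 $ 3 = - A $ 3 $ 2" "A $ 3 $ 1 = - A $ 1 $ 3"
  using so3_entry [OF assms, of 1 1] so3_entry [OF assms, of 2 2] so3_entry [OF assms, of 3 3]
    so3_entry [OF assms, of 1 2] so3_entry [OF assms, of 2 3] so3_entry [OF assms, of 3 1]
  by simp_all

lemma so3_expansion:
  assumes "A \<in> so3"
  shows "A = (\<Sum>i\<in>UNIV. so3_coord i A *\<^sub>R so3_basis i)"
  using so3_entries [OF assms]
  by (simp add: vec_eq_iff forall_3 sum_3 so3_basis_def so3_coord_def)

lemma so3_coord_basis: "so3_coord i (so3_basis j) = (if i = j then 1 else 0)"
  using exhaust_3 [of i] exhaust_3 [of j] by (auto simp: so3_coord_def so3_basis_def)

lemma mcomm_so3_basis:
  "mcomm (so3_basis i) (so3_basis j) = (\<Sum>k\<in>UNIV. levi_civita i j k *\<^sub>R so3_basis k)"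
  using exhaust_3 [of i] exhaust_3 [of j]
  by (auto simp: mcomm_def so3_basis_def vec_eq_iff forall_3 matrix_mult_entry sum_3)

lemma so3_rep_sum:
  fixes X :: "3 \<Rightarrow> real^3^3"
  assumes "so3_rep \<rho>" and X: "\<And>i. X i \<in> so3"
  shows "\<rho> (\<Sum>i\<in>UNIV. c i *\<^sub>R X i) = (\<Sum>i\<in>UNIV. c i *\<^sub>R \<rho> (X i))"
  using assms by (simp add: sum_3 so3_rep_def so3_add so3_scaleR)

lemma so3_rep_expansion:
  assumes "so3_rep \<rho>" "A \<in> so3"
  shows "\<rho> A = (\<Sum>i\<in>UNIV. so3_coord i A *\<^sub>R \<rho> (so3_basis i))"
  using so3_rep_sum [OF assms(1), of so3_basis "\<lambda>i. so3_coord i A"] so3_expansion [OF assms(2)]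
  by (simp add: so3_basis_in_so3)

lemma so3_rep_mcomm:
  assumes "so3_rep \<rho>"
  shows "mcomm (\<rho> (so3_basis i)) (\<rho> (so3_basis j)) = (\<Sum>k\<in>UNIV. levi_civita i j k *\<^sub>R \<rho> (so3_basis k))"
proof -
  have "mcomm (\<rho> (so3_basis i)) (\<rho> (so3_basis j)) = \<rho> (mcomm (so3_basis i) (so3_basis j))"
    using assms so3_basis_in_so3 by (auto simp: so3_rep_def)
  then show ?thesis
    using so3_rep_sum [OF assms, of so3_basis] by (simp add: mcomm_so3_basis so3_basis_in_so3)
qed

text \<open>Linear extension of a triple with the bracket relations; it turns the residues at a pole
  into a representation.\<close>

lemma so3_rep_of_triple:
  fixes a :: "3 \<Rightarrow> complex^'n^'n"
  assumes "\<And>i j. mcomm (a i) (a j) = (\<Sum>k\<in>UNIV. levi_civita i j k *\<^sub>R a k)"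
  defines "\<sigma> \<equiv> \<lambda>A. \<Sum>i\<in>UNIV. so3_coord i A *\<^sub>R a i"
  shows "so3_rep \<sigma>" "\<sigma> (so3_basis i) = a i"
proof -
  show "\<sigma> (so3_basis i) = a i"
    by (simp add: \<sigma>_def so3_coord_basis if_distrib [of "\<lambda>c. c *\<^sub>R _"] cong: if_cong)
  have comm: "a 1 ** a 2 = a 2 ** a 1 + a 3" "a 2 ** a 3 = a 3 ** a 2 + a 1"
    "a 3 ** a 1 = a 1 ** a 3 + a 2"
    using assms(1) [of 1 2] assms(1) [of 2 3] assms(1) [of 3 1]
    by (simp_all add: mcomm_def sum_3 algebra_simps)
  have "\<sigma> (mcomm A B) = mcomm (\<sigma> A) (\<sigma> B)" if "A \<in> so3" "B \<in> so3" for A B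
  proof -
    show ?thesis
      by (simp add: \<sigma>_def sum_3 so3_coord_def mcomm_def matrix_ring_simps comm matrix_mult_entry
          so3_entries [OF that(1)] so3_entries [OF that(2)])
        (simp add: vec_eq_iff algebra_simps)
  qed
  then show "so3_rep \<sigma>"
    by (simp add: so3_rep_def \<sigma>_def so3_coord_def sum_3 algebra_simps)
qed

lemma irreducible_range_generators:
  assumes "so3_rep \<rho>" "irreducible_family (\<rho> ` so3)"
  shows "irreducible_family (range (\<lambda>i. \<rho> (so3_basis i)))"
  unfolding irreducible_family_def
proof (intro allI impI, elim conjE)
  fix W assume W: "vec.subspace W" and inv: "\<forall>M\<in>range (\<lambda>i. \<rho> (so3_basis i)). \<forall>w\<in>W. M *v w \<in> W"
  have "\<rho> A *v w \<in> W" if "A \<in> so3" "w \<in> W" for A w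
  proof -
    have "\<rho> A *v w = (\<Sum>i\<in>UNIV. of_real (so3_coord i A) *s (\<rho> (so3_basis i) *v w))"
      unfolding so3_rep_expansion [OF assms(1) that(1)]
      by (simp add: vec_eq_iff matrix_vector_mult_def sum_3 scaleR_conv_of_real [where 'a = complex]
          distrib_right sum.distrib sum_distrib_left mult.assoc)
    also have "\<dots> \<in> W"
      using W inv that(2) by (auto intro!: vec.subspace_sum vec.subspace_scale)
    finally show ?thesis .
  qed
  then show "W = {0} \<or> W = UNIV"
    using assms(2) W unfolding irreducible_family_def by blast
qed

text \<open>1-by-1 matrices commute, while every basis element of so(3) is a bracket.\<close>

lemma so3_rep_dim_one:
  fixes \<rho> :: "real^3^3 \<Rightarrow> complex^1^1"
  assumes "so3_rep \<rho>"
  shows "\<rho> (so3_basis i) = 0"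
proof -
  have "(\<Sum>k\<in>UNIV. levi_civita i j k *\<^sub>R \<rho> (so3_basis k)) = 0" for i j
    unfolding so3_rep_mcomm [OF assms, symmetric]
    by (simp add: mcomm_def vec_eq_iff matrix_mult_entry mult.commute)
  from this [of 2 3] this [of 3 1] this [of 1 2] show ?thesis
    using exhaust_3 [of i] by (auto simp: sum_3)
qed

section \<open>Gauge transformations\<close>

lemma gram_diagonal_pos:
  fixes P :: "complex^'n^'n"
  assumes "invertible P"
  shows "\<exists>r>0. (cadj P ** P) $ i $ i = of_real r"
proof -
  let ?r = "\<Sum>k\<in>UNIV. (cmod (P $ k $ i))\<^sup>2"
  have "(cadj P ** P) $ i $ i = of_real ?r"
    by (simp add: matrix_mult_entry cadj_def complex_norm_square [symmetric] mult.commute [of "cnj _"])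
  moreover have "?r \<noteq> 0"
  proof
    assume "?r = 0"
    then have "P $ k $ i = 0" for k
      by (simp add: sum_nonneg_eq_0_iff)
    then have "P *v axis i 1 = 0"
      by (simp add: vec_eq_iff matrix_vector_mult_def axis_def if_distrib [of "\<lambda>x. _ * x"] cong: if_cong)
    then have "axis i 1 = (0 :: complex^'n)"
      using assms invertible_left_inverse matrix_left_invertible_ker by blast
    then show False by simp
  qed
  moreover have "?r \<ge> 0"
    by (simp add: sum_nonneg)
  ultimately show ?thesis
    by (metis order_le_less)
qed

text \<open>Take an n-th root of the inverse determinant. The extra phase disappears under
  conjugation.\<close>

lemma unitary_scaled_to_SU:
  fixes M :: "complex^'n^'n"
  assumes M: "M ** cadj M = mat 1"
  shows "\<exists>w. cmod w = 1 \<and> mat w ** M \<in> SU"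
proof -
  have cdet: "det (cadj M) = cnj (det M)"
  proof -
    have "det (cadj M) = det (\<chi> i j. cnj (M $ i $ j))"
      by (subst det_transpose [symmetric]) (simp add: cadj_def transpose_def)
    then show ?thesis
      by (simp add: det_def)
  qed
  have "det M * cnj (det M) = 1"
    using arg_cong [OF M, of det] by (simp add: det_mul cdet det_I)
  then have "cmod (det M) * cmod (det M) = 1"
    by (metis norm_mult complex_mod_cnj norm_one)
  then have d: "cmod (det M) = 1"
    using norm_ge_zero [of "det M"] unfolding square_eq_1_iff by linarith
  then have d0: "det M \<noteq> 0"
    by auto
  obtain w where w: "inverse (det M) = w ^ CARD('n)"
    by (rule exists_complex_root [of "CARD('n)" "inverse (det M)"]) (simp, rule that)
  have "cmod w ^ CARD('n) = 1"
    by (simp add: norm_power [symmetric] w [symmetric] norm_inverse d)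
  then have "cmod w = 1"
    using power_eq_imp_eq_base [of "cmod w" "CARD('n)" 1] by simp
  moreover have "mat w ** M \<in> SU"
  proof -
    have "(mat w ** M) ** cadj (mat w ** M) = mat (w * cnj w) ** (M ** cadj M)"
      by (simp add: cadj_mat_mult mult_mat_mult [of M] matrix_assoc_right mat_mult_mat_mult)
    also have "\<dots> = mat 1"
      using \<open>cmod w = 1\<close> by (simp add: M complex_norm_square [symmetric])
    finally have "(mat w ** M) ** cadj (mat w ** M) = mat 1" .
    moreover have "det (mat w ** M) = 1"
      using d0 by (simp add: det_mat_mult w [symmetric])
    ultimately show ?thesis
      by (simp add: SU_def)
  qed
  ultimately show ?thesis by blast
qed

lemma bounded_linear_conjugation: "bounded_linear (\<lambda>M :: complex^'n^'n. A ** M ** B)"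
  unfolding linear_conv_bounded_linear [symmetric]
  by (rule linearI) (simp_all add: matrix_ring_simps)

lemma bounded_linear_entry_divide: "bounded_linear (\<lambda>M :: complex^'n^'m. M $ a $ b / y)"
  unfolding linear_conv_bounded_linear [symmetric]
  by (rule linearI) (simp_all add: scaleR_complex add_divide_distrib)

section \<open>The explicit solution\<close>

lemma quotient_square_minus_one_deriv:
  fixes t a b :: real
  assumes "t\<^sup>2 \<noteq> 1"
  shows "((\<lambda>t. (a * t + b) / (t\<^sup>2 - 1)) has_real_derivative
     (- a * (t\<^sup>2 + 1) - 2 * b * t) / (t\<^sup>2 - 1)\<^sup>2) (at t)"
  using assms
  by (auto intro!: derivative_eq_intros simp: power2_eq_square algebra_simps)

lemma explicit_reduced_solution:
  "reduced_solution (\<lambda>t. - (t / (t\<^sup>2 - 1))) (\<lambda>t. - (t / (t\<^sup>2 - 1)))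
     (\<lambda>t. sqrt 8 / (sqrt 3 * (t\<^sup>2 - 1))) (\<lambda>t. sqrt 2 / (t\<^sup>2 - 1)) {-1<..<1}"
  unfolding reduced_solution_def
proof (intro ballI conjI)
  fix t :: real assume "t \<in> {-1<..<1}"
  then have t: "t\<^sup>2 \<noteq> 1"
    by (simp add: power2_eq_1_iff)
  let ?q = "t\<^sup>2 - 1"
  have q: "?q \<noteq> 0" using t by simp
  have f: "((\<lambda>t. - (t / (t\<^sup>2 - 1))) has_real_derivative (t\<^sup>2 + 1) / ?q\<^sup>2) (at t)"
    using quotient_square_minus_one_deriv [OF t, of "-1" 0] by simp
  have g: "((\<lambda>t. c / (t\<^sup>2 - 1)) has_real_derivative (- 2 * c * t) / ?q\<^sup>2) (at t)" for c
    using quotient_square_minus_one_deriv [OF t, of 0 c] by simp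
  have g0: "sqrt 8 / (sqrt 3 * (t\<^sup>2 - 1)) = (sqrt 8 / sqrt 3) / (t\<^sup>2 - 1)" for t
    by simp
  show "((\<lambda>t. - (t / (t\<^sup>2 - 1))) has_real_derivative
      (- (t / ?q))\<^sup>2 + (sqrt 8 / (sqrt 3 * ?q))\<^sup>2 - 5/6 * (sqrt 2 / ?q)\<^sup>2) (at t)"
  proof (rule DERIV_cong [OF f])
    have "(T + 1) / u = T / u + 8 / (3 * u) - 5/6 * (2 / u)" if "u \<noteq> 0" for T u :: real
      using that by (simp add: field_simps)
    from this [of "?q\<^sup>2" "t\<^sup>2"] q
    show "(t\<^sup>2 + 1) / ?q\<^sup>2 = (- (t / ?q))\<^sup>2 + (sqrt 8 / (sqrt 3 * ?q))\<^sup>2 - 5/6 * (sqrt 2 / ?q)\<^sup>2"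
      by (simp add: power_divide power_mult_distrib)
  qed
  show "((\<lambda>t. - (t / (t\<^sup>2 - 1))) has_real_derivative
      (- (t / ?q))\<^sup>2 + 1/2 * (sqrt 2 / ?q)\<^sup>2) (at t)"
    by (rule DERIV_cong [OF f]) (use q in \<open>simp add: power_divide field_simps\<close>)
  show "((\<lambda>t. sqrt 8 / (sqrt 3 * (t\<^sup>2 - 1))) has_real_derivative
      2 * - (t / ?q) * (sqrt 8 / (sqrt 3 * ?q))) (at t)"
    unfolding g0
    by (rule DERIV_cong [OF g]) (use q in \<open>simp add: field_simps power2_eq_square\<close>)
  show "((\<lambda>t. sqrt 2 / (t\<^sup>2 - 1)) has_real_derivative
      (3 * - (t / ?q) - - (t / ?q)) * (sqrt 2 / ?q)) (at t)"
  proof (rule DERIV_cong [OF g])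
    have "(- 2 * c * t) / u\<^sup>2 = (3 * - (t / u) - - (t / u)) * (c / u)" if "u \<noteq> 0" for c u :: real
      using that by (simp add: field_simps power2_eq_square)
    from this [OF q] show "(- 2 * sqrt 2 * t) / ?q\<^sup>2 = (3 * - (t / ?q) - - (t / ?q)) * (sqrt 2 / ?q)" .
  qed
qed

text \<open>On the interval F(t) (t^2 - 1) + t = 0; continuity at s would give s = 0 in the
  limit.\<close>

lemma no_continuous_extension:
  fixes F :: "real \<Rightarrow> real"
  assumes s: "s = 1 \<or> s = - 1" and F: "\<And>t. t \<in> {-1<..<1} \<Longrightarrow> F t = - (t / (t\<^sup>2 - 1))"
  shows "\<not> isCont F s"
proof
  assume "isCont F s"
  then have "(F \<longlongrightarrow> F s) (at s within {-1<..<1})"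
    unfolding isCont_def by (rule tendsto_within_subset) simp
  then have "((\<lambda>t. F t * (t\<^sup>2 - 1) + t) \<longlongrightarrow> F s * (s\<^sup>2 - 1) + s) (at s within {-1<..<1})"
    by (intro tendsto_intros)
  moreover have "\<forall>\<^sub>F t in at s within {-1<..<1}. F t * (t\<^sup>2 - 1) + t = 0"
    unfolding eventually_at_filter
  proof (intro always_eventually allI impI)
    fix t :: real assume t: "t \<in> {-1<..<1}"
    then have "t\<^sup>2 \<noteq> 1"
      by (simp add: power2_eq_1_iff)
    then show "F t * (t\<^sup>2 - 1) + t = 0"
      by (simp add: F [OF t])
  qed
  ultimately have "((\<lambda>_. 0) \<longlongrightarrow> F s * (s\<^sup>2 - 1) + s) (at s within {-1<..<1})"
    by (rule Lim_transform_eventually)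
  moreover have "at s within {-1<..<1} \<noteq> bot"
    using s islimpt_greaterThanLessThan1 [of "-1" "1 :: real"]
      islimpt_greaterThanLessThan2 [of "-1" "1 :: real"] by (auto simp: trivial_limit_within)
  ultimately have "F s * (s\<^sup>2 - 1) + s = 0"
    using tendsto_unique tendsto_const by blast
  then show False
    using s by auto
qed

lemma explicit_maximally_extended:
  "maximally_extended_reduced_solution (\<lambda>t. - (t / (t\<^sup>2 - 1))) (\<lambda>t. - (t / (t\<^sup>2 - 1)))
     (\<lambda>t. sqrt 8 / (sqrt 3 * (t\<^sup>2 - 1))) (\<lambda>t. sqrt 2 / (t\<^sup>2 - 1)) {-1<..<1}"
  unfolding maximally_extended_reduced_solution_def
proof (intro conjI explicit_reduced_solution notI, elim exE conjE)
  fix J F1 F2 G0 G1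
  assume J: "is_interval J" "{-1<..<1} \<subset> J" and sol: "reduced_solution F1 F2 G0 G1 J"
    and F: "\<forall>t\<in>{-1<..<1}. F1 t = - (t / (t\<^sup>2 - 1)) \<and> F2 t = - (t / (t\<^sup>2 - 1)) \<and>
       G0 t = sqrt 8 / (sqrt 3 * (t\<^sup>2 - 1)) \<and> G1 t = sqrt 2 / (t\<^sup>2 - 1)"
  obtain u where u: "u \<in> J" "u \<notin> {-1<..<1}"
    using J(2) by blast
  have "(0 :: real) \<in> {-1<..<1}"
    by simp
  then have z: "0 \<in> J"
    using J(2) by blast
  have "\<exists>s. (s = 1 \<or> s = - 1) \<and> s \<in> J"
  proof (cases "u \<ge> 1")
    case True
    then show ?thesis
      using mem_is_interval_1_I [OF J(1) z u(1), of 1] by auto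
  next
    case False
    then have "u \<le> - 1"
      using u(2) by auto
    then show ?thesis
      using mem_is_interval_1_I [OF J(1) u(1) z, of "- 1"] by auto
  qed
  then obtain s where s: "s = 1 \<or> s = - 1" "s \<in> J"
    by blast
  have "isCont F1 s"
    using sol s(2) DERIV_isCont unfolding reduced_solution_def by blast
  then show False
    using no_continuous_extension [OF s(1), of F1] F by blast
qed

section \<open>Reduction of Nahm's equations\<close>

lemma matrix_conj_unitary:
  fixes M N R :: "complex^'n^'n"
  assumes "R ** cadj R = mat 1"
  shows "cadj R ** (M ** N) ** R = (cadj R ** M ** R) ** (cadj R ** N ** R)"
proof -
  have "(cadj R ** M ** R) ** (cadj R ** N ** R) = cadj R ** (M ** ((R ** cadj R) ** (N ** R)))"
    by (simp add: matrix_assoc_right)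
  then show ?thesis
    by (simp add: assms matrix_assoc_right)
qed

lemma mcomm_conj_unitary:
  fixes M N R :: "complex^'n^'n"
  assumes "R ** cadj R = mat 1"
  shows "cadj R ** mcomm M N ** R = mcomm (cadj R ** M ** R) (cadj R ** N ** R)"
  unfolding mcomm_def matrix_diff_ldistrib matrix_diff_rdistrib matrix_conj_unitary [OF assms] ..

lemma trace_mcomm: "trace (mcomm M N) = 0" for M N :: "complex^'n^'n"
  by (simp add: mcomm_def trace_sub trace_mult_commute [of M N])

context so3_blocks begin

text \<open>Linearity over four constant matrices, which reduces differentiating the triple to
  differentiating its coefficients.\<close>

lemma form_expansion:
  "form f1 f2 (of_real g0) (of_real g1) i =
     f1 *\<^sub>R form 1 0 0 0 i + f2 *\<^sub>R form 0 1 0 0 i + g0 *\<^sub>R form 0 0 1 0 i + g1 *\<^sub>R form 0 0 0 1 i"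
  using mat_of_real_mult [of 1 "B i"] mat_of_real_mult [of 1 "b i"]
    mat_of_real_mult [of 1 "cadj (B i)"] mat_of_real_mult [of 1 "cadj (b i)"]
  by (simp add: form_def block3_simps block3_eq_iff mat_of_real_mult)

lemma gen_form: "gen i = form 1 1 0 0 i"
  by (simp add: gen_def form_def block3_eq_iff)

lemma cadj_form: "cadj (form f1 f2 c0 c1 i) = - form f1 f2 c0 c1 i"
  by (simp add: form_def block3_simps block3_eq_iff cadj_minus cadj_scaleR cadj_mat_mult
      skew5 skew3)

text \<open>Each diagonal block is a multiple of a commutator and thus traceless.\<close>

lemma trace_form: "trace (form f1 f2 c0 c1 i) = 0"
proof -
  have c: "mcomm (Y5 2) (Y5 3) = Y5 1" "mcomm (Y5 3) (Y5 1) = Y5 2" "mcomm (Y5 1) (Y5 2) = Y5 3"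
    "mcomm (Y3 2) (Y3 3) = Y3 1" "mcomm (Y3 3) (Y3 1) = Y3 2" "mcomm (Y3 1) (Y3 2) = Y3 3"
    by (simp_all add: comm5 comm3 sum_3)
  have "trace (Y5 i) = 0" "trace (Y3 i) = 0"
    using exhaust_3 [of i] trace_mcomm [of "Y5 2" "Y5 3"] trace_mcomm [of "Y5 3" "Y5 1"]
      trace_mcomm [of "Y5 1" "Y5 2"] trace_mcomm [of "Y3 2" "Y3 3"] trace_mcomm [of "Y3 3" "Y3 1"]
      trace_mcomm [of "Y3 1" "Y3 2"] by (auto simp: c)
  then show ?thesis
    by (simp add: form_def trace_block3 trace_scaleR) (simp add: trace_def)
qed

lemma form_vector_derivative:
  assumes "(f1 has_real_derivative d1) (at t)" "(f2 has_real_derivative d2) (at t)"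
    "(g0 has_real_derivative e0) (at t)" "(g1 has_real_derivative e1) (at t)"
  shows "((\<lambda>t. form (f1 t) (f2 t) (of_real (g0 t)) (of_real (g1 t)) i) has_vector_derivative
     form d1 d2 (of_real e0) (of_real e1) i) (at t)"
  unfolding form_expansion
  by (intro has_vector_derivative_add)
    (use assms in \<open>auto intro!: bounded_linear.has_vector_derivative [OF bounded_linear_scaleR_left]
      simp: has_real_derivative_iff_has_vector_derivative\<close>)

lemma reduced_imp_nahm:
  assumes "reduced_solution f1 f2 g0 g1 I"
  shows "nahm_solution (\<lambda>i t. form (f1 t) (f2 t) (of_real (g0 t)) (of_real (g1 t)) i) I"
  unfolding nahm_solution_def
proof (intro conjI allI ballI)
  fix i t assume "t \<in> I"
  show "form (f1 t) (f2 t) (of_real (g0 t)) (of_real (g1 t)) i \<in> su"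
    by (simp add: su_def cadj_form trace_form)
next
  fix t assume t: "t \<in> I"
  define E where "E i = form ((f1 t)\<^sup>2 + (g0 t)\<^sup>2 - 5/6 * (g1 t)\<^sup>2) ((f2 t)\<^sup>2 + 1/2 * (g1 t)\<^sup>2)
       (of_real (2 * f1 t * g0 t)) (of_real ((3 * f2 t - f1 t) * g1 t)) i" for i
  have D: "((\<lambda>t. form (f1 t) (f2 t) (of_real (g0 t)) (of_real (g1 t)) i) has_vector_derivative E i) (at t)" for i
    unfolding E_def using assms t by (intro form_vector_derivative) (simp_all add: reduced_solution_def)
  have comm: "mcomm (form (f1 t) (f2 t) (of_real (g0 t)) (of_real (g1 t)) j)
      (form (f1 t) (f2 t) (of_real (g0 t)) (of_real (g1 t)) k)
      = (\<Sum>l\<in>UNIV. levi_civita j k l *\<^sub>R E l)" for j k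
    unfolding mcomm_form E_def by simp
  show "((\<lambda>t. form (f1 t) (f2 t) (of_real (g0 t)) (of_real (g1 t)) 1) has_vector_derivative
      mcomm (form (f1 t) (f2 t) (of_real (g0 t)) (of_real (g1 t)) 2)
        (form (f1 t) (f2 t) (of_real (g0 t)) (of_real (g1 t)) 3)) (at t)"
    "((\<lambda>t. form (f1 t) (f2 t) (of_real (g0 t)) (of_real (g1 t)) 2) has_vector_derivative
      mcomm (form (f1 t) (f2 t) (of_real (g0 t)) (of_real (g1 t)) 3)
        (form (f1 t) (f2 t) (of_real (g0 t)) (of_real (g1 t)) 1)) (at t)"
    "((\<lambda>t. form (f1 t) (f2 t) (of_real (g0 t)) (of_real (g1 t)) 3) has_vector_derivative
      mcomm (form (f1 t) (f2 t) (of_real (g0 t)) (of_real (g1 t)) 1)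
        (form (f1 t) (f2 t) (of_real (g0 t)) (of_real (g1 t)) 2)) (at t)"
    unfolding comm using D [of 1] D [of 2] D [of 3]
    by (simp_all only: sum_3 levi_civita_values scaleR_one scaleR_zero_left add_0 add_0_right)
qed

text \<open>Polar decomposition: H = \<open>cadj P ** P\<close> commutes with the generators, so it
  is block scalar with positive entries, and P times the inverse square root of H is a unitary
  intertwiner.\<close>

lemma unitary_intertwiner:
  fixes Y :: "3 \<Rightarrow> complex^(5 + 3 + 1)^(5 + 3 + 1)"
  assumes skew: "\<And>i. cadj (Y i) = - Y i" and P: "invertible P"
    and inter: "\<And>i. Y i ** P = P ** gen i"
  shows "\<exists>R. cadj R ** R = mat 1 \<and> R ** cadj R = mat 1 \<and> (\<forall>i. cadj R ** Y i ** R = gen i)"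
proof -
  define H where "H = cadj P ** P"
  have gskew: "cadj (gen i) = - gen i" for i
    by (simp add: gen_form cadj_form)
  have "gen j ** H = H ** gen j" for j
  proof -
    have "cadj P ** Y j = gen j ** cadj P"
      using arg_cong [OF inter [of j], of cadj] by (simp add: cadj_mult skew gskew matrix_ring_simps)
    then have "gen j ** H = (cadj P ** Y j) ** P"
      by (simp add: H_def matrix_mul_assoc)
    then show ?thesis
      by (simp add: H_def matrix_assoc_right inter)
  qed
  moreover have "cadj H = H"
    by (simp add: H_def cadj_mult)
  ultimately obtain a b' c where H: "H = block3 (mat a) 0 0 0 (mat b') 0 0 0 (mat c)"
    using commutes_gen_hermitian by blast
  have pos: "\<exists>r>0. H $ i $ i = of_real r" for i
    unfolding H_def by (rule gram_diagonal_pos [OF P])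
  obtain \<alpha> where \<alpha>: "\<alpha> > 0" "a = of_real \<alpha>"
    using pos [of "Inl 1"] by (auto simp: H mat_def)
  obtain \<beta> where \<beta>: "\<beta> > 0" "b' = of_real \<beta>"
    using pos [of "Inr (Inl 1)"] by (auto simp: H mat_def)
  obtain \<gamma> where \<gamma>: "\<gamma> > 0" "c = of_real \<gamma>"
    using pos [of "Inr (Inr 1)"] by (auto simp: H mat_def)
  define s where "s x = complex_of_real (1 / sqrt x)" for x
  have s: "s x * (of_real x * s x) = 1" "cnj (s x) = s x" if "x > 0" for x
  proof -
    have "s x * (of_real x * s x) = of_real (1 / sqrt x * (x * (1 / sqrt x)))"
      unfolding s_def of_real_mult ..
    also have "1 / sqrt x * (x * (1 / sqrt x)) = 1"
      using that by (simp add: field_simps)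
    finally show "s x * (of_real x * s x) = 1" by simp
  qed (simp add: s_def)
  \<comment> \<open>The inverse square root of H.\<close>
  define D :: "complex^(5 + 3 + 1)^(5 + 3 + 1)" where "D = block3 (mat (s \<alpha>)) 0 0 0 (mat (s \<beta>)) 0 0 0 (mat (s \<gamma>) :: complex^1^1)"
  define R where "R = P ** D"
  have D1: "cadj D = D"
    using \<alpha> \<beta> \<gamma> by (simp add: D_def cadj_block3 cadj_mat s)
  have D2: "D ** (H ** D) = mat 1"
    unfolding D_def H block3_mat [symmetric] block3_mult block3_eq_iff
    using \<alpha> \<beta> \<gamma> by (simp add: mat_mult_mat s)
  have D3: "gen i ** D = D ** gen i" for i
    unfolding D_def gen_def block3_mult block3_eq_iff
    by (simp add: mat_commute [of _ "Y5 i"] mat_commute [of _ "Y3 i"])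
  have RR: "cadj R ** R = mat 1"
    using D2 by (simp add: R_def cadj_mult D1 H_def matrix_assoc_right)
  have "cadj R ** Y i ** R = gen i" for i
  proof -
    have "Y i ** R = R ** gen i"
      unfolding R_def by (simp add: matrix_assoc_right D3 [symmetric]) (simp add: matrix_mul_assoc inter)
    then have "cadj R ** Y i ** R = (cadj R ** R) ** gen i"
      by (simp add: matrix_assoc_right)
    then show ?thesis by (simp add: RR)
  qed
  with RR show ?thesis
    using matrix_left_right_inverse by blast
qed

text \<open>Reads a coefficient off one matrix entry where the constant factor is nonzero. As
  \<open>c\<close> is controlled only on I, openness is needed for the derivative.\<close>

lemma entry_has_derivative:
  fixes T :: "real \<Rightarrow> complex^'n^'n"
  assumes T: "(T has_vector_derivative D) (at t)" and "open I" "t \<in> I" "y \<noteq> 0"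
    and c: "\<And>t. t \<in> I \<Longrightarrow> T t $ p $ q = c t * y" and d: "D $ p $ q = d * y"
  shows "(c has_vector_derivative d) (at t)"
proof -
  have "((\<lambda>t. T t $ p $ q / y) has_vector_derivative D $ p $ q / y) (at t)"
    by (rule bounded_linear.has_vector_derivative [OF bounded_linear_entry_divide T])
  then have "((\<lambda>t. T t $ p $ q / y) has_vector_derivative d) (at t)"
    using d \<open>y \<noteq> 0\<close> by simp
  then show ?thesis
    by (rule has_vector_derivative_transform_within_open [OF _ \<open>open I\<close> \<open>t \<in> I\<close>])
      (use c \<open>y \<noteq> 0\<close> in simp)
qed

lemma form_derivative_components:
  assumes "open I" "t \<in> I"
    and T: "\<And>i t. t \<in> I \<Longrightarrow> T i t = form (f1 t) (f2 t) (c0 t) (c1 t) i"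
    and D: "\<And>i. (T i has_vector_derivative form d1 d2 e0 e1 i) (at t)"
  shows "(f1 has_real_derivative d1) (at t)" "(f2 has_real_derivative d2) (at t)"
    "(c0 has_vector_derivative e0) (at t)" "(c1 has_vector_derivative e1) (at t)"
proof -
  have real: "(f has_real_derivative d) (at t)"
    if "((\<lambda>t. complex_of_real (f t)) has_vector_derivative of_real d) (at t)" for f d
    using bounded_linear.has_vector_derivative [OF bounded_linear_Re that]
    by (simp add: has_real_derivative_iff_has_vector_derivative)
  obtain k p q where "Y3 k $ p $ q \<noteq> 0"
    using Y3_nonzero by (auto simp: vec_eq_iff)
  then show "(f1 has_real_derivative d1) (at t)"
    by (intro real entry_has_derivative [where T = "T k" and p = "Inr (Inl p)" and q = "Inr (Inl q)"
        and y = "Y3 k $ p $ q", OF D assms(1,2)])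
      (simp_all add: T form_def scaleR_complex)
  obtain k p q where "Y5 k $ p $ q \<noteq> 0"
    using Y5_nonzero by (auto simp: vec_eq_iff)
  then show "(f2 has_real_derivative d2) (at t)"
    by (intro real entry_has_derivative [where T = "T k" and p = "Inl p" and q = "Inl q"
        and y = "Y5 k $ p $ q", OF D assms(1,2)])
      (simp_all add: T form_def scaleR_complex)
  obtain k p q where "b k $ p $ q \<noteq> 0"
    using b_nonzero by (auto simp: vec_eq_iff)
  then show "(c0 has_vector_derivative e0) (at t)"
    by (intro entry_has_derivative [where T = "T k" and p = "Inr (Inl p)" and q = "Inr (Inr q)"
        and y = "b k $ p $ q", OF D assms(1,2)])
      (simp_all add: T form_def mat_mult_entry)
  obtain k p q where "B k $ p $ q \<noteq> 0"
    using B_nonzero by (auto simp: vec_eq_iff)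
  then show "(c1 has_vector_derivative e1) (at t)"
    by (intro entry_has_derivative [where T = "T k" and p = "Inl p" and q = "Inr (Inl q)"
        and y = "B k $ p $ q", OF D assms(1,2)])
      (simp_all add: T form_def mat_mult_entry)
qed

end

lemma reduced_solution_real_analytic:
  assumes "open I" and sol: "reduced_solution f1 f2 g0 g1 I"
  shows "real_analytic_on f1 I" "real_analytic_on f2 I" "real_analytic_on g0 I" "real_analytic_on g1 I"
proof -
  define x where "x i = (if i = (1::4) then f1 else if i = 2 then f2 else if i = 3 then g0 else g1)" for i
  \<comment> \<open>The structure constants of the reduced system in the order f_1, f_2, g_0,
    g_1.\<close>
  define c :: "4 \<Rightarrow> 4 \<Rightarrow> 4 \<Rightarrow> real" where
    "c i j k = (if i = 1 then (if j = 1 \<and> k = 1 \<or> j = 3 \<and> k = 3 then 1 else if j = 4 \<and> k = 4 then - (5/6) else 0)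
       else if i = 2 then (if j = 2 \<and> k = 2 then 1 else if j = 4 \<and> k = 4 then 1/2 else 0)
       else if i = 3 then (if j = 1 \<and> k = 3 then 2 else 0)
       else (if j = 2 \<and> k = 4 then 3 else if j = 1 \<and> k = 4 then - 1 else 0))" for i j k
  have "(x i has_real_derivative (\<Sum>j\<in>UNIV. \<Sum>k\<in>UNIV. c i j k * (x j t * x k t))) (at t)"
    if "t \<in> I" for i t
    using exhaust_4 [of i] sol that unfolding reduced_solution_def
    by (auto simp: x_def c_def sum_4 power2_eq_square algebra_simps)
  then have "real_analytic_on (x i) I" for i
    by (rule quadratic_ode_real_analytic [OF \<open>open I\<close>])
  from this [of 1] this [of 2] this [of 3] this [of 4]
  show "real_analytic_on f1 I" "real_analytic_on f2 I" "real_analytic_on g0 I" "real_analytic_on g1 I"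
    by (simp_all add: x_def)
qed

context so3_blocks begin

text \<open>The phase on V_3 is normalised to 1, which fixes the phases on V_5 and V_1 that cancel
  those of the two off-diagonal coefficients.\<close>

lemma block_diagonal_conj_form:
  assumes "cmod u0 = 1" "cmod u1 = 1"
  defines "V \<equiv> block3 (mat (cnj u1) :: complex^5^5) 0 0 0 (mat 1 :: complex^3^3) 0 0 0 (mat u0 :: complex^1^1)"
  shows "V ** cadj V = mat 1"
    and "V ** form f1 f2 (of_real g0 * u0) (of_real g1 * u1) i ** cadj V = form f1 f2 (of_real g0) (of_real g1) i"
proof -
  have u: "u0 * cnj u0 = 1" "cnj u0 * u0 = 1" "u1 * cnj u1 = 1" "cnj u1 * u1 = 1"
    using assms(1,2) by (simp_all add: complex_norm_square [symmetric] mult.commute [of "cnj _"])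
  show "V ** cadj V = mat 1"
    unfolding V_def block3_mat [symmetric] block3_simps block3_eq_iff
    by (simp add: cadj_mat mat_mult_mat u)
  have conj: "mat v ** (M :: complex^'n^'m) ** mat w = mat (v * w) ** M" for v w M
    by (simp add: vec_eq_iff mult_mat_entry mat_mult_entry)
  show "V ** form f1 f2 (of_real g0 * u0) (of_real g1 * u1) i ** cadj V = form f1 f2 (of_real g0) (of_real g1) i"
    unfolding V_def form_def block3_simps block3_eq_iff
    by (auto simp: vec_eq_iff cadj_mat mult_mat_entry mat_mult_entry scaleR_complex u mult_ac)
qed

theorem nahm_reduction:
  assumes I: "open I" "is_interval I" and nahm: "nahm_solution T I"
    and Y: "\<And>i. cadj (Y i) = - Y i"
    and sym: "\<And>i j t. t \<in> I \<Longrightarrow> mcomm (Y i) (T j t) = (\<Sum>k\<in>UNIV. levi_civita i j k *\<^sub>R T k t)"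
    and P: "invertible P" and inter: "\<And>i. Y i ** P = P ** gen i"
  shows "\<exists>U\<in>SU. \<exists>f1 f2 g0 g1. reduced_solution f1 f2 g0 g1 I \<and>
    (\<forall>i. \<forall>t\<in>I. gauge_act U (T i t) = form (f1 t) (f2 t) (of_real (g0 t)) (of_real (g1 t)) i)"
proof -
  obtain R where R: "cadj R ** R = mat 1" "R ** cadj R = mat 1"
    and gen: "\<And>i. cadj R ** Y i ** R = gen i"
    using unitary_intertwiner [OF Y P inter] by blast
  define T1 where "T1 i t = cadj R ** T i t ** R" for i t
  have form_ex: "\<exists>f1 f2 c0 c1. \<forall>i. T1 i t = form f1 f2 c0 c1 i" if t: "t \<in> I" for t
  proof (rule tensor_operator_gen_form)
    show "tensor_operator gen gen (\<lambda>i. T1 i t)"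
      unfolding tensor_operator_def
    proof (intro allI)
      fix j k
      have eps: "levi_civita j k i = levi_civita i j k" for i
        by (metis levi_civita_swap(1,2) minus_minus)
      have "gen j ** T1 k t - T1 k t ** gen j = mcomm (gen j) (T1 k t)"
        by (simp add: mcomm_def)
      also have "\<dots> = cadj R ** mcomm (Y j) (T k t) ** R"
        unfolding mcomm_conj_unitary [OF R(2)] gen T1_def ..
      also have "\<dots> = (\<Sum>i\<in>UNIV. levi_civita i j k *\<^sub>R T1 i t)"
        by (simp add: sym [OF t] T1_def matrix_sum_left matrix_sum_right matrix_scaleR_left
            matrix_scaleR_right eps)
      finally show "gen j ** T1 k t - T1 k t ** gen j = (\<Sum>i\<in>UNIV. levi_civita i j k *\<^sub>R T1 i t)" .
    qed
    fix i
    have "cadj (T i t) = - T i t"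
      using nahm t by (simp add: nahm_solution_def su_def)
    then show "cadj (T1 i t) = - T1 i t"
      by (simp add: T1_def cadj_mult matrix_ring_simps)
  qed
  then have "\<forall>t. \<exists>f1 f2 c0 c1. t \<in> I \<longrightarrow> (\<forall>i. T1 i t = form f1 f2 c0 c1 i)"
    by blast
  then obtain f1 f2 c0 c1 where form: "\<And>i t. t \<in> I \<Longrightarrow> T1 i t = form (f1 t) (f2 t) (c0 t) (c1 t) i"
    by metis
  define d1 where "d1 t = (f1 t)\<^sup>2 + (cmod (c0 t))\<^sup>2 - 5/6 * (cmod (c1 t))\<^sup>2" for t
  define d2 where "d2 t = (f2 t)\<^sup>2 + 1/2 * (cmod (c1 t))\<^sup>2" for t
  define e0 where "e0 t = of_real (2 * f1 t) * c0 t" for t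
  define e1 where "e1 t = of_real (3 * f2 t - f1 t) * c1 t" for t
  have deriv: "(T1 i has_vector_derivative form (d1 t) (d2 t) (e0 t) (e1 t) i) (at t)"
    if t: "t \<in> I" for i t
  proof -
    have comm: "cadj R ** mcomm (T j t) (T k t) ** R
        = (\<Sum>l\<in>UNIV. levi_civita j k l *\<^sub>R form (d1 t) (d2 t) (e0 t) (e1 t) l)" for j k
      unfolding mcomm_conj_unitary [OF R(2)] T1_def [symmetric] form [OF t] mcomm_form
        d1_def d2_def e0_def e1_def ..
    have D: "(T1 i has_vector_derivative cadj R ** M ** R) (at t)"
      if "(T i has_vector_derivative M) (at t)" for i M
      unfolding T1_def using bounded_linear.has_vector_derivative [OF bounded_linear_conjugation that] .
    have "(T 1 has_vector_derivative mcomm (T 2 t) (T 3 t)) (at t)"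
      "(T 2 has_vector_derivative mcomm (T 3 t) (T 1 t)) (at t)"
      "(T 3 has_vector_derivative mcomm (T 1 t) (T 2 t)) (at t)"
      using nahm t by (auto simp: nahm_solution_def)
    from this [THEN D] show ?thesis
      unfolding comm using exhaust_3 [of i] by (auto simp: sum_3)
  qed
  note comps = form_derivative_components [of I _ T1, OF I(1) _ form deriv]
  have cont: "continuous_on I f1" "continuous_on I f2"
    using comps(1,2) by (auto intro!: continuous_at_imp_continuous_on DERIV_isCont)
  have "\<exists>u. cmod u = 1 \<and> (\<forall>t\<in>I. \<exists>r. c0 t = of_real r * u)"
    using comps(3) by (intro linear_ode_constant_phase [OF I(2), of "\<lambda>t. 2 * f1 t"])
      (auto simp: e0_def intro!: continuous_intros cont)
  then obtain u0 g0 where u0: "cmod u0 = 1" and c0: "\<And>t. t \<in> I \<Longrightarrow> c0 t = of_real (g0 t) * u0"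
    by metis
  have "\<exists>u. cmod u = 1 \<and> (\<forall>t\<in>I. \<exists>r. c1 t = of_real r * u)"
    using comps(4) by (intro linear_ode_constant_phase [OF I(2), of "\<lambda>t. 3 * f2 t - f1 t"])
      (auto simp: e1_def intro!: continuous_intros cont)
  then obtain u1 g1 where u1: "cmod u1 = 1" and c1: "\<And>t. t \<in> I \<Longrightarrow> c1 t = of_real (g1 t) * u1"
    by metis
  define V :: "complex^(5 + 3 + 1)^(5 + 3 + 1)" where "V = block3 (mat (cnj u1) :: complex^5^5) 0 0 0 (mat 1 :: complex^3^3) 0 0 0 (mat u0 :: complex^1^1)"
  note V = block_diagonal_conj_form [OF u0 u1, folded V_def]
  have "(V ** cadj R) ** cadj (V ** cadj R) = V ** (cadj R ** R) ** cadj V"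
    by (simp add: cadj_mult matrix_assoc_right)
  then have "(V ** cadj R) ** cadj (V ** cadj R) = mat 1"
    by (simp add: R(1) V(1))
  \<comment> \<open>The gauge transformation is unitary; a scalar phase moves it into
    \<open>SU\<close> without affecting the conjugation.\<close>
  then obtain w where w: "cmod w = 1" and SU: "mat w ** (V ** cadj R) \<in> SU"
    using unitary_scaled_to_SU by blast
  define U where "U = mat w ** (V ** cadj R)"
  have U: "U ** cadj U = mat 1"
    using SU by (simp add: SU_def U_def)
  have gauge: "gauge_act U (T i t) = form (f1 t) (f2 t) (of_real (g0 t)) (of_real (g1 t)) i"
    if t: "t \<in> I" for i t
  proof -
    have "gauge_act U (T i t) = mat w ** (V ** T1 i t ** cadj V) ** mat (cnj w)"
      by (simp add: gauge_act_def unitary_matrix_inv [OF U])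
        (simp add: U_def T1_def cadj_mult cadj_mat matrix_assoc_right)
    also have "\<dots> = mat (w * cnj w) ** (V ** T1 i t ** cadj V)"
      by (simp add: vec_eq_iff mult_mat_entry mat_mult_entry)
    also have "w * cnj w = 1"
      using w by (simp add: complex_norm_square [symmetric])
    finally show ?thesis
      by (simp add: form [OF t] c0 [OF t] c1 [OF t] V(2))
  qed
  \<comment> \<open>The real factor was only chosen pointwise; its differentiability follows from g
    = Re (c \<open>cnj u\<close>) on the open set I.\<close>
  have real_part: "(g has_real_derivative e) (at t)"
    if t: "t \<in> I" and u: "cmod u = 1" and c: "\<And>t. t \<in> I \<Longrightarrow> c t = of_real (g t) * u"
      and d: "(c has_vector_derivative of_real e * u) (at t)" for g c u e t
  proof -
    have u': "u * cnj u = 1"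
      using u by (simp add: complex_norm_square [symmetric])
    have "((\<lambda>t. Re (c t * cnj u)) has_vector_derivative Re (of_real e * u * cnj u)) (at t)"
      by (intro bounded_linear.has_vector_derivative [OF bounded_linear_Re]
          bounded_linear.has_vector_derivative [OF bounded_linear_mult_left] d)
    then have "((\<lambda>t. Re (c t * cnj u)) has_vector_derivative e) (at t)"
      by (simp only: mult.assoc u' mult_1_right Re_complex_of_real)
    then have "(g has_vector_derivative e) (at t)"
      by (rule has_vector_derivative_transform_within_open [OF _ I(1) t])
        (simp only: c mult.assoc u' mult_1_right Re_complex_of_real)
    then show ?thesis
      by (simp add: has_real_derivative_iff_has_vector_derivative)
  qed
  have "reduced_solution f1 f2 g0 g1 I"
    unfolding reduced_solution_def
  proof (intro ballI conjI)
    fix t assume t: "t \<in> I"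
    have n: "(cmod (c0 t))\<^sup>2 = (g0 t)\<^sup>2" "(cmod (c1 t))\<^sup>2 = (g1 t)\<^sup>2"
      using u0 u1 by (simp_all add: c0 [OF t] c1 [OF t] norm_mult)
    show "(f1 has_real_derivative (f1 t)\<^sup>2 + (g0 t)\<^sup>2 - 5/6 * (g1 t)\<^sup>2) (at t)"
      "(f2 has_real_derivative (f2 t)\<^sup>2 + 1/2 * (g1 t)\<^sup>2) (at t)"
      using comps(1,2) [OF t] t by (simp_all add: d1_def d2_def n)
    show "(g0 has_real_derivative 2 * f1 t * g0 t) (at t)"
      by (rule real_part [OF t u0 c0]) (use comps(3) [OF t] t in \<open>simp_all add: e0_def c0 [OF t] mult_ac\<close>)
    show "(g1 has_real_derivative (3 * f2 t - f1 t) * g1 t) (at t)"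
      by (rule real_part [OF t u1 c1]) (use comps(4) [OF t] t in \<open>simp_all add: e1_def c1 [OF t] mult_ac\<close>)
  qed
  with SU gauge show ?thesis
    unfolding U_def by blast
qed

end

section \<open>The explicit solution at its poles\<close>

context so3_blocks begin

definition explicit :: "3 \<Rightarrow> real \<Rightarrow> complex^(5 + 3 + 1)^(5 + 3 + 1)" where
  "explicit i t = form (- (t / (t\<^sup>2 - 1))) (- (t / (t\<^sup>2 - 1)))
     (of_real (sqrt 8 / (sqrt 3 * (t\<^sup>2 - 1)))) (of_real (sqrt 2 / (t\<^sup>2 - 1))) i"

text \<open>The constant part of the solution: \<open>explicit i t\<close> is
  (\<open>off_diagonal i\<close> - t \<open>gen i\<close>) / (t^2 - 1).\<close>

definition off_diagonal :: "3 \<Rightarrow> complex^(5 + 3 + 1)^(5 + 3 + 1)" where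
  "off_diagonal i = form 0 0 (of_real (sqrt 8 / sqrt 3)) (of_real (sqrt 2)) i"

lemma form_gen_off_diagonal:
  "form f f (of_real (g * (sqrt 8 / sqrt 3))) (of_real (g * sqrt 2)) i = f *\<^sub>R gen i + g *\<^sub>R off_diagonal i"
  using form_expansion [of f f "g * (sqrt 8 / sqrt 3)" "g * sqrt 2" i] form_expansion [of 1 1 0 0 i]
    form_expansion [of 0 0 "sqrt 8 / sqrt 3" "sqrt 2" i]
  by (simp add: gen_form off_diagonal_def scaleR_add_right)

lemma explicit_expansion: "explicit i t = - (t / (t\<^sup>2 - 1)) *\<^sub>R gen i + (1 / (t\<^sup>2 - 1)) *\<^sub>R off_diagonal i"
  using form_gen_off_diagonal [of "- (t / (t\<^sup>2 - 1))" "1 / (t\<^sup>2 - 1)" i]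
  by (simp add: explicit_def mult.commute)

lemma explicit_irreducible: "irreducible_datum explicit {-1<..<1}"
  unfolding irreducible_datum_def irreducible_family_def
proof (intro allI impI, elim conjE)
  fix W assume W: "vec.subspace W"
    and inv: "\<forall>M\<in>{explicit i t |i t. t \<in> {-1<..<1}}. \<forall>w\<in>W. M *v w \<in> W"
  have T: "explicit i t *v w \<in> W" if "t \<in> {-1<..<1}" "w \<in> W" for i t w
    using inv that by blast
  have scaleR_mult: "(r *\<^sub>R M) *v w = of_real r *s (M *v w)" for r and M :: "complex^(5 + 3 + 1)^(5 + 3 + 1)" and w
    by (simp add: vec_eq_iff matrix_vector_mult_def sum_distrib_left scaleR_complex mult.assoc)
  have off: "off_diagonal i *v w \<in> W" if "w \<in> W" for i w
  proof -
    \<comment> \<open>The times 0 and 1/2 suffice to recover both constant matrices from values of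
      the solution; at t = 0 the \<open>gen\<close> term is absent.\<close>
    have "off_diagonal i = (- 1) *\<^sub>R explicit i 0"
      by (simp add: explicit_expansion)
    then have "off_diagonal i *v w = of_real (- 1) *s (explicit i 0 *v w)"
      by (simp only: scaleR_mult)
    then show ?thesis
      using T [of 0 w i] that W vec.subspace_neg by simp
  qed
  have gen: "gen i *v w \<in> W" if "w \<in> W" for i w
  proof -
    have "gen i = (3/2) *\<^sub>R explicit i (1/2) + 2 *\<^sub>R off_diagonal i"
      by (simp add: explicit_expansion power2_eq_square scaleR_diff_right)
    then have "gen i *v w = of_real (3/2) *s (explicit i (1/2) *v w) + of_real 2 *s (off_diagonal i *v w)"
      by (simp only: scaleR_mult matrix_vector_mult_add_rdistrib)
    then show ?thesis
      using that by (auto intro!: vec.subspace_add [OF W] vec.subspace_scale [OF W] T off)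
  qed
  show "W = {0} \<or> W = UNIV"
    by (rule irreducible_gen_form [OF W gen off [unfolded off_diagonal_def]]) auto
qed

text \<open>The negative residues are again of the shape \<open>form\<close>, and
  \<open>pole_map\<close> conjugates them to three copies of \<open>Y3\<close>.\<close>

lemma explicit_pole:
  assumes s: "s = 1 \<or> s = - 1"
  shows "\<exists>\<sigma> P. induced_rep_at_pole explicit {-1<..<1} s \<sigma> \<and> P ** cadj P = mat 2 \<and> cadj P ** P = mat 2 \<and>
    (\<forall>i. \<sigma> (so3_basis i) ** P = P ** block3 (Y3 i) 0 0 0 (Y3 i) 0 0 0 (Y3 i))"
proof -
  \<comment> \<open>The residue is (off_diagonal - s gen) / (2 s) with 1/s = s, so its negative has
    off-diagonal coefficients z and x/2; the pole enters only through their signs.\<close>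
  define x where "x = - s * sqrt 2"
  define z where "z = - s / 2 * (sqrt 8 / sqrt 3)"
  have xz: "x\<^sup>2 = 2" "z\<^sup>2 = 2/3"
    using s by (auto simp: x_def z_def power_mult_distrib power_divide)
  define a where "a i = form (1/2) (1/2) (of_real z) (of_real (x/2)) i" for i
  have a: "a i = (1/2) *\<^sub>R gen i + (- s / 2) *\<^sub>R off_diagonal i" for i
    using form_gen_off_diagonal [of "1/2" "- s / 2" i] by (simp add: a_def x_def z_def)
  have n: "(cmod (of_real z))\<^sup>2 = 2/3" "(cmod (of_real (x/2)))\<^sup>2 = 1/2"
    unfolding norm_of_real power2_abs power_divide xz by simp_all
  \<comment> \<open>The coefficients are a fixed point of the map in \<open>mcomm_form\<close>: 1/4
    + 2/3 - 5/12 = 1/2 and 1/4 + 1/4 = 1/2, while both off-diagonal factors equal 1.\<close>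
  have "mcomm (a i) (a j) = (\<Sum>k\<in>UNIV. levi_civita i j k *\<^sub>R a k)" for i j
    unfolding a_def mcomm_form n by (simp add: power2_eq_square)
  note rep = so3_rep_of_triple [OF this]
  define \<sigma> where "\<sigma> A = (\<Sum>i\<in>UNIV. so3_coord i A *\<^sub>R a i)" for A
  have "simple_residue (\<lambda>t. explicit i t $ p $ q) {-1<..<1} s ((- a i) $ p $ q)" for i p q
  proof (rule simple_residue_end_point [OF s, where x = "- (gen i $ p $ q)" and y = "off_diagonal i $ p $ q"])
    fix t :: real
    have "explicit i t $ p $ q = of_real (- (t / (t\<^sup>2 - 1))) * gen i $ p $ q
        + of_real (1 / (t\<^sup>2 - 1)) * off_diagonal i $ p $ q"
      by (simp add: explicit_expansion scaleR_complex)
    then show "explicit i t $ p $ q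
        = (of_real t * - (gen i $ p $ q) + off_diagonal i $ p $ q) / (of_real t ^ 2 - 1)"
      by (simp add: add_divide_distrib diff_divide_distrib)
  next
    show "(- a i) $ p $ q = (of_real s * - (gen i $ p $ q) + off_diagonal i $ p $ q) / (2 * of_real s)"
      using s by (auto simp: a scaleR_complex field_simps)
  qed
  moreover have "\<exists>i. - a i \<noteq> 0"
  proof -
    obtain i where "Y3 i \<noteq> 0"
      using Y3_nonzero by blast
    then have "a i \<noteq> 0"
      unfolding a_def form_def block3_0 [symmetric] block3_eq_iff by simp
    then show ?thesis by auto
  qed
  ultimately have "simple_pole_residues explicit {-1<..<1} s (\<lambda>i. - a i)"
    unfolding simple_pole_residues_def by blast
  then have "induced_rep_at_pole explicit {-1<..<1} s \<sigma>"
    unfolding induced_rep_at_pole_def \<sigma>_def using rep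
    by (intro conjI exI [of _ "\<lambda>i. - a i"]) simp_all
  moreover have "\<sigma> (so3_basis i) ** pole_map x z = pole_map x z ** block3 (Y3 i) 0 0 0 (Y3 i) 0 0 0 (Y3 i)" for i
    using rep(2) [of i] pole_map_intertwines [OF xz, of i] by (simp add: \<sigma>_def a_def)
  ultimately show ?thesis
    using pole_map_unitary [OF xz] by blast
qed

end

section \<open>Passage between representations and generators\<close>

lemma rep_isomorphic_so3I:
  assumes "so3_rep \<sigma>" "so3_rep \<tau>" "invertible P"
    and "\<And>i. \<sigma> (so3_basis i) ** P = P ** \<tau> (so3_basis i)"
  shows "rep_isomorphic \<sigma> \<tau>"
proof -
  have "\<sigma> A ** P = P ** \<tau> A" if "A \<in> so3" for A
    unfolding so3_rep_expansion [OF assms(1) that] so3_rep_expansion [OF assms(2) that]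
    by (simp add: matrix_sum_left matrix_sum_right matrix_scaleR_left matrix_scaleR_right assms(4))
  then show ?thesis
    unfolding rep_isomorphic_def using assms(3) by blast
qed

lemma so3_rep_sum3:
  assumes "so3_rep \<rho>" "so3_rep \<sigma>" "so3_rep \<tau>"
  shows "so3_rep (rep_sum3 \<rho> \<sigma> \<tau>)"
  using assms unfolding so3_rep_def rep_sum3_def mcomm_def
  by (simp add: block3_simps block3_eq_iff)

lemma so3_blocks_of_representations:
  assumes "irreducible_unitary_so3_rep \<rho>5" "irreducible_unitary_so3_rep \<rho>3" "so3_rep \<rho>1"
    "B_triple \<rho>3 \<rho>5 B3" "B_triple \<rho>1 \<rho>3 B1"
  shows "so3_blocks (\<lambda>i. \<rho>5 (so3_basis i)) (\<lambda>i. \<rho>3 (so3_basis i)) B3 B1"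
proof
  show "tensor_operator (\<lambda>i. \<rho>3 (so3_basis i)) (\<lambda>_. 0) B1"
    using assms(5) so3_rep_dim_one [OF assms(3)] by (simp add: tensor_operator_def B_triple_def)
qed (use assms in \<open>simp_all add: irreducible_unitary_so3_rep_def irreducible_range_generators
  so3_rep_mcomm so3_basis_in_so3 tensor_operator_def B_triple_def\<close>)

theorem theorem4p13:
  fixes \<rho>5 :: "real^3^3 \<Rightarrow> complex^5^5"
    and \<rho>3 :: "real^3^3 \<Rightarrow> complex^3^3"
    and \<rho>1 :: "real^3^3 \<Rightarrow> complex^1^1"
    and B3 :: "3 \<Rightarrow> complex^3^5"
    and B1 :: "3 \<Rightarrow> complex^1^3"
    and f1' f2' g0' g1' :: "real \<Rightarrow> real"
  assumes irr5: "irreducible_unitary_so3_rep \<rho>5"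
    and irr3: "irreducible_unitary_so3_rep \<rho>3"
    and irr1: "irreducible_unitary_so3_rep \<rho>1"
    and B3: "B_triple \<rho>3 \<rho>5 B3"
    and B1: "B_triple \<rho>1 \<rho>3 B1"
    and f1': "f1' = (\<lambda>t. - (t / (t\<^sup>2 - 1)))"
    and f2': "f2' = (\<lambda>t. - (t / (t\<^sup>2 - 1)))"
    and g0': "g0' = (\<lambda>t. sqrt 8 / (sqrt 3 * (t\<^sup>2 - 1)))"
    and g1': "g1' = (\<lambda>t. sqrt 2 / (t\<^sup>2 - 1))"
  shows
    "(\<forall>(I :: real set) (T :: 3 \<Rightarrow> real \<Rightarrow> complex^(5 + 3 + 1)^(5 + 3 + 1))
        (Y :: 3 \<Rightarrow> complex^(5 + 3 + 1)^(5 + 3 + 1))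
        (\<rho> :: real^3^3 \<Rightarrow> complex^(5 + 3 + 1)^(5 + 3 + 1)).
        open I \<and> is_interval I \<and> I \<noteq> {} \<and>
        nahm_solution T I \<and> spherically_symmetric T I \<and>
        symmetry_generators Y T I \<and> generators_induce Y \<rho> \<and>
        rep_isomorphic \<rho> (rep_sum3 \<rho>5 \<rho>3 \<rho>1) \<longrightarrow>
        (\<exists>U\<in>SU. \<exists>f1 f2 g0 g1 :: real \<Rightarrow> real.
           real_analytic_on f1 I \<and> real_analytic_on f2 I \<and>
           real_analytic_on g0 I \<and> real_analytic_on g1 I \<and>
           (\<forall>i. \<forall>t\<in>I. gauge_act U (T i t) = ansatz \<rho>5 \<rho>3 B3 B1 f1 f2 g0 g1 i t) \<and>
           reduced_solution f1 f2 g0 g1 I))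
     \<and> maximally_extended_reduced_solution f1' f2' g0' g1' {-1<..<1}
     \<and> nahm_solution (ansatz \<rho>5 \<rho>3 B3 B1 f1' f2' g0' g1') {-1<..<1}
     \<and> irreducible_datum (ansatz \<rho>5 \<rho>3 B3 B1 f1' f2' g0' g1') {-1<..<1}
     \<and> (\<forall>s\<in>{1, -1 :: real}.
          simple_residue (\<lambda>t. of_real (f1' t)) {-1<..<1} s (- (1/2))
        \<and> simple_residue (\<lambda>t. of_real (f2' t)) {-1<..<1} s (- (1/2))
        \<and> simple_residue (\<lambda>t. of_real (g0' t)) {-1<..<1} s (of_real (s * sqrt (2/3)))
        \<and> simple_residue (\<lambda>t. of_real (g1' t)) {-1<..<1} s (of_real (s * (1 / sqrt 2))))
     \<and> (\<forall>s\<in>{1, -1 :: real}. \<exists>\<sigma>.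
          induced_rep_at_pole (ansatz \<rho>5 \<rho>3 B3 B1 f1' f2' g0' g1') {-1<..<1} s \<sigma>
        \<and> rep_isomorphic \<sigma> (rep_sum3 \<rho>3 \<rho>3 \<rho>3))"
proof -
  have reps: "so3_rep \<rho>5" "so3_rep \<rho>3" "so3_rep \<rho>1"
    using irr5 irr3 irr1 by (simp_all add: irreducible_unitary_so3_rep_def)
  interpret so3_blocks "\<lambda>i. \<rho>5 (so3_basis i)" "\<lambda>i. \<rho>3 (so3_basis i)" B3 B1
    by (rule so3_blocks_of_representations [OF irr5 irr3 reps(3) B3 B1])
  have ansatz: "ansatz \<rho>5 \<rho>3 B3 B1 f1 f2 g0 g1 i t = form (f1 t) (f2 t) (of_real (g0 t)) (of_real (g1 t)) i"
    for f1 f2 g0 g1 i t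
    by (simp add: ansatz_def form_def block3_eq_iff mat_of_real_mult)
  have explicit: "ansatz \<rho>5 \<rho>3 B3 B1 f1' f2' g0' g1' = explicit"
    by (simp add: fun_eq_iff ansatz explicit_def f1' f2' g0' g1')
  have gen: "rep_sum3 \<rho>5 \<rho>3 \<rho>1 (so3_basis i) = gen i" for i
    by (simp add: rep_sum3_def gen_def so3_rep_dim_one [OF reps(3)])
  show ?thesis
  proof (intro conjI)
    show "\<forall>(I :: real set) (T :: 3 \<Rightarrow> real \<Rightarrow> complex^(5 + 3 + 1)^(5 + 3 + 1))
        (Y :: 3 \<Rightarrow> complex^(5 + 3 + 1)^(5 + 3 + 1))
        (\<rho> :: real^3^3 \<Rightarrow> complex^(5 + 3 + 1)^(5 + 3 + 1)).
        open I \<and> is_interval I \<and> I \<noteq> {} \<and>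
        nahm_solution T I \<and> spherically_symmetric T I \<and>
        symmetry_generators Y T I \<and> generators_induce Y \<rho> \<and>
        rep_isomorphic \<rho> (rep_sum3 \<rho>5 \<rho>3 \<rho>1) \<longrightarrow>
        (\<exists>U\<in>SU. \<exists>f1 f2 g0 g1 :: real \<Rightarrow> real.
           real_analytic_on f1 I \<and> real_analytic_on f2 I \<and>
           real_analytic_on g0 I \<and> real_analytic_on g1 I \<and>
           (\<forall>i. \<forall>t\<in>I. gauge_act U (T i t) = ansatz \<rho>5 \<rho>3 B3 B1 f1 f2 g0 g1 i t) \<and>
           reduced_solution f1 f2 g0 g1 I)"
    proof (intro allI impI, elim conjE)
      fix I :: "real set" and T :: "3 \<Rightarrow> real \<Rightarrow> complex^(5 + 3 + 1)^(5 + 3 + 1)"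
        and Y :: "3 \<Rightarrow> complex^(5 + 3 + 1)^(5 + 3 + 1)"
        and \<rho> :: "real^3^3 \<Rightarrow> complex^(5 + 3 + 1)^(5 + 3 + 1)"
      assume I: "open I" "is_interval I" and nahm: "nahm_solution T I"
        and sym: "symmetry_generators Y T I" and ind: "generators_induce Y \<rho>"
        and iso: "rep_isomorphic \<rho> (rep_sum3 \<rho>5 \<rho>3 \<rho>1)"
      obtain P where P: "invertible P" "\<And>A. A \<in> so3 \<Longrightarrow> \<rho> A ** P = P ** rep_sum3 \<rho>5 \<rho>3 \<rho>1 A"
        using iso unfolding rep_isomorphic_def by blast
      have inter: "Y i ** P = P ** gen i" for i
        using P(2) [OF so3_basis_in_so3, of i] ind by (simp add: gen generators_induce_def)
      have skew: "cadj (Y i) = - Y i" for i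
        using sym by (simp add: symmetry_generators_def su_def)
      have tens: "mcomm (Y i) (T j t) = (\<Sum>k\<in>UNIV. levi_civita i j k *\<^sub>R T k t)" if "t \<in> I" for i j t
        using sym that by (simp add: symmetry_generators_def)
      obtain U f1 f2 g0 g1 where "U \<in> SU" and sol: "reduced_solution f1 f2 g0 g1 I"
        and "\<forall>i. \<forall>t\<in>I. gauge_act U (T i t) = form (f1 t) (f2 t) (of_real (g0 t)) (of_real (g1 t)) i"
        using nahm_reduction [OF I nahm skew tens P(1) inter] by blast
      then show "\<exists>U\<in>SU. \<exists>f1 f2 g0 g1 :: real \<Rightarrow> real.
           real_analytic_on f1 I \<and> real_analytic_on f2 I \<and>
           real_analytic_on g0 I \<and> real_analytic_on g1 I \<and>
           (\<forall>i. \<forall>t\<in>I. gauge_act U (T i t) = ansatz \<rho>5 \<rho>3 B3 B1 f1 f2 g0 g1 i t) \<and>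
           reduced_solution f1 f2 g0 g1 I"
        unfolding ansatz using reduced_solution_real_analytic [OF I(1) sol] by blast
    qed
    show "maximally_extended_reduced_solution f1' f2' g0' g1' {-1<..<1}"
      unfolding f1' f2' g0' g1' by (rule explicit_maximally_extended)
    show "nahm_solution (ansatz \<rho>5 \<rho>3 B3 B1 f1' f2' g0' g1') {-1<..<1}"
      unfolding explicit using reduced_imp_nahm [OF explicit_reduced_solution]
      by (simp add: explicit_def [abs_def])
    show "irreducible_datum (ansatz \<rho>5 \<rho>3 B3 B1 f1' f2' g0' g1') {-1<..<1}"
      unfolding explicit by (rule explicit_irreducible)
    show "\<forall>s\<in>{1, -1 :: real}.
          simple_residue (\<lambda>t. of_real (f1' t)) {-1<..<1} s (- (1/2))
        \<and> simple_residue (\<lambda>t. of_real (f2' t)) {-1<..<1} s (- (1/2))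
        \<and> simple_residue (\<lambda>t. of_real (g0' t)) {-1<..<1} s (of_real (s * sqrt (2/3)))
        \<and> simple_residue (\<lambda>t. of_real (g1' t)) {-1<..<1} s (of_real (s * (1 / sqrt 2)))"
    proof
      fix s :: real assume "s \<in> {1, -1}"
      then have s: "s = 1 \<or> s = - 1" by simp
      have f: "simple_residue (\<lambda>t. of_real (- (t / (t\<^sup>2 - 1)))) {-1<..<1} s (- (1/2))"
        by (rule simple_residue_end_point [OF s, where x = "- 1" and y = 0]) (use s in auto)
      have g: "simple_residue (\<lambda>t. of_real (c / (t\<^sup>2 - 1))) {-1<..<1} s (of_real (s * (c / 2)))" for c
        by (rule simple_residue_end_point [OF s, where x = 0 and y = "of_real c"]) (use s in auto)
      have "sqrt 2 * sqrt 2 = (2 :: real)"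
        by simp
      then have c1: "sqrt 2 / 2 = 1 / sqrt 2"
        by (simp add: field_simps)
      have "sqrt 8 = 2 * sqrt 2"
        using real_sqrt_mult [of 4 2] by simp
      then have c0: "sqrt 8 / sqrt 3 / 2 = sqrt (2/3)"
        by (simp add: real_sqrt_divide)
      show "simple_residue (\<lambda>t. of_real (f1' t)) {-1<..<1} s (- (1/2))
        \<and> simple_residue (\<lambda>t. of_real (f2' t)) {-1<..<1} s (- (1/2))
        \<and> simple_residue (\<lambda>t. of_real (g0' t)) {-1<..<1} s (of_real (s * sqrt (2/3)))
        \<and> simple_residue (\<lambda>t. of_real (g1' t)) {-1<..<1} s (of_real (s * (1 / sqrt 2)))"
        unfolding f1' f2' g0' g1' c0 [symmetric] c1 [symmetric]
        using f g [of "sqrt 8 / sqrt 3"] g [of "sqrt 2"] by simp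
    qed
    show "\<forall>s\<in>{1, -1 :: real}. \<exists>\<sigma>.
          induced_rep_at_pole (ansatz \<rho>5 \<rho>3 B3 B1 f1' f2' g0' g1') {-1<..<1} s \<sigma>
        \<and> rep_isomorphic \<sigma> (rep_sum3 \<rho>3 \<rho>3 \<rho>3)"
    proof
      fix s :: real assume "s \<in> {1, -1}"
      then have "s = 1 \<or> s = - 1" by simp
      from explicit_pole [OF this] obtain \<sigma> P
        where \<sigma>: "induced_rep_at_pole explicit {-1<..<1} s \<sigma>"
          and P: "P ** cadj P = mat 2" "cadj P ** P = mat 2"
          and inter: "\<And>i. \<sigma> (so3_basis i) ** P = P ** rep_sum3 \<rho>3 \<rho>3 \<rho>3 (so3_basis i)"
        by (auto simp: rep_sum3_def)
      \<comment> \<open>Since P is sqrt 2 times a unitary map, half its adjoint is its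
        inverse.\<close>
      have "P ** ((1/2) *\<^sub>R cadj P) = mat 1" "((1/2) *\<^sub>R cadj P) ** P = mat 1"
        by (simp_all add: matrix_scaleR_left matrix_scaleR_right P vec_eq_iff mat_def scaleR_complex)
      then have "invertible P"
        unfolding invertible_def by blast
      moreover have "so3_rep \<sigma>"
        using \<sigma> by (simp add: induced_rep_at_pole_def)
      ultimately have "rep_isomorphic \<sigma> (rep_sum3 \<rho>3 \<rho>3 \<rho>3)"
        using so3_rep_sum3 [OF reps(2) reps(2) reps(2)] inter by (intro rep_isomorphic_so3I)
      with \<sigma> show "\<exists>\<sigma>. induced_rep_at_pole (ansatz \<rho>5 \<rho>3 B3 B1 f1' f2' g0' g1') {-1<..<1} s \<sigma>
        \<and> rep_isomorphic \<sigma> (rep_sum3 \<rho>3 \<rho>3 \<rho>3)"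
        unfolding explicit by blast
    qed
  qed
qed

end
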